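(* Suppose that $\phi^0:\Omega\to\mathbb{R}$ satisfies $\phi^0>0$ on $\Omega^+(0)$, $\phi^0<0$ on $\Omega^-(0)$, $\{x\in\Omega\mid\phi^0(x)=0\}=\Sigma(0)$ and $\nabla\phi^0\neq0$ on $\Sigma(0)$, and that $\phi^0$ is $C^2$-smooth with $|\nabla\phi^0|\equiv1$ in a neighborhood of $\Sigma(0)$. Then there exist a ($t$-global) tubular neighborhood $\Theta$ of $\{\Sigma(t)\}_{t\ge0}$ and a $C^2$-function $\phi:\Theta\to\mathbb{R}$ such that (a) $\frac{\partial\phi}{\partial t}(t,x)+v\big(t,x-\phi(t,x)\nabla\phi(t,x)\big)\cdot\nabla\phi(t,x)=0$ in $\Theta|_{t>0}$, $\phi=\phi^0$ on $\Theta|_{t=0}$, $|\nabla\phi|\equiv1$ in $\Theta$, and $\phi(t,\cdot)>0$ in $\Theta\cap\Omega^+(t)$, $\phi(t,\cdot)<0$ in $\Theta\cap\Omega^-(t)$ for each $t\ge0$; and moreover (b) the map $(t,x)\mapsto\mathcal{P}^tx$ is single-valued and $C^1$-smooth in $\Theta$; (c) $\phi$ solves the linear transport equation with extended velocity $\tilde v(t,x):=v(t,\mathcal{P}^tx)$, that is, $$\frac{\partial\phi}{\partial t}(t,x)+\tilde v(t,x)\cdot\nabla\phi(t,x)=0\ \text{ in }\Theta|_{t>0},\qquad\phi=\phi^0\ \text{ on }\Theta|_{t=0};$$ (d) for each $t\ge0$, $\phi(t,\cdot)$ is the local signed distance function of $\Sigma(t)$.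
   Context: Setting. $\Omega\subset\mathbb{R}^3$ is a bounded connected open set and $v=v(t,x):[0,\infty)\times\bar\Omega\to\mathbb{R}^3$ is a given function satisfying: (H1) $v\in C^0([0,\infty)\times\bar\Omega;\mathbb{R}^3)\cap C^1([0,\infty)\times\Omega;\mathbb{R}^3)$; $v$ is Lipschitz continuous in $x$ on $[0,\infty)\times\bar\Omega$; $v$ is twice partially differentiable in $x$; all of these partial derivatives of $v$ belong to $C^0([0,\infty)\times\Omega;\mathbb{R}^3)$. (H2) $\pm v(s,x)\in T_{\partial\Omega}(x)$ for all $(s,x)\in[0,\infty)\times\partial\Omega$, where $T_{\partial\Omega}(x):=\{z\in\mathbb{R}^3\mid\liminf_{h\to0+}\mathrm{dist}(x+hz,\partial\Omega)/h=0\}$. No regularity of $\partial\Omega$ is assumed. $X(s,\tau,\xi)$ denotes the flow of $x'(s)=v(s,x(s))$, i.e. $s\mapsto X(s,\tau,\xi)$ is the unique solution with $x(\tau)=\xi$; by (H1), (H2), $\Omega$ and $\partial\Omega$ are forward and backward flow invariant for times in $[0,\infty)$. $\Omega^+(0)\subset\Omega$ is a subdomain such that $\Sigma(0):=\partial\Omega^+(0)$ is a closed $C^2$-smooth surface with $\Sigma(0)\cap\partial\Omega=\emptyset$, and $\Omega^-(0):=\Omega\setminus(\Omega^+(0)\cup\Sigma(0))$. For $t\ge0$, $\Omega^\pm(t):=X(t,0,\Omega^\pm(0))$ and $\Sigma(t):=X(t,0,\Sigma(0))$ (the moving interface). For $\varepsilon>0$, $\Sigma_\varepsilon(t):=\bigcup_{x\in\Sigma(t)}\{y\in\mathbb{R}^3\mid|x-y|<\varepsilon\}$.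 A set $\Theta\subset[0,\infty)\times\Omega$ is a ($t$-global) tubular neighborhood of $\{\Sigma(t)\}_{t\ge0}$ if $\Theta\supset\bigcup_{t\ge0}(\{t\}\times\Sigma(t))$, the set $\{x\in\Omega\mid(t,x)\in\Theta\}$ is open for each $t\ge0$, and there is a nonincreasing function $\varepsilon:[0,\infty)\to\mathbb{R}_{>0}$ with $\{t\}\times\Sigma_{\varepsilon(t)}(t)\subset\Theta$ for all $t\ge0$. $\Theta|_{t>0}$ and $\Theta|_{t=0}$ denote the parts of $\Theta$ with $t>0$ and $t=0$; "in $\Theta\cap\Omega^\pm(t)$" refers to points $x\in\Omega^\pm(t)$ with $(t,x)\in\Theta$. $\nabla$ is the gradient in $x$. Solving the PDE includes that the spatial argument at which $v$ is evaluated lies where $v$ is defined. The metric projection onto $\Sigma(t)$ is the set-valued map $\mathcal{P}^tx:=\{\xi\in\Sigma(t)\mid|x-\xi|=\inf_{y\in\Sigma(t)}|x-y|\}$ for $x\in\Omega$, $t\ge0$; if $\mathcal{P}^tx=\{\xi\}$ is a singleton one writes $\mathcal{P}^tx=\xi$. That $\phi(t,\cdot)$ is the local signed distance function of $\Sigma(t)$ means that for every $x$ with $(t,x)\in\Theta$, $\phi(t,x)$ equals $+\min_{y\in\Sigma(t)}|x-y|$ if $x\in\Omega^+(t)$, $-\min_{y\in\Sigma(t)}|x-y|$ if $x\in\Omega^-(t)$, and $0$ if $x\in\Sigma(t)$. *)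

theory Defs
  imports "HOL-Analysis.Analysis"
begin

text \<open>
  Classes \<open>C\<^sup>1\<close> and \<open>C\<^sup>2\<close> on a set \<open>S\<close> that is relatively open in an ambient set \<open>A\<close>. Only
  \<open>A = UNIV\<close> and the closed half space \<open>A = {0..} \<times> UNIV\<close> of space-time points are used; in both
  cases relative openness makes the derivative within \<open>S\<close> unique. It is the usual derivative, except
  that on the half space the time derivative at \<open>t = 0\<close> is one-sided.
\<close>

definition C1_on :: "'a::real_normed_vector set \<Rightarrow> 'a set \<Rightarrow> ('a \<Rightarrow> 'b::real_normed_vector) \<Rightarrow> bool"
  where "C1_on A S f \<longleftrightarrow> openin (top_of_set A) S \<and>
    (\<exists>f' :: 'a \<Rightarrow> 'a \<Rightarrow>\<^sub>L 'b.
      (\<forall>p\<in>S. (f has_derivative blinfun_apply (f' p)) (at p within S)) \<and> continuous_on S f')"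

definition C2_on :: "'a::real_normed_vector set \<Rightarrow> 'a set \<Rightarrow> ('a \<Rightarrow> 'b::real_normed_vector) \<Rightarrow> bool"
  where "C2_on A S f \<longleftrightarrow> openin (top_of_set A) S \<and>
    (\<exists>f' :: 'a \<Rightarrow> 'a \<Rightarrow>\<^sub>L 'b.
      (\<forall>p\<in>S. (f has_derivative blinfun_apply (f' p)) (at p within S)) \<and> C1_on A S f')"

abbreviation spacetime :: "(real \<times> (real^3)) set"
  where "spacetime \<equiv> {0..} \<times> UNIV"

definition grad :: "(real^3 \<Rightarrow> real) \<Rightarrow> real^3 \<Rightarrow> real^3"
  where "grad f x = (THE D. GDERIV f x :> D)"

definition has_partial_x ::
    "(real \<times> (real^3) \<Rightarrow> real^3) \<Rightarrow> 3 \<Rightarrow> real^3 \<Rightarrow> real \<times> (real^3) \<Rightarrow> bool"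
  where "has_partial_x f i d p \<longleftrightarrow>
    ((\<lambda>h. f (fst p, snd p + h *\<^sub>R axis i 1)) has_vector_derivative d) (at 0)"

definition H1 :: "(real^3) set \<Rightarrow> (real \<times> (real^3) \<Rightarrow> real^3) \<Rightarrow> bool"
  where "H1 \<Omega> v \<longleftrightarrow>
    continuous_on ({0..} \<times> closure \<Omega>) v \<and>
    C1_on spacetime ({0..} \<times> \<Omega>) v \<and>
    (\<exists>L. \<forall>t\<ge>0. L-lipschitz_on (closure \<Omega>) (\<lambda>x. v (t, x))) \<and>
    (\<exists>d d2. \<forall>i j.
      (\<forall>p\<in>{0..} \<times> \<Omega>. has_partial_x v i (d i p) p \<and> has_partial_x (d i) j (d2 i j p) p) \<and>
      continuous_on ({0..} \<times> \<Omega>) (d i) \<and> continuous_on ({0..} \<times> \<Omega>) (d2 i j))"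

definition tangent_cone :: "(real^3) set \<Rightarrow> real^3 \<Rightarrow> (real^3) set"
  where "tangent_cone S x =
    {z. Liminf (at_right 0) (\<lambda>h. ereal (infdist (x + h *\<^sub>R z) S / h)) = 0}"

definition H2 :: "(real^3) set \<Rightarrow> (real \<times> (real^3) \<Rightarrow> real^3) \<Rightarrow> bool"
  where "H2 \<Omega> v \<longleftrightarrow> (\<forall>s\<ge>0. \<forall>x\<in>frontier \<Omega>.
    v (s, x) \<in> tangent_cone (frontier \<Omega>) x \<and> - v (s, x) \<in> tangent_cone (frontier \<Omega>) x)"

definition solution_through ::
    "(real^3) set \<Rightarrow> (real \<times> (real^3) \<Rightarrow> real^3) \<Rightarrow> real \<Rightarrow> real^3 \<Rightarrow> (real \<Rightarrow> real^3) \<Rightarrow> bool"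
  where "solution_through \<Omega> v \<tau> \<xi> x \<longleftrightarrow> x \<tau> = \<xi> \<and>
    (\<forall>s\<ge>0. x s \<in> closure \<Omega> \<and> (x has_vector_derivative v (s, x s)) (at s within {0..}))"

text \<open>
  The value at time \<open>s\<close> of the solution through \<open>(\<tau>, \<xi>)\<close>. For \<open>\<tau> \<ge> 0\<close> and \<open>\<xi> \<in> closure \<Omega>\<close>, existence
  and uniqueness (on \<open>{0..}\<close>) of that solution are consequences of \<open>H1\<close> and \<open>H2\<close>, not assumptions.
\<close>

definition flow ::
    "(real^3) set \<Rightarrow> (real \<times> (real^3) \<Rightarrow> real^3) \<Rightarrow> real \<Rightarrow> real \<Rightarrow> real^3 \<Rightarrow> real^3"
  where "flow \<Omega> v s \<tau> \<xi> = (THE y. \<exists>x. solution_through \<Omega> v \<tau> \<xi> x \<and> y = x s)"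

definition transported ::
    "(real^3) set \<Rightarrow> (real \<times> (real^3) \<Rightarrow> real^3) \<Rightarrow> (real^3) set \<Rightarrow> real \<Rightarrow> (real^3) set"
  where "transported \<Omega> v A t = flow \<Omega> v t 0 ` A"

text \<open>
  A compact embedded \<open>C\<^sup>2\<close> surface without boundary, described locally as a regular level set;
  connectedness is not required.
\<close>

definition closed_C2_surface :: "(real^3) set \<Rightarrow> bool"
  where "closed_C2_surface S \<longleftrightarrow> compact S \<and> S \<noteq> {} \<and>
    (\<forall>p\<in>S. \<exists>U (\<psi> :: real^3 \<Rightarrow> real). open U \<and> p \<in> U \<and> C2_on UNIV U \<psi> \<and>
      (\<forall>x\<in>U. grad \<psi> x \<noteq> 0) \<and> S \<inter> U = {x \<in> U. \<psi> x = 0})"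

definition tubular_neighborhood ::
    "(real^3) set \<Rightarrow> (real \<Rightarrow> (real^3) set) \<Rightarrow> (real \<times> (real^3)) set \<Rightarrow> bool"
  where "tubular_neighborhood \<Omega> \<Sigma> \<Theta> \<longleftrightarrow>
    \<Theta> \<subseteq> {0..} \<times> \<Omega> \<and>
    (\<Union>t\<in>{0..}. {t} \<times> \<Sigma> t) \<subseteq> \<Theta> \<and>
    (\<forall>t\<ge>0. open {x \<in> \<Omega>. (t, x) \<in> \<Theta>}) \<and>
    (\<exists>\<epsilon> :: real \<Rightarrow> real. (\<forall>t\<ge>0. 0 < \<epsilon> t) \<and> antimono_on {0..} \<epsilon> \<and>
      (\<forall>t\<ge>0. {t} \<times> (\<Union>x\<in>\<Sigma> t. ball x (\<epsilon> t)) \<subseteq> \<Theta>))"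

definition metric_projection :: "(real^3) set \<Rightarrow> real^3 \<Rightarrow> (real^3) set"
  where "metric_projection S x = {\<xi> \<in> S. norm (x - \<xi>) = (INF y\<in>S. norm (x - y))}"

definition min_distance :: "(real^3) set \<Rightarrow> real^3 \<Rightarrow> real"
  where "min_distance S x = (LEAST r. \<exists>y\<in>S. r = norm (x - y))"

end

theory Submission
  imports Defs
begin

text \<open>
  Tangency of \<open>\<plusminus> v\<close> to the boundary keeps trajectories inside \<open>\<Omega>\<close>, so the flow \<open>X t\<close> is defined for
  all times. A normal \<open>p\<close> of the moving interface evolves by the adjoint variational equation
  \<open>p' = - (Dv)\<^sup>T p\<close>. The pair \<open>(X, p)\<close> solves an ordinary differential equation with a right-hand side
  of class \<open>C\<^sup>1\<close> in the state; therefore the unit normal \<open>\<nu> = p / |p|\<close> is \<open>C\<^sup>1\<close> jointly in time and in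
  the initial point.

  A nearest point of the interface to \<open>x\<close> is a solution \<open>(y, r)\<close> of \<open>x = X t y + r \<nu> t y\<close>, \<open>\<phi>0 y = 0\<close>.
  Compactness, uniformly on bounded time intervals, gives uniqueness for small \<open>r\<close>, and the implicit
  function theorem makes \<open>(y, r)\<close> a \<open>C\<^sup>1\<close> function of \<open>(t, x)\<close>. With \<open>\<phi> = r\<close> and foot point \<open>P = X t y\<close>,
  differentiating \<open>x = P + \<phi> \<nu>\<close> and pairing with \<open>\<nu>\<close> yields \<open>\<nabla>\<phi> = \<nu>\<close> and
  \<open>\<partial>\<phi>/\<partial>t = - v (t, P) \<bullet> \<nu>\<close>. Both are \<open>C\<^sup>1\<close>, so \<open>\<phi>\<close> is \<open>C\<^sup>2\<close>, although the implicit function theorem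
  alone gives only \<open>C\<^sup>1\<close>. At \<open>t = 0\<close> one has \<open>\<phi> = \<phi>0\<close> because the gradient of an eikonal function is
  constant along its normal lines.
\<close>

section \<open>Differential inequalities and Lipschitz differential equations\<close>

text \<open>No regularity of the boundary is available, so invariance of \<open>\<Omega>\<close>
  cannot be read off from normals. Instead the distance to \<open>frontier \<Omega>\<close> is
  controlled along trajectories of a Lipschitz extension of \<open>v\<close>, by a Gronwall
  inequality that asks for progress along some arbitrarily small step, which is all that the limit
  inferior in the tangent cone provides.

  One inequality, \<open>c * norm (z - z') \<le> norm (H (t, z) - H (t, z'))\<close> near
  \<open>\<Sigma>0 \<times> {0}\<close>, serves three purposes: uniqueness of nearest points,
  Lipschitz dependence of \<open>(y, r)\<close> on \<open>(t, x)\<close>, and invertibility of the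
  derivative of \<open>H\<close> at \<open>r \<noteq> 0\<close>. At \<open>r = 0\<close> that
  invertibility is checked directly: the pairing of \<open>p\<close> with the linearized flow is
  constant in time, so it equals the pairing of the initial normal with the initial vector.\<close>

lemma has_vector_derivative_within_bound:
  fixes u :: "real \<Rightarrow> 'a::real_normed_vector"
  assumes "(u has_vector_derivative D) (at t within S)" "e > 0"
  obtains d where "d > 0" "\<And>s. s \<in> S \<Longrightarrow> \<bar>s - t\<bar> < d \<Longrightarrow> norm (u s - u t - (s - t) *\<^sub>R D) \<le> e * \<bar>s - t\<bar>"
  using assms unfolding has_vector_derivative_def has_derivative_within_alt
  by (metis real_norm_def)

text \<open>The hypothesis \<open>step\<close> asks for one small \<open>h\<close> at each time,
  below any prescribed \<delta>; this covers functions such as distances, for which only a lower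
  Dini derivative is controlled. After weighting by \<open>exp (- (a * t))\<close>, the last time at
  which the function lies under the line of slope \<open>b + \<eta>\<close> cannot come before
  \<open>T\<close>.\<close>

lemma dini_gronwall:
  fixes e :: "real \<Rightarrow> real"
  assumes T: "0 \<le> T" and cont: "continuous_on {0..T} e"
    and nonneg: "\<And>t. t \<in> {0..T} \<Longrightarrow> 0 \<le> e t" and "0 \<le> a" "0 \<le> b"
    and step: "\<And>t \<eta> \<delta>. 0 \<le> t \<Longrightarrow> t < T \<Longrightarrow> 0 < \<eta> \<Longrightarrow> 0 < \<delta> \<Longrightarrow> \<delta> \<le> T - t \<Longrightarrow>
      \<exists>h>0. h < \<delta> \<and> e (t + h) \<le> e t + h * (a * e t + b + \<eta>)"
  shows "e T \<le> exp (a * T) * (e 0 + b * T)"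
proof -
  define f where "f t = exp (- (a * t)) * e t" for t
  have contf: "continuous_on {0..T} f"
    unfolding f_def by (intro continuous_intros cont)
  have fT: "f T \<le> e 0 + b * T + \<eta> * T" if \<eta>: "\<eta> > 0" for \<eta>
  proof -
    define S where "S = {0..T} \<inter> (\<lambda>t. f t - (b + \<eta>) * t) -` {..e 0}"
    have "closed S"
      unfolding S_def by (intro continuous_closed_preimage continuous_intros contf)
    moreover have "0 \<in> S" using T by (simp add: S_def f_def)
    moreover have bdd: "bdd_above S" by (auto simp: S_def bdd_above_def)
    ultimately have s: "Sup S \<in> S" using closed_contains_Sup by blast
    define s where "s = Sup S"
    have s': "0 \<le> s" "s \<le> T" "f s \<le> e 0 + (b + \<eta>) * s" using s by (auto simp: S_def s_def)
    have "s = T"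
    proof (rule ccontr)
      assume "s \<noteq> T"
      then have "s < T" using s' by simp
      then obtain h where h: "h > 0" "h < T - s" "e (s + h) \<le> e s + h * (a * e s + b + \<eta>)"
        using step[of s \<eta> "T - s"] s' \<eta> by auto
      have es: "0 \<le> e s" using nonneg s' by auto
      have "f (s + h) \<le> exp (- (a * (s + h))) * (e s * (1 + a * h) + h * (b + \<eta>))"
        unfolding f_def using h(3) by (intro mult_left_mono) (auto simp: algebra_simps)
      also have "\<dots> = exp (- (a * s)) * e s * (exp (- (a * h)) * (1 + a * h))
          + exp (- (a * (s + h))) * (h * (b + \<eta>))"
        by (simp add: algebra_simps exp_add exp_diff exp_minus field_simps)
      also have "\<dots> \<le> exp (- (a * s)) * e s * 1 + 1 * (h * (b + \<eta>))"
      proof (intro add_mono mult_left_mono mult_right_mono)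
        show "exp (- (a * h)) * (1 + a * h) \<le> 1"
          using exp_ge_add_one_self[of "a * h"] by (simp add: exp_minus field_simps)
        show "exp (- (a * (s + h))) \<le> 1" using h s' \<open>0 \<le> a\<close> by simp
      qed (use es h \<eta> \<open>0 \<le> b\<close> in auto)
      also have "\<dots> \<le> e 0 + (b + \<eta>) * (s + h)" using s'(3) by (simp add: f_def algebra_simps)
      finally have "s + h \<in> S" using h s' by (simp add: S_def algebra_simps)
      then have "s + h \<le> s" unfolding s_def by (intro cSup_upper bdd)
      then show False using h by simp
    qed
    then show ?thesis using s' by (simp add: algebra_simps)
  qed
  have "f T \<le> e 0 + b * T"
  proof (rule field_le_epsilon)
    fix \<epsilon> :: real assume "0 < \<epsilon>"
    then have "f T \<le> e 0 + b * T + \<epsilon> / (T + 1) * T" using T by (intro fT) auto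
    also have "\<epsilon> / (T + 1) * T \<le> \<epsilon>" using T \<open>0 < \<epsilon>\<close> by (simp add: field_simps)
    finally show "f T \<le> e 0 + b * T + \<epsilon>" by simp
  qed
  then have "exp (a * T) * f T \<le> exp (a * T) * (e 0 + b * T)" by simp
  then show ?thesis by (simp add: f_def exp_minus field_simps)
qed

text \<open>The norm need not be differentiable at zeros of \<open>u\<close>, hence the detour
  through \<open>dini_gronwall\<close>; the first-order expansion of \<open>u\<close> supplies its
  step.\<close>

lemma gronwall_norm:
  fixes u :: "real \<Rightarrow> 'a::real_normed_vector"
  assumes der: "\<And>t. t \<in> {0..T} \<Longrightarrow> (u has_vector_derivative u' t) (at t within {0..T})"
    and bound: "\<And>t. t \<in> {0..T} \<Longrightarrow> norm (u' t) \<le> a * norm (u t) + b"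
    and "0 \<le> a" "0 \<le> b" and t: "t \<in> {0..T}"
  shows "norm (u t) \<le> exp (a * t) * (norm (u 0) + b * t)"
proof (rule dini_gronwall)
  have "continuous_on {0..T} u"
    using der by (meson continuous_on_vector_derivative)
  then show "continuous_on {0..t} (\<lambda>t. norm (u t))"
    using t by (intro continuous_intros) (auto intro: continuous_on_subset)
next
  fix s \<eta> \<delta> :: real
  assume s: "0 \<le> s" "s < t" "0 < \<eta>" "0 < \<delta>" "\<delta> \<le> t - s"
  then have sT: "s \<in> {0..T}" using t by auto
  obtain d where d: "d > 0" "\<And>r. r \<in> {0..T} \<Longrightarrow> \<bar>r - s\<bar> < d \<Longrightarrow>
      norm (u r - u s - (r - s) *\<^sub>R u' s) \<le> \<eta> * \<bar>r - s\<bar>"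
    using has_vector_derivative_within_bound[OF der[OF sT] \<open>0 < \<eta>\<close>] by blast
  define h where "h = min d \<delta> / 2"
  have h: "h > 0" "h < d" "h < \<delta>" using d s by (auto simp: h_def)
  have "norm (u (s + h) - u s - h *\<^sub>R u' s) \<le> \<eta> * h"
    using d(2)[of "s + h"] h s t by auto
  then have "norm (u (s + h)) \<le> norm (u s) + h * norm (u' s) + \<eta> * h"
    using norm_triangle_ineq[of "u (s + h) - u s - h *\<^sub>R u' s" "u s + h *\<^sub>R u' s"]
      norm_triangle_ineq[of "u s" "h *\<^sub>R u' s"] h by (simp add: algebra_simps)
  also have "h * norm (u' s) \<le> h * (a * norm (u s) + b)"
    using bound[OF sT] h by simp
  finally show "\<exists>h>0. h < \<delta> \<and> norm (u (s + h)) \<le> norm (u s) + h * (a * norm (u s) + b + \<eta>)"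
    using h by (intro exI[of _ h]) (auto simp: algebra_simps)
qed (use assms in auto)

text \<open>A finite subcover of \<open>K\<close> gives a common \<open>c\<close>, and
  \<open>mono\<close> passes from the constants of the cover to their minimum. The points
  \<open>x\<close> may lie outside \<open>K\<close>: the conclusion covers a whole metric
  neighborhood.\<close>

lemma compact_uniform_nbhd:
  fixes K :: "'a::metric_space set" and P :: "real \<Rightarrow> 'a \<Rightarrow> bool"
  assumes K: "compact K"
    and loc: "\<And>k. k \<in> K \<Longrightarrow> \<exists>d>0. \<exists>c>0. \<forall>x. dist k x < d \<longrightarrow> P c x"
    and mono: "\<And>c c' x. P c x \<Longrightarrow> 0 < c' \<Longrightarrow> c' \<le> c \<Longrightarrow> P c' x"
  obtains d c where "d > 0" "c > 0" "\<And>k x. k \<in> K \<Longrightarrow> dist k x < d \<Longrightarrow> P c x"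
proof -
  obtain d c where dc: "\<And>k. k \<in> K \<Longrightarrow> d k > (0::real) \<and> c k > (0::real) \<and> (\<forall>x. dist k x < d k \<longrightarrow> P (c k) x)"
    using loc by metis
  have "\<forall>k\<in>K. open (ball k (d k))" "K \<subseteq> (\<Union>k\<in>K. ball k (d k))" using dc by auto
  then obtain C where C: "C \<subseteq> K" "finite C" "K \<subseteq> (\<Union>k\<in>C. ball k (d k))"
    using compactE_image[OF K, of K "\<lambda>k. ball k (d k)"] by metis
  define U where "U = (\<Union>k\<in>C. ball k (d k))"
  obtain r where r: "r > 0" "(\<Union>x\<in>K. ball x r) \<subseteq> U"
    using compact_subset_open_imp_ball_epsilon_subset[OF K, of U] C unfolding U_def by blast
  \<comment> \<open>The element 1 keeps the set nonempty when \<open>K\<close> is empty.\<close>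
  define m where "m = Min (insert 1 (c ` C))"
  have m: "m > 0" "\<And>k. k \<in> C \<Longrightarrow> m \<le> c k" using C dc unfolding m_def by (auto simp: Min_gr_iff)
  have "P m x" if "k \<in> K" "dist k x < r" for k x
  proof -
    have "x \<in> U" using that r(2) by (auto simp: subset_eq)
    then obtain k' where "k' \<in> C" "dist k' x < d k'" unfolding U_def by auto
    then show ?thesis using dc m mono C(1) by blast
  qed
  then show ?thesis using that r(1) m(1) by blast
qed

section \<open>Existence and uniqueness for differential equations with Lipschitz right-hand
  side\<close>

lemma continuous_on_lipschitz_compose:
  fixes F :: "real \<Rightarrow> 'a::real_normed_vector \<Rightarrow> 'b::real_normed_vector"
  assumes cont: "\<And>x. x \<in> C \<Longrightarrow> continuous_on S (\<lambda>t. F t x)"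
    and lip: "\<And>t. t \<in> S \<Longrightarrow> L-lipschitz_on C (F t)"
    and x: "continuous_on S x" "\<And>t. t \<in> S \<Longrightarrow> x t \<in> C"
  shows "continuous_on S (\<lambda>t. F t (x t))"
  unfolding continuous_on_def
proof
  fix s assume s: "s \<in> S"
  have "((\<lambda>t. L * norm (x t - x s) + norm (F t (x s) - F s (x s))) \<longlongrightarrow> L * norm (x s - x s) + norm (F s (x s) - F s (x s)))
      (at s within S)"
    using x cont[OF x(2)[OF s]] s by (intro tendsto_intros) (auto simp: continuous_on_def)
  then have *: "((\<lambda>t. L * norm (x t - x s) + norm (F t (x s) - F s (x s))) \<longlongrightarrow> 0) (at s within S)" by simp
  have "norm (F t (x t) - F s (x s)) \<le> L * norm (x t - x s) + norm (F t (x s) - F s (x s))" if "t \<in> S" for t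
    using lipschitz_on_normD[OF lip[OF that] x(2)[OF that] x(2)[OF s]]
      norm_triangle_ineq[of "F t (x t) - F t (x s)" "F t (x s) - F s (x s)"] by simp
  then have "((\<lambda>t. F t (x t) - F s (x s)) \<longlongrightarrow> 0) (at s within S)"
    by (intro Lim_null_comparison[OF _ *]) (auto simp: eventually_at_filter)
  then show "((\<lambda>t. F t (x t)) \<longlongrightarrow> F s (x s)) (at s within S)" by (simp add: LIM_zero_iff)
qed

text \<open>The exponential weight in the sup norm makes the Picard operator a contraction on all of \<open>[0, T]\<close>.\<close>

lemma lipschitz_ode_exists:
  fixes F :: "real \<Rightarrow> 'a::banach \<Rightarrow> 'a"
  assumes T: "0 \<le> T" and cont: "\<And>x. continuous_on {0..T} (\<lambda>t. F t x)"
    and lip: "\<And>t. t \<in> {0..T} \<Longrightarrow> L-lipschitz_on UNIV (F t)"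
  shows "\<exists>x. x 0 = \<xi> \<and> (\<forall>t\<in>{0..T}. (x has_vector_derivative F t (x t)) (at t within {0..T}))"
proof -
  have L: "0 \<le> L" using lip[of 0] T lipschitz_on_nonneg by auto
  \<comment> \<open>Any \<open>K > L\<close> makes \<open>L / K\<close> a contraction factor; the
    summand 1 keeps \<open>K\<close> positive when \<open>L = 0\<close>.\<close>
  define K where "K = 2 * L + 1"
  have K: "K > 0" "L / K < 1" "0 \<le> L / K" using L by (auto simp: K_def)
  \<comment> \<open>The fixed point \<open>f\<close> is the solution rescaled by
    \<open>exp (- (K * s))\<close>, so the plain sup norm of \<open>f\<close> is a weighted norm of
    the solution.\<close>
  define G where "G f s = F s (exp (K * s) *\<^sub>R f s)" for f :: "real \<Rightarrow> 'a" and s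
  \<comment> \<open>Clamping time to \<open>[0, T]\<close> turns functions on the interval into
    bounded continuous functions on the line, which form a complete space.\<close>
  define cl where "cl t = max 0 (min T t)" for t
  have cl: "cl t \<in> {0..T}" for t using T by (auto simp: cl_def)
  have clid: "cl t = t" if "t \<in> {0..T}" for t using that by (auto simp: cl_def)
  have G_cont: "continuous_on {0..T} (G f)" if "continuous_on UNIV f" for f
    unfolding G_def
    by (rule continuous_on_lipschitz_compose[of UNIV, OF cont lip])
       (auto intro!: continuous_intros continuous_on_subset[OF that])
  define J where "J f t = exp (- (K * t)) *\<^sub>R (\<xi> + integral {0..t} (G f))" for f t
  have J_cont: "continuous_on {0..T} (J f)" if "continuous_on UNIV f" for f
    unfolding J_def
    by (intro continuous_intros indefinite_integral_continuous_1 integrable_continuous_interval G_cont that)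
  have J_bc: "(\<lambda>t. J f (cl t)) \<in> bcontfun" if "continuous_on UNIV f" for f
  proof -
    have c: "continuous_on UNIV cl" unfolding cl_def by (intro continuous_intros)
    have "continuous_on UNIV (\<lambda>t. J f (cl t))"
      using cl by (intro continuous_on_compose2[OF J_cont[OF that] c]) blast
    moreover have "bounded (J f ` {0..T})"
      by (intro compact_imp_bounded compact_continuous_image J_cont that compact_Icc)
    then have "bounded (range (\<lambda>t. J f (cl t)))"
      by (rule bounded_subset) (use cl in auto)
    ultimately show ?thesis by (simp add: bcontfun_def)
  qed
  define \<Phi> where "\<Phi> f = Bcontfun (\<lambda>t. J (apply_bcontfun f) (cl t))" for f :: "real \<Rightarrow>\<^sub>C 'a"
  have ac: "continuous_on UNIV (apply_bcontfun f)" for f :: "real \<Rightarrow>\<^sub>C 'a" by simp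
  have \<Phi>: "apply_bcontfun (\<Phi> f) t = J (apply_bcontfun f) (cl t)" for f t
    unfolding \<Phi>_def using J_bc[OF ac] by (simp add: Bcontfun_inverse)
  have "dist (\<Phi> f) (\<Phi> g) \<le> L / K * dist f g" for f g
  proof (rule dist_bound)
    fix t0
    define t where "t = cl t0"
    have t: "t \<in> {0..T}" using cl by (simp add: t_def)
    have GI: "G (apply_bcontfun h) integrable_on {0..t}" for h
      using t by (intro integrable_continuous_interval continuous_on_subset[OF G_cont[OF ac]]) auto
    have "norm (integral {0..t} (\<lambda>s. G f s - G g s)) \<le> integral {0..t} (\<lambda>s. L * dist f g * exp (K * s))"
    proof (rule integral_norm_bound_integral)
      show "(\<lambda>s. G f s - G g s) integrable_on {0..t}" by (intro integrable_diff GI)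
      show "(\<lambda>s. L * dist f g * exp (K * s)) integrable_on {0..t}"
        by (intro integrable_continuous_interval continuous_intros)
      fix s assume "s \<in> {0..t}"
      then have "s \<in> {0..T}" using t by auto
      then have "norm (G f s - G g s) \<le> L * norm (exp (K * s) *\<^sub>R f s - exp (K * s) *\<^sub>R g s)"
        unfolding G_def using lipschitz_on_normD[OF lip] by auto
      also have "\<dots> = L * exp (K * s) * dist (f s) (g s)"
        by (simp add: dist_norm flip: scaleR_diff_right)
      also have "\<dots> \<le> L * exp (K * s) * dist f g"
        using L by (intro mult_left_mono dist_bounded) auto
      finally show "norm (G f s - G g s) \<le> L * dist f g * exp (K * s)" by (simp add: mult_ac)
    qed
    also have "integral {0..t} (\<lambda>s. L * dist f g * exp (K * s)) = L * dist f g * exp (K * t) / K - L * dist f g * exp (K * 0) / K"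
      using t K by (intro integral_unique fundamental_theorem_of_calculus)
        (auto intro!: derivative_eq_intros simp: has_real_derivative_iff_has_vector_derivative[symmetric])
    also have "\<dots> \<le> L * dist f g * exp (K * t) / K" using L K by simp
    finally have "exp (- (K * t)) * norm (integral {0..t} (G f) - integral {0..t} (G g)) \<le>
        exp (- (K * t)) * (L * dist f g * exp (K * t) / K)"
      using GI by (intro mult_left_mono) (simp_all add: integral_diff)
    also have "\<dots> = L / K * dist f g"
      by (simp add: exp_minus)
    finally have "exp (- (K * t)) * norm (integral {0..t} (G f) - integral {0..t} (G g)) \<le> L / K * dist f g" .
    moreover have "J f t - J g t = exp (- (K * t)) *\<^sub>R (integral {0..t} (G f) - integral {0..t} (G g))"
      by (simp add: J_def scaleR_add_right scaleR_diff_right)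
    ultimately show "dist (\<Phi> f t0) (\<Phi> g t0) \<le> L / K * dist f g"
      by (simp only: \<Phi> t_def[symmetric] dist_norm) simp
  qed
  then have "\<exists>!f. \<Phi> f = f" using K by (intro banach_fix_type[of "L / K"]) auto
  then obtain f where f: "\<Phi> f = f" by blast
  define x where "x t = exp (K * t) *\<^sub>R f t" for t
  have x: "x t = \<xi> + integral {0..t} (\<lambda>s. F s (x s))" if "t \<in> {0..T}" for t
  proof -
    have "f t = J f t" using \<Phi>[of f t] f clid[OF that] by simp
    then show ?thesis by (simp add: x_def J_def G_def[abs_def] exp_minus)
  qed
  show ?thesis
  proof (intro exI[of _ x] conjI ballI)
    show "x 0 = \<xi>" using x[of 0] T by simp
    fix t assume t: "t \<in> {0..T}"
    have "continuous_on {0..T} (\<lambda>s. F s (x s))" using G_cont[OF ac, of f] by (simp add: G_def[abs_def] x_def)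
    from integral_has_vector_derivative[OF this t]
    have "((\<lambda>u. \<xi> + integral {0..u} (\<lambda>s. F s (x s))) has_vector_derivative F t (x t)) (at t within {0..T})"
      using has_vector_derivative_add[OF has_vector_derivative_const] by fastforce
    then show "(x has_vector_derivative F t (x t)) (at t within {0..T})"
      by (rule has_vector_derivative_transform[OF t, rotated -1]) (simp add: x)
  qed
qed

text \<open>A stability estimate; uniqueness is the case of equal initial values. The Lipschitz
  condition is asked on a set \<open>C\<close> containing both trajectories, so that the estimate
  applies to \<open>v\<close> itself on \<open>closure \<Omega>\<close>.\<close>

lemma ode_unique:
  fixes F :: "real \<Rightarrow> 'a::real_normed_vector \<Rightarrow> 'a"
  assumes x: "\<And>t. t \<in> {0..T} \<Longrightarrow> (x has_vector_derivative F t (x t)) (at t within {0..T})"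
    and y: "\<And>t. t \<in> {0..T} \<Longrightarrow> (y has_vector_derivative F t (y t)) (at t within {0..T})"
    and lip: "\<And>t. t \<in> {0..T} \<Longrightarrow> L-lipschitz_on C (F t)"
    and C: "\<And>t. t \<in> {0..T} \<Longrightarrow> x t \<in> C" "\<And>t. t \<in> {0..T} \<Longrightarrow> y t \<in> C"
    and t: "t \<in> {0..T}"
  shows "norm (x t - y t) \<le> exp (L * t) * norm (x 0 - y 0)"
proof -
  have "norm ((\<lambda>t. x t - y t) t) \<le> exp (L * t) * (norm ((\<lambda>t. x t - y t) 0) + 0 * t)"
  proof (rule gronwall_norm[of T _ "\<lambda>t. F t (x t) - F t (y t)" L 0])
    show "0 \<le> L" using lip[OF t] lipschitz_on_nonneg by blast
  qed (use t in \<open>auto intro!: has_vector_derivative_diff x y lipschitz_on_normD[OF lip] C\<close>)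
  then show ?thesis by simp
qed

lemma has_vector_derivative_within_Ici_Icc:
  fixes t T :: real
  assumes "0 \<le> t" "t < T"
  shows "(x has_vector_derivative D) (at t within {0..T}) \<longleftrightarrow> (x has_vector_derivative D) (at t within {0..})"
proof -
  have "at t within {0..T} = at t within {0..}"
    using assms by (intro at_within_nhd[of t "{..<T}"]) auto
  then show ?thesis by simp
qed

text \<open>The Lipschitz constant may grow with the time horizon, as for the linear variational
  equations, whose coefficients are bounded on bounded time intervals. Solutions on nested intervals
  agree by uniqueness and are glued.\<close>

lemma lipschitz_ode_exists_global:
  fixes F :: "real \<Rightarrow> 'a::banach \<Rightarrow> 'a"
  assumes cont: "\<And>x. continuous_on {0..} (\<lambda>t. F t x)"
    and lip: "\<And>t T. 0 \<le> t \<Longrightarrow> t \<le> T \<Longrightarrow> (L T)-lipschitz_on UNIV (F t)"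
  shows "\<exists>x. x 0 = \<xi> \<and> (\<forall>t\<ge>0. (x has_vector_derivative F t (x t)) (at t within {0..}))"
proof -
  have "\<exists>x. x 0 = \<xi> \<and> (\<forall>t\<in>{0..T}. (x has_vector_derivative F t (x t)) (at t within {0..T}))" if "0 \<le> T" for T
    by (rule lipschitz_ode_exists[OF that, of F "L T"])
      (auto intro: continuous_on_subset[OF cont] lip)
  then obtain z where z: "\<And>T. 0 \<le> T \<Longrightarrow> z T 0 = \<xi>"
    "\<And>T t. 0 \<le> t \<Longrightarrow> t \<le> T \<Longrightarrow> (z T has_vector_derivative F t (z T t)) (at t within {0..T})"
    by (metis atLeastAtMost_iff order_trans)
  have agree: "z S t = z T t" if "0 \<le> t" "t \<le> S" "S \<le> T" for S T t
  proof -
    have "norm (z S t - z T t) \<le> exp (L S * t) * norm (z S 0 - z T 0)"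
    proof (rule ode_unique[of S _ F _ _ UNIV])
      fix s assume s: "s \<in> {0..S}"
      then show "(z S has_vector_derivative F s (z S s)) (at s within {0..S})" using z(2) by auto
      have "(z T has_vector_derivative F s (z T s)) (at s within {0..T})" using z(2) s that by auto
      then show "(z T has_vector_derivative F s (z T s)) (at s within {0..S})"
        by (rule has_vector_derivative_within_subset) (use that in auto)
      show "(L S)-lipschitz_on UNIV (F s)" using lip s by auto
    qed (use that in auto)
    then show ?thesis using that z(1) by simp
  qed
  \<comment> \<open>At time \<open>t\<close> the solution on \<open>[0, t + 1]\<close> is taken, so
    that \<open>t\<close> is not the right end point and differentiability within
    \<open>[0, t + 1]\<close> is the same as within the half line.\<close>
  define x where "x t = z (t + 1) t" for t
  have x: "x s = z (t + 1) s" if "0 \<le> s" "s \<le> t + 1" for s t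
  proof (cases "s \<le> t")
    case True
    then show ?thesis using agree[of s "s + 1" "t + 1"] that(1) by (simp add: x_def)
  next
    case False
    then show ?thesis using agree[of s "t + 1" "s + 1"] that by (simp add: x_def)
  qed
  show ?thesis
  proof (intro exI[of _ x] conjI allI impI)
    show "x 0 = \<xi>" using z(1)[of 1] by (simp add: x_def)
    fix t :: real assume t: "0 \<le> t"
    have "(z (t + 1) has_vector_derivative F t (x t)) (at t within {0..t + 1})"
      using z(2)[of t "t + 1"] t by (simp add: x_def)
    then have "(x has_vector_derivative F t (x t)) (at t within {0..t + 1})"
      by (rule has_vector_derivative_transform[rotated -1]) (use t x in auto)
    then show "(x has_vector_derivative F t (x t)) (at t within {0..})"
      using has_vector_derivative_within_Ici_Icc[OF t, of "t + 1" x "F t (x t)"] by simp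
  qed
qed

section \<open>Differentiable dependence on initial data\<close>

text \<open>A bootstrap: an estimate available as long as \<open>u\<close> has not exceeded
  \<open>r\<close> gives the strict bound, so a first time with \<open>u \<ge> r\<close> cannot
  exist. It keeps neighboring trajectories in the tube where the linearization is
  controlled.\<close>

lemma continuous_barrier:
  fixes u :: "real \<Rightarrow> real"
  assumes cont: "continuous_on {0..T} u" and "u 0 < r"
    and step: "\<And>t. t \<in> {0..T} \<Longrightarrow> (\<And>s. s \<in> {0..t} \<Longrightarrow> u s \<le> r) \<Longrightarrow> u t < r"
    and t: "t \<in> {0..T}"
  shows "u t < r"
proof (rule ccontr)
  assume "\<not> u t < r"
  define S where "S = {0..T} \<inter> u -` {r..}"
  have "closed S" unfolding S_def by (intro continuous_closed_preimage cont) auto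
  moreover have "S \<noteq> {}" using t \<open>\<not> u t < r\<close> by (auto simp: S_def)
  moreover have "bdd_below S" by (auto simp: S_def bdd_below_def)
  ultimately have "Inf S \<in> S" using closed_contains_Inf by blast
  define t1 where "t1 = Inf S"
  have t1: "t1 \<in> {0..T}" "r \<le> u t1" using \<open>Inf S \<in> S\<close> by (auto simp: S_def t1_def)
  have below: "u s < r" if "0 \<le> s" "s < t1" for s
  proof (rule ccontr)
    assume "\<not> u s < r"
    then have "s \<in> S" using that t1 by (auto simp: S_def)
    then show False using cInf_lower[OF _ \<open>bdd_below S\<close>] that by (force simp: t1_def)
  qed
  have "u t1 \<le> r"
  proof (rule ccontr)
    assume "\<not> u t1 \<le> r"
    then obtain s where s: "0 \<le> s" "s \<le> t1" "u s = r"
      using IVT'[of u 0 r t1] \<open>u 0 < r\<close> t1 continuous_on_subset[OF cont, of "{0..t1}"] by auto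
    then have "s \<noteq> t1" using \<open>\<not> u t1 \<le> r\<close> by auto
    then show False using below[of s] s by auto
  qed
  then have "u s \<le> r" if "s \<in> {0..t1}" for s
    using below[of s] that by (cases "s = t1") auto
  from step[OF t1(1) this] show False using t1 by simp
qed

text \<open>The flow \<open>Z\<close> is given, and its differentiability is what is proved. The
  setting is abstract because it is used twice: for \<open>v\<close> itself, and for the coupled
  system of trajectory and costate. \<open>V\<close> holds the initial points, \<open>U\<close> the
  states.\<close>

locale C1_flow =
  fixes F :: "real \<Rightarrow> 'a::euclidean_space \<Rightarrow> 'a"
    and A :: "real \<Rightarrow> 'a \<Rightarrow> 'a \<Rightarrow>\<^sub>L 'a"
    and Z :: "real \<Rightarrow> 'a \<Rightarrow> 'a"
    and U V :: "'a set"
  assumes U: "open U" and V: "open V"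
    and F_deriv: "\<And>t z. 0 \<le> t \<Longrightarrow> z \<in> U \<Longrightarrow> (F t has_derivative A t z) (at z)"
    and A_cont: "continuous_on ({0..} \<times> U) (\<lambda>(t, z). A t z)"
    and Z_init: "\<And>\<xi>. \<xi> \<in> V \<Longrightarrow> Z 0 \<xi> = \<xi>"
    and Z_in: "\<And>t \<xi>. 0 \<le> t \<Longrightarrow> \<xi> \<in> V \<Longrightarrow> Z t \<xi> \<in> U"
    and Z_deriv: "\<And>t \<xi>. 0 \<le> t \<Longrightarrow> \<xi> \<in> V \<Longrightarrow>
      ((\<lambda>s. Z s \<xi>) has_vector_derivative F t (Z t \<xi>)) (at t within {0..})"
begin

lemma Z_deriv_Icc:
  assumes "t \<in> {0..T}" "\<xi> \<in> V"
  shows "((\<lambda>s. Z s \<xi>) has_vector_derivative F t (Z t \<xi>)) (at t within {0..T})"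
  by (rule has_vector_derivative_within_subset[OF Z_deriv]) (use assms in auto)

lemma Z_cont_t: "\<xi> \<in> V \<Longrightarrow> continuous_on {0..} (\<lambda>t. Z t \<xi>)"
  by (rule continuous_on_vector_derivative[where f' = "\<lambda>t. F t (Z t \<xi>)"]) (auto intro: Z_deriv)

lemma A_cont_along: "\<xi> \<in> V \<Longrightarrow> continuous_on {0..} (\<lambda>t. A t (Z t \<xi>))"
  using continuous_on_compose2[OF A_cont continuous_on_Pair[OF continuous_on_id Z_cont_t[of \<xi>]]] Z_in[of _ \<xi>]
  by auto

lemma A_bound:
  assumes "\<xi> \<in> V"
  obtains B where "B > 0" "\<And>t. t \<in> {0..T} \<Longrightarrow> norm (A t (Z t \<xi>)) \<le> B"
proof -
  have "bounded ((\<lambda>t. A t (Z t \<xi>)) ` {0..T})"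
    by (intro compact_imp_bounded compact_continuous_image compact_Icc
        continuous_on_subset[OF A_cont_along[OF assms]]) auto
  then show ?thesis using that by (auto simp: bounded_pos)
qed

text \<open>The graph of one trajectory over \<open>[0, T]\<close> is compact, so
  \<open>compact_uniform_nbhd\<close> makes the continuity of \<open>A\<close> uniform in
  time.\<close>

lemma tube:
  assumes \<xi>: "\<xi> \<in> V" and "\<eta> > 0"
  obtains r where "r > 0" "\<And>t z. t \<in> {0..T} \<Longrightarrow> dist z (Z t \<xi>) \<le> r \<Longrightarrow> z \<in> U"
    "\<And>t z. t \<in> {0..T} \<Longrightarrow> dist z (Z t \<xi>) \<le> r \<Longrightarrow> norm (A t z - A t (Z t \<xi>)) \<le> \<eta>"
proof -
  \<comment> \<open>Times outside \<open>[0, T]\<close> satisfy the condition vacuously, so it can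
    be asked on full balls of space-time.\<close>
  define P where "P c p = (fst p \<in> {0..T} \<longrightarrow> snd p \<in> U \<and> norm (A (fst p) (snd p) - A (fst p) (Z (fst p) \<xi>)) < \<eta>)"
    for c :: real and p
  define K where "K = (\<lambda>t. (t, Z t \<xi>)) ` {0..T}"
  have "compact K" unfolding K_def
    by (intro compact_continuous_image compact_Icc continuous_intros continuous_on_subset[OF Z_cont_t[OF \<xi>]]) auto
  moreover have "\<exists>d>0. \<exists>c>0. \<forall>x. dist k x < d \<longrightarrow> P c x" if kK: "k \<in> K" for k
  proof -
    obtain t where k: "k = (t, Z t \<xi>)" and t: "t \<in> {0..T}" using kK unfolding K_def by blast
    have "continuous_on ({0..T} \<times> U) (\<lambda>p. norm (A (fst p) (snd p) - A (fst p) (Z (fst p) \<xi>)))"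
    proof (intro continuous_intros)
      show "continuous_on ({0..T} \<times> U) (\<lambda>p. A (fst p) (snd p))"
        using continuous_on_subset[OF A_cont, of "{0..T} \<times> U"] by (force simp: case_prod_unfold)
      show "continuous_on ({0..T} \<times> U) (\<lambda>p. A (fst p) (Z (fst p) \<xi>))"
        by (rule continuous_on_compose2[OF A_cont_along[OF \<xi>]]) (auto intro!: continuous_intros)
    qed
    moreover have "k \<in> {0..T} \<times> U" using k t Z_in \<xi> by auto
    ultimately obtain d where d: "d > 0" "\<And>p. p \<in> {0..T} \<times> U \<Longrightarrow> dist p k < d \<Longrightarrow>
        norm (A (fst p) (snd p) - A (fst p) (Z (fst p) \<xi>)) < \<eta>"
      unfolding continuous_on_iff using \<open>\<eta> > 0\<close> by (force simp: k)
    obtain d' where d': "d' > 0" "ball (Z t \<xi>) d' \<subseteq> U" using U Z_in[of t \<xi>] \<xi> t openE by (metis atLeastAtMost_iff)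
    have "snd p \<in> U" if "dist k p < d'" for p
      using d'(2) dist_snd_le[of k p] that by (auto simp: k subset_eq)
    then show ?thesis using d d'
      by (intro exI[of _ "min d d'"] conjI exI[of _ 1]) (auto simp: P_def dist_commute mem_Times_iff)
  qed
  ultimately obtain d c where d: "d > 0" "\<And>k x. k \<in> K \<Longrightarrow> dist k x < d \<Longrightarrow> P c x"
    by (rule compact_uniform_nbhd[of K P]) (auto simp: P_def)
  have "P c (t, z)" if "t \<in> {0..T}" "dist z (Z t \<xi>) \<le> d / 2" for t z
    using d(2)[of "(t, Z t \<xi>)" "(t, z)"] that d(1) by (auto simp: K_def dist_Pair_Pair dist_commute)
  then show ?thesis using that[of "d / 2"] d(1) by (fastforce simp: P_def)
qed

text \<open>The mean value inequality for \<open>F t\<close> minus its linear part, whose derivative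
  \<open>A t y - A t (Z t \<xi>)\<close> is at most \<eta> on the tube.\<close>

lemma tube_linearization:
  assumes \<xi>: "\<xi> \<in> V" and "\<eta> > 0"
  obtains r where "r > 0"
    "\<And>t z. t \<in> {0..T} \<Longrightarrow> dist z (Z t \<xi>) \<le> r \<Longrightarrow>
      norm (F t z - F t (Z t \<xi>) - A t (Z t \<xi>) (z - Z t \<xi>)) \<le> \<eta> * norm (z - Z t \<xi>)"
proof -
  obtain r where r: "r > 0" "\<And>t z. t \<in> {0..T} \<Longrightarrow> dist z (Z t \<xi>) \<le> r \<Longrightarrow> z \<in> U"
    "\<And>t z. t \<in> {0..T} \<Longrightarrow> dist z (Z t \<xi>) \<le> r \<Longrightarrow> norm (A t z - A t (Z t \<xi>)) \<le> \<eta>"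
    using tube[OF assms] by metis
  have "norm (F t z - F t (Z t \<xi>) - A t (Z t \<xi>) (z - Z t \<xi>)) \<le> \<eta> * norm (z - Z t \<xi>)"
    if t: "t \<in> {0..T}" and z: "dist z (Z t \<xi>) \<le> r" for t z
  proof -
    have "norm ((\<lambda>z. F t z - A t (Z t \<xi>) z) z - (\<lambda>z. F t z - A t (Z t \<xi>) z) (Z t \<xi>)) \<le> \<eta> * norm (z - Z t \<xi>)"
    proof (rule differentiable_bound[of "cball (Z t \<xi>) r" _ "\<lambda>y. blinfun_apply (A t y - A t (Z t \<xi>))"])
      fix y assume "y \<in> cball (Z t \<xi>) r"
      then have y: "dist y (Z t \<xi>) \<le> r" by (simp add: dist_commute)
      show "((\<lambda>z. F t z - A t (Z t \<xi>) z) has_derivative blinfun_apply (A t y - A t (Z t \<xi>))) (at y within cball (Z t \<xi>) r)"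
        using t r(2)[OF t y] F_deriv[of t y]
        by (auto intro!: derivative_eq_intros has_derivative_at_withinI[OF F_deriv] simp: blinfun.diff_left)
      show "onorm (blinfun_apply (A t y - A t (Z t \<xi>))) \<le> \<eta>"
        using r(3)[OF t y] by (simp add: norm_blinfun.rep_eq)
    qed (use z r in \<open>auto simp: dist_commute\<close>)
    then show ?thesis by (simp add: blinfun.diff_right algebra_simps)
  qed
  then show ?thesis using that r(1) by blast
qed

text \<open>Gronwall gives the factor \<open>C\<close> as long as the neighboring trajectory stays
  within distance \<open>r\<close>. Since \<delta> is so small that
  \<open>C * norm (\<zeta> - \<xi>) < r\<close>, \<open>continuous_barrier\<close> shows that it
  stays there up to \<open>T\<close>.\<close>

lemma Z_lipschitz:
  assumes \<xi>: "\<xi> \<in> V"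
  obtains C \<delta> where "C > 0" "\<delta> > 0" "ball \<xi> \<delta> \<subseteq> V"
    "\<And>\<zeta> t. \<zeta> \<in> ball \<xi> \<delta> \<Longrightarrow> t \<in> {0..T} \<Longrightarrow> norm (Z t \<zeta> - Z t \<xi>) \<le> C * norm (\<zeta> - \<xi>)"
proof -
  obtain r where r: "r > 0"
    "\<And>t z. t \<in> {0..T} \<Longrightarrow> dist z (Z t \<xi>) \<le> r \<Longrightarrow>
      norm (F t z - F t (Z t \<xi>) - A t (Z t \<xi>) (z - Z t \<xi>)) \<le> 1 * norm (z - Z t \<xi>)"
    using tube_linearization[OF \<xi>, of 1 T] by auto
  obtain B where B: "B > 0" "\<And>t. t \<in> {0..T} \<Longrightarrow> norm (A t (Z t \<xi>)) \<le> B"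
    using A_bound[OF \<xi>] by metis
  define C where "C = exp ((B + 1) * T)"
  obtain \<delta>0 where \<delta>0: "\<delta>0 > 0" "ball \<xi> \<delta>0 \<subseteq> V" using V \<xi> openE by blast
  define \<delta> where "\<delta> = min \<delta>0 (min r (r / C))"
  have C: "C > 0" by (simp add: C_def)
  have \<delta>: "\<delta> > 0" using \<delta>0 r C by (simp add: \<delta>_def)
  have F: "norm (F t z - F t (Z t \<xi>)) \<le> (B + 1) * norm (z - Z t \<xi>)"
    if t: "t \<in> {0..T}" and z: "norm (z - Z t \<xi>) \<le> r" for t z
  proof -
    have "norm (A t (Z t \<xi>) (z - Z t \<xi>)) \<le> B * norm (z - Z t \<xi>)"
      using norm_blinfun[of "A t (Z t \<xi>)"] B(2)[OF t] by (meson mult_right_mono norm_ge_zero order_trans)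
    then show ?thesis
      using r(2)[OF t] z norm_triangle_sub[of "F t z - F t (Z t \<xi>)" "A t (Z t \<xi>) (z - Z t \<xi>)"]
      by (force simp: dist_norm algebra_simps)
  qed
  have growth: "norm (Z t \<zeta> - Z t \<xi>) \<le> C * norm (\<zeta> - \<xi>)"
    if \<zeta>: "\<zeta> \<in> V" and t: "t \<in> {0..T}" and le: "\<And>s. s \<in> {0..t} \<Longrightarrow> norm (Z s \<zeta> - Z s \<xi>) \<le> r" for \<zeta> t
  proof -
    have "norm ((\<lambda>t. Z t \<zeta> - Z t \<xi>) t) \<le> exp ((B + 1) * t) * (norm ((\<lambda>t. Z t \<zeta> - Z t \<xi>) 0) + 0 * t)"
    proof (rule gronwall_norm)
      fix s assume s: "s \<in> {0..t}"
      show "((\<lambda>t. Z t \<zeta> - Z t \<xi>) has_vector_derivative F s (Z s \<zeta>) - F s (Z s \<xi>)) (at s within {0..t})"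
        by (intro has_vector_derivative_diff Z_deriv_Icc s \<zeta> \<xi>)
      show "norm (F s (Z s \<zeta>) - F s (Z s \<xi>)) \<le> (B + 1) * norm (Z s \<zeta> - Z s \<xi>) + 0"
        using F[of s "Z s \<zeta>"] le[OF s] s t by auto
    qed (use B t in auto)
    also have "\<dots> \<le> C * norm (\<zeta> - \<xi>)"
      using t B Z_init \<zeta> \<xi> by (auto simp: C_def intro!: mult_right_mono)
    finally show ?thesis .
  qed
  have "norm (Z t \<zeta> - Z t \<xi>) \<le> C * norm (\<zeta> - \<xi>)" if \<zeta>: "\<zeta> \<in> ball \<xi> \<delta>" and t: "t \<in> {0..T}" for \<zeta> t
  proof -
    have \<zeta>V: "\<zeta> \<in> V" and small: "norm (\<zeta> - \<xi>) < \<delta>" using \<delta>0 \<zeta> by (auto simp: \<delta>_def dist_norm norm_minus_commute)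
    have "C * norm (\<zeta> - \<xi>) < r" using small C by (simp add: \<delta>_def field_simps)
    have lt: "norm (Z s \<zeta> - Z s \<xi>) < r" if "s \<in> {0..T}" for s
    proof (rule continuous_barrier[OF _ _ _ that])
      show "continuous_on {0..T} (\<lambda>s. norm (Z s \<zeta> - Z s \<xi>))"
        using Z_cont_t[OF \<zeta>V] Z_cont_t[OF \<xi>]
        by (intro continuous_intros) (auto intro: continuous_on_subset)
      show "norm (Z 0 \<zeta> - Z 0 \<xi>) < r" using small Z_init \<zeta>V \<xi> by (auto simp: \<delta>_def)
      show "norm (Z t \<zeta> - Z t \<xi>) < r" if "t \<in> {0..T}" "\<And>s. s \<in> {0..t} \<Longrightarrow> norm (Z s \<zeta> - Z s \<xi>) \<le> r" for t
        using growth[OF \<zeta>V that] \<open>C * norm (\<zeta> - \<xi>) < r\<close> by simp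
    qed
    show ?thesis by (rule growth[OF \<zeta>V t]) (use lt t in force)
  qed
  moreover have "ball \<xi> \<delta> \<subseteq> V" using \<delta>0 by (auto simp: \<delta>_def)
  ultimately show ?thesis using that[OF C \<delta>] by blast
qed

text \<open>The candidate for the derivative of \<open>Z t\<close> at \<xi>: the solution of the
  linearized equation along the trajectory. A whole curve is chosen for each \<xi> and then
  evaluated at \<open>t\<close>.\<close>

definition W :: "real \<Rightarrow> 'a \<Rightarrow> 'a \<Rightarrow>\<^sub>L 'a" where
  "W = (\<lambda>t \<xi>. (SOME w. w 0 = id_blinfun \<and>
    (\<forall>t\<ge>0. (w has_vector_derivative A t (Z t \<xi>) o\<^sub>L w t) (at t within {0..}))) t)"

lemma W_exists:
  assumes \<xi>: "\<xi> \<in> V"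
  shows "\<exists>w. w 0 = id_blinfun \<and> (\<forall>t\<ge>0. (w has_vector_derivative A t (Z t \<xi>) o\<^sub>L w t) (at t within {0..}))"
proof -
  have "\<exists>B>0. \<forall>t\<in>{0..T}. norm (A t (Z t \<xi>)) \<le> B" for T
    using A_bound[OF \<xi>, of T] by metis
  then obtain B where B: "\<And>T. B T > 0 \<and> (\<forall>t\<in>{0..T}. norm (A t (Z t \<xi>)) \<le> B T)" by metis
  show ?thesis
  proof (rule lipschitz_ode_exists_global[where L = B])
    fix x :: "'a \<Rightarrow>\<^sub>L 'a"
    show "continuous_on {0..} (\<lambda>t. A t (Z t \<xi>) o\<^sub>L x)"
      by (intro continuous_intros A_cont_along \<xi>)
  next
    fix t T :: real assume t: "0 \<le> t" "t \<le> T"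
    have "dist (A t (Z t \<xi>) o\<^sub>L x) (A t (Z t \<xi>) o\<^sub>L y) \<le> B T * dist x y" for x y :: "'a \<Rightarrow>\<^sub>L 'a"
    proof -
      have "norm ((A t (Z t \<xi>) o\<^sub>L x) - (A t (Z t \<xi>) o\<^sub>L y)) = norm (A t (Z t \<xi>) o\<^sub>L (x - y))"
        by (simp add: bounded_bilinear.diff_right[OF bounded_bilinear_blinfun_compose])
      also have "\<dots> \<le> norm (A t (Z t \<xi>)) * norm (x - y)" by (rule norm_blinfun_compose)
      also have "\<dots> \<le> B T * norm (x - y)" using B[of T] t by (intro mult_right_mono) auto
      finally show ?thesis by (simp add: dist_norm)
    qed
    then show "(B T)-lipschitz_on UNIV (\<lambda>x::'a \<Rightarrow>\<^sub>L 'a. A t (Z t \<xi>) o\<^sub>L x)"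
      using B[of T] by (intro lipschitz_onI) auto
  qed
qed

lemma W_init: "\<xi> \<in> V \<Longrightarrow> W 0 \<xi> = id_blinfun"
  and W_deriv: "\<xi> \<in> V \<Longrightarrow> 0 \<le> t \<Longrightarrow>
    ((\<lambda>t. W t \<xi>) has_vector_derivative A t (Z t \<xi>) o\<^sub>L W t \<xi>) (at t within {0..})"
  using someI_ex[OF W_exists, of \<xi>] unfolding W_def by auto

lemma W_deriv_Icc:
  assumes "t \<in> {0..T}" "\<xi> \<in> V"
  shows "((\<lambda>t. W t \<xi>) has_vector_derivative A t (Z t \<xi>) o\<^sub>L W t \<xi>) (at t within {0..T})"
  by (rule has_vector_derivative_within_subset[OF W_deriv]) (use assms in auto)

lemma W_cont_t: "\<xi> \<in> V \<Longrightarrow> continuous_on {0..} (\<lambda>t. W t \<xi>)"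
  by (rule continuous_on_vector_derivative[where f' = "\<lambda>t. A t (Z t \<xi>) o\<^sub>L W t \<xi>"]) (auto intro: W_deriv)

text \<open>Two Gronwall estimates with one common \<delta>: the first yields differentiability of
  \<open>Z t\<close> at \<xi>, the second continuity of the derivative in the initial point, both
  uniformly on \<open>[0, T]\<close>.\<close>

lemma W_approx:
  assumes \<xi>: "\<xi> \<in> V" and T: "T \<ge> 0" and \<eta>: "\<eta> > 0"
  obtains \<delta> where "\<delta> > 0" "ball \<xi> \<delta> \<subseteq> V"
    "\<And>\<zeta> t. \<zeta> \<in> ball \<xi> \<delta> \<Longrightarrow> t \<in> {0..T} \<Longrightarrow>
      norm (Z t \<zeta> - Z t \<xi> - W t \<xi> (\<zeta> - \<xi>)) \<le> \<eta> * norm (\<zeta> - \<xi>)"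
    "\<And>\<zeta> t. \<zeta> \<in> ball \<xi> \<delta> \<Longrightarrow> t \<in> {0..T} \<Longrightarrow> norm (W t \<zeta> - W t \<xi>) \<le> \<eta>"
proof -
  obtain B where B: "B > 0" "\<And>t. t \<in> {0..T} \<Longrightarrow> norm (A t (Z t \<xi>)) \<le> B"
    using A_bound[OF \<xi>] by metis
  obtain C \<delta>0 where C: "C > 0" "\<delta>0 > 0" "ball \<xi> \<delta>0 \<subseteq> V"
    "\<And>\<zeta> t. \<zeta> \<in> ball \<xi> \<delta>0 \<Longrightarrow> t \<in> {0..T} \<Longrightarrow> norm (Z t \<zeta> - Z t \<xi>) \<le> C * norm (\<zeta> - \<xi>)"
    using Z_lipschitz[OF \<xi>] by metis
  have "bounded ((\<lambda>t. W t \<xi>) ` {0..T})"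
    by (intro compact_imp_bounded compact_continuous_image compact_Icc
        continuous_on_subset[OF W_cont_t[OF \<xi>]]) auto
  then obtain Bw where Bw: "Bw > 0" "\<And>t. t \<in> {0..T} \<Longrightarrow> norm (W t \<xi>) \<le> Bw"
    by (auto simp: bounded_pos)
  \<comment> \<open>\<open>M\<close> dominates the Gronwall factors of both estimates. Their forcing
    terms are \<open>\<eta>' * C * norm (\<zeta> - \<xi>)\<close> and \<open>\<eta>' * Bw\<close>,
    which explains \<open>C + Bw\<close>.\<close>
  define M where "M = exp ((B + 1) * T) * T * (C + Bw)"
  have M: "M \<ge> 0" using T C Bw by (simp add: M_def)
  \<comment> \<open>The bound \<open>\<eta>' \<le> 1\<close> makes \<open>B + 1\<close> a bound for
    \<open>A\<close> along neighboring trajectories.\<close>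
  define \<eta>' where "\<eta>' = min 1 (\<eta> / (M + 1))"
  have \<eta>': "\<eta>' > 0" "\<eta>' \<le> 1" "M * \<eta>' \<le> \<eta>"
  proof -
    show "M * \<eta>' \<le> \<eta>"
    proof -
      have "M * \<eta>' \<le> M * (\<eta> / (M + 1))" using M by (intro mult_left_mono) (auto simp: \<eta>'_def)
      also have "\<dots> \<le> \<eta>" using M \<eta> by (simp add: field_simps)
      finally show ?thesis .
    qed
  qed (use M \<eta> in \<open>auto simp: \<eta>'_def\<close>)
  obtain r1 where r1: "r1 > 0" "\<And>t z. t \<in> {0..T} \<Longrightarrow> dist z (Z t \<xi>) \<le> r1 \<Longrightarrow>
      norm (F t z - F t (Z t \<xi>) - A t (Z t \<xi>) (z - Z t \<xi>)) \<le> \<eta>' * norm (z - Z t \<xi>)"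
    using tube_linearization[OF \<xi> \<eta>'(1)] by metis
  obtain r2 where r2: "r2 > 0"
    "\<And>t z. t \<in> {0..T} \<Longrightarrow> dist z (Z t \<xi>) \<le> r2 \<Longrightarrow> norm (A t z - A t (Z t \<xi>)) \<le> \<eta>'"
    using tube[OF \<xi> \<eta>'(1)] by metis
  define \<delta> where "\<delta> = min \<delta>0 (min r1 r2 / C)"
  have \<delta>: "\<delta> > 0" using C r1 r2 by (simp add: \<delta>_def)
  have close: "norm (Z t \<zeta> - Z t \<xi>) \<le> C * norm (\<zeta> - \<xi>)" "dist (Z t \<zeta>) (Z t \<xi>) \<le> r1" "dist (Z t \<zeta>) (Z t \<xi>) \<le> r2" "\<zeta> \<in> V"
    if "\<zeta> \<in> ball \<xi> \<delta>" "t \<in> {0..T}" for \<zeta> t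
  proof -
    have "norm (\<zeta> - \<xi>) < \<delta>" using that by (auto simp: dist_norm norm_minus_commute)
    then have "C * norm (\<zeta> - \<xi>) \<le> min r1 r2" using C by (simp add: \<delta>_def field_simps)
    moreover show *: "norm (Z t \<zeta> - Z t \<xi>) \<le> C * norm (\<zeta> - \<xi>)"
      using C(4)[of \<zeta> t] that by (auto simp: \<delta>_def)
    ultimately show "dist (Z t \<zeta>) (Z t \<xi>) \<le> r1" "dist (Z t \<zeta>) (Z t \<xi>) \<le> r2"
      by (auto simp: dist_norm)
    show "\<zeta> \<in> V" using that C(3) by (auto simp: \<delta>_def)
  qed
  have E1: "exp (B * t) * t \<le> exp ((B + 1) * T) * T" "exp ((B + 1) * t) * t \<le> exp ((B + 1) * T) * T"
    if "t \<in> {0..T}" for t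
    using that B by (auto intro!: mult_mono)
  show ?thesis
  proof (rule that[OF \<delta>])
    show "ball \<xi> \<delta> \<subseteq> V" using C(3) by (auto simp: \<delta>_def)
  next
    fix \<zeta> t assume \<zeta>: "\<zeta> \<in> ball \<xi> \<delta>" and t: "t \<in> {0..T}"
    have \<zeta>V: "\<zeta> \<in> V" using close \<zeta> t by blast
    have "norm ((\<lambda>t. Z t \<zeta> - Z t \<xi> - W t \<xi> (\<zeta> - \<xi>)) t) \<le> exp (B * t) *
        (norm ((\<lambda>t. Z t \<zeta> - Z t \<xi> - W t \<xi> (\<zeta> - \<xi>)) 0) + \<eta>' * (C * norm (\<zeta> - \<xi>)) * t)"
    proof (rule gronwall_norm)
      fix s assume s: "s \<in> {0..t}"
      then have sT: "s \<in> {0..T}" using t by auto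
      have "((\<lambda>t. W t \<xi> (\<zeta> - \<xi>)) has_vector_derivative (A s (Z s \<xi>) o\<^sub>L W s \<xi>) (\<zeta> - \<xi>)) (at s within {0..t})"
        by (rule bounded_linear.has_vector_derivative[OF _ W_deriv_Icc[OF s \<xi>]]) (rule blinfun.bounded_linear_left)
      then show "((\<lambda>t. Z t \<zeta> - Z t \<xi> - W t \<xi> (\<zeta> - \<xi>)) has_vector_derivative
          F s (Z s \<zeta>) - F s (Z s \<xi>) - A s (Z s \<xi>) (W s \<xi> (\<zeta> - \<xi>))) (at s within {0..t})"
        by (intro has_vector_derivative_diff Z_deriv_Icc s \<zeta>V \<xi>) simp
      let ?e = "Z s \<zeta> - Z s \<xi> - W s \<xi> (\<zeta> - \<xi>)"
      have split: "F s (Z s \<zeta>) - F s (Z s \<xi>) - A s (Z s \<xi>) (W s \<xi> (\<zeta> - \<xi>)) =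
          (F s (Z s \<zeta>) - F s (Z s \<xi>) - A s (Z s \<xi>) (Z s \<zeta> - Z s \<xi>)) + A s (Z s \<xi>) ?e"
        by (simp add: blinfun.diff_right)
      have "norm (F s (Z s \<zeta>) - F s (Z s \<xi>) - A s (Z s \<xi>) (W s \<xi> (\<zeta> - \<xi>))) \<le>
          \<eta>' * norm (Z s \<zeta> - Z s \<xi>) + norm (A s (Z s \<xi>)) * norm ?e"
        unfolding split
        by (rule order_trans[OF norm_triangle_ineq add_mono[OF r1(2)[OF sT close(2)[OF \<zeta> sT]] norm_blinfun]])
      also have "\<dots> \<le> \<eta>' * (C * norm (\<zeta> - \<xi>)) + B * norm ?e"
        using close(1)[OF \<zeta> sT] B(2)[OF sT] \<eta>'(1) by (intro add_mono mult_left_mono mult_right_mono) auto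
      finally show "norm (F s (Z s \<zeta>) - F s (Z s \<xi>) - A s (Z s \<xi>) (W s \<xi> (\<zeta> - \<xi>))) \<le>
          B * norm ?e + \<eta>' * (C * norm (\<zeta> - \<xi>))" by simp
    qed (use t B C \<eta>' in auto)
    also have "\<dots> = (exp (B * t) * t) * (\<eta>' * C * norm (\<zeta> - \<xi>))"
      using Z_init W_init \<zeta>V \<xi> by simp
    also have "\<dots> \<le> (exp ((B + 1) * T) * T) * (\<eta>' * (C + Bw) * norm (\<zeta> - \<xi>))"
      by (rule mult_mono[OF E1(1)[OF t]]) (use t \<eta>' C Bw T in \<open>auto intro!: mult_right_mono\<close>)
    also have "\<dots> = M * \<eta>' * norm (\<zeta> - \<xi>)" by (simp add: M_def)
    also have "\<dots> \<le> \<eta> * norm (\<zeta> - \<xi>)" using \<eta>' by (intro mult_right_mono) auto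
    finally show "norm (Z t \<zeta> - Z t \<xi> - W t \<xi> (\<zeta> - \<xi>)) \<le> \<eta> * norm (\<zeta> - \<xi>)" by simp
  next
    fix \<zeta> t assume \<zeta>: "\<zeta> \<in> ball \<xi> \<delta>" and t: "t \<in> {0..T}"
    have \<zeta>V: "\<zeta> \<in> V" using close \<zeta> t by blast
    have "norm ((\<lambda>t. W t \<zeta> - W t \<xi>) t) \<le> exp ((B + 1) * t) * (norm ((\<lambda>t. W t \<zeta> - W t \<xi>) 0) + \<eta>' * Bw * t)"
    proof (rule gronwall_norm)
      fix s assume s: "s \<in> {0..t}"
      then have sT: "s \<in> {0..T}" using t by auto
      show "((\<lambda>t. W t \<zeta> - W t \<xi>) has_vector_derivative
          (A s (Z s \<zeta>) o\<^sub>L W s \<zeta>) - (A s (Z s \<xi>) o\<^sub>L W s \<xi>)) (at s within {0..t})"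
        by (intro has_vector_derivative_diff W_deriv_Icc s \<zeta>V \<xi>)
      have a: "norm (A s (Z s \<zeta>) - A s (Z s \<xi>)) \<le> \<eta>'" by (rule r2(2)[OF sT close(3)[OF \<zeta> sT]])
      then have a': "norm (A s (Z s \<zeta>)) \<le> B + 1"
        using B(2)[OF sT] \<eta>'(2) norm_triangle_sub[of "A s (Z s \<zeta>)" "A s (Z s \<xi>)"] by linarith
      have split: "(A s (Z s \<zeta>) o\<^sub>L W s \<zeta>) - (A s (Z s \<xi>) o\<^sub>L W s \<xi>) =
          (A s (Z s \<zeta>) o\<^sub>L (W s \<zeta> - W s \<xi>)) + ((A s (Z s \<zeta>) - A s (Z s \<xi>)) o\<^sub>L W s \<xi>)"
        by (simp add: bounded_bilinear.diff_left[OF bounded_bilinear_blinfun_compose] bounded_bilinear.diff_right[OF bounded_bilinear_blinfun_compose])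
      have "norm ((A s (Z s \<zeta>) o\<^sub>L W s \<zeta>) - (A s (Z s \<xi>) o\<^sub>L W s \<xi>)) \<le>
          norm (A s (Z s \<zeta>)) * norm (W s \<zeta> - W s \<xi>) + norm (A s (Z s \<zeta>) - A s (Z s \<xi>)) * norm (W s \<xi>)"
        unfolding split by (intro order_trans[OF norm_triangle_ineq add_mono] norm_blinfun_compose)
      also have "\<dots> \<le> (B + 1) * norm (W s \<zeta> - W s \<xi>) + \<eta>' * Bw"
        using a a' Bw(2)[OF sT] \<eta>'(1) by (intro add_mono mult_mono mult_right_mono) auto
      finally show "norm ((A s (Z s \<zeta>) o\<^sub>L W s \<zeta>) - (A s (Z s \<xi>) o\<^sub>L W s \<xi>)) \<le>
          (B + 1) * norm (W s \<zeta> - W s \<xi>) + \<eta>' * Bw" .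
    qed (use t B Bw \<eta>' in auto)
    also have "\<dots> = (exp ((B + 1) * t) * t) * (\<eta>' * Bw)" using W_init \<zeta>V \<xi> by simp
    also have "\<dots> \<le> (exp ((B + 1) * T) * T) * (\<eta>' * (C + Bw))"
      by (rule mult_mono[OF E1(2)[OF t]]) (use t \<eta>' C Bw T in auto)
    also have "\<dots> = M * \<eta>'" by (simp add: M_def)
    also have "\<dots> \<le> \<eta>" by (rule \<eta>')
    finally show "norm (W t \<zeta> - W t \<xi>) \<le> \<eta>" by simp
  qed
qed

lemma W_cont: "continuous_on ({0..} \<times> V) (\<lambda>(t, \<xi>). W t \<xi>)"
  unfolding continuous_on_iff
proof (intro ballI allI impI)
  fix p :: "real \<times> 'a" and e :: real assume p: "p \<in> {0..} \<times> V" and e: "0 < e"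
  obtain t \<xi> where p_eq: "p = (t, \<xi>)" and t: "0 \<le> t" and \<xi>: "\<xi> \<in> V" using p by auto
  \<comment> \<open>The horizon \<open>t + 1\<close> leaves room for times after
    \<open>t\<close>.\<close>
  obtain \<delta> where \<delta>: "\<delta> > 0" "\<And>\<zeta> s. \<zeta> \<in> ball \<xi> \<delta> \<Longrightarrow> s \<in> {0..t + 1} \<Longrightarrow> norm (W s \<zeta> - W s \<xi>) \<le> e / 3"
    using W_approx[OF \<xi>, of "t + 1" "e / 3"] t e by (metis add_nonneg_nonneg zero_le_one zero_less_divide_iff zero_less_numeral)
  obtain d where d: "d > 0" "\<And>s. s \<in> {0..} \<Longrightarrow> dist s t < d \<Longrightarrow> dist (W s \<xi>) (W t \<xi>) < e / 3"
    using W_cont_t[OF \<xi>, unfolded continuous_on_iff, rule_format, of t "e / 3"] t e by auto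
  show "\<exists>d>0. \<forall>q\<in>{0..} \<times> V. dist q p < d \<longrightarrow> dist (case q of (t, \<xi>) \<Rightarrow> W t \<xi>) (case p of (t, \<xi>) \<Rightarrow> W t \<xi>) < e"
  proof (intro exI[of _ "min 1 (min \<delta> d)"] conjI ballI impI)
    fix q assume q: "q \<in> {0..} \<times> V" "dist q p < min 1 (min \<delta> d)"
    obtain s \<zeta> where q_eq: "q = (s, \<zeta>)" and s: "0 \<le> s" using q by auto
    have "dist s t < min 1 (min \<delta> d)" "dist \<zeta> \<xi> < min 1 (min \<delta> d)"
      using q(2) dist_fst_le[of q p] dist_snd_le[of q p] by (auto simp: q_eq p_eq)
    then have "norm (W s \<zeta> - W s \<xi>) \<le> e / 3" "norm (W s \<xi> - W t \<xi>) < e / 3"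
      using \<delta>(2)[of \<zeta> s] d(2)[of s] s by (auto simp: dist_norm norm_minus_commute)
    then show "dist (case q of (t, \<xi>) \<Rightarrow> W t \<xi>) (case p of (t, \<xi>) \<Rightarrow> W t \<xi>) < e"
      using norm_triangle_ineq[of "W s \<zeta> - W s \<xi>" "W s \<xi> - W t \<xi>"] e by (simp add: q_eq p_eq dist_norm)
  qed (use \<delta> d in auto)
qed

lemma Z_deriv_x:
  assumes t: "0 \<le> t" and \<xi>: "\<xi> \<in> V"
  shows "(Z t has_derivative W t \<xi>) (at \<xi>)"
  unfolding has_derivative_at_alt
proof (intro conjI allI impI blinfun.bounded_linear_right)
  fix e :: real assume "0 < e"
  then obtain \<delta> where "\<delta> > 0" "\<And>\<zeta>. \<zeta> \<in> ball \<xi> \<delta> \<Longrightarrow> norm (Z t \<zeta> - Z t \<xi> - W t \<xi> (\<zeta> - \<xi>)) \<le> e * norm (\<zeta> - \<xi>)"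
    using W_approx[OF \<xi> t] t by (metis atLeastAtMost_iff order_refl)
  then show "\<exists>d>0. \<forall>y. norm (y - \<xi>) < d \<longrightarrow> norm (Z t y - Z t \<xi> - W t \<xi> (y - \<xi>)) \<le> e * norm (y - \<xi>)"
    by (metis dist_norm mem_ball norm_minus_commute)
qed

text \<open>A time derivative at the point and a spatial derivative continuous in both variables
  suffice for joint differentiability; at \<open>t = 0\<close> it is one-sided in time.\<close>

lemma Z_has_derivative:
  assumes t: "0 \<le> t" and \<xi>: "\<xi> \<in> V"
  shows "((\<lambda>(t, \<xi>). Z t \<xi>) has_derivative (\<lambda>(\<tau>, \<eta>). \<tau> *\<^sub>R F t (Z t \<xi>) + W t \<xi> \<eta>)) (at (t, \<xi>) within {0..} \<times> V)"
proof -
  obtain r where r: "r > 0" "ball \<xi> r \<subseteq> V" using V \<xi> openE by blast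
  \<comment> \<open>The criterion on partial derivatives wants a convex set of spatial arguments,
    hence the ball.\<close>
  have "((\<lambda>(t, \<xi>). Z t \<xi>) has_derivative (\<lambda>(\<tau>, \<eta>). \<tau> *\<^sub>R F t (Z t \<xi>) + W t \<xi> \<eta>)) (at (t, \<xi>) within {0..} \<times> ball \<xi> r)"
  proof (rule has_derivative_partialsI[where fx = "\<lambda>\<tau>. \<tau> *\<^sub>R F t (Z t \<xi>)" and fy = W])
    show "((\<lambda>t. Z t \<xi>) has_derivative (\<lambda>\<tau>. \<tau> *\<^sub>R F t (Z t \<xi>))) (at t within {0..})"
      using Z_deriv[OF t \<xi>] by (simp add: has_vector_derivative_def)
    fix s \<zeta> assume "s \<in> {0::real..}" "\<zeta> \<in> ball \<xi> r"
    then show "(Z s has_derivative W s \<zeta>) (at \<zeta> within ball \<xi> r)"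
      by (intro has_derivative_at_withinI[OF Z_deriv_x]) (use r in auto)
  next
    have "continuous_on ({0..} \<times> ball \<xi> r) (\<lambda>(t, \<xi>). W t \<xi>)"
      by (rule continuous_on_subset[OF W_cont]) (use r in auto)
    then show "continuous (at (t, \<xi>) within {0..} \<times> ball \<xi> r) (\<lambda>(t, \<xi>). W t \<xi>)"
      using t r by (simp add: continuous_on_eq_continuous_within)
  qed (use r in auto)
  moreover have "at (t, \<xi>) within {0..} \<times> ball \<xi> r = at (t, \<xi>) within {0..} \<times> V"
    by (rule at_within_nhd[of _ "UNIV \<times> ball \<xi> r"]) (use r in \<open>auto simp: open_Times\<close>)
  ultimately show ?thesis by simp
qed

end

section \<open>The flow of the velocity field\<close>

text \<open>The witness is McShane's infimal convolution.\<close>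

lemma lipschitz_extension_real:
  fixes f :: "real \<Rightarrow> 'a::metric_space \<Rightarrow> real"
  assumes C: "compact C" "C \<noteq> {}"
    and lip: "\<And>t. 0 \<le> t \<Longrightarrow> L-lipschitz_on C (f t)"
    and cont: "continuous_on ({0..} \<times> C) (\<lambda>(t, x). f t x)"
  obtains g where "\<And>t x. 0 \<le> t \<Longrightarrow> x \<in> C \<Longrightarrow> g t x = f t x"
    "\<And>t. 0 \<le> t \<Longrightarrow> L-lipschitz_on UNIV (g t)" "\<And>x. continuous_on {0..} (\<lambda>t. g t x)"
proof
  define g where "g t x = (INF y\<in>C. f t y + L * dist x y)" for t x
  have L: "0 \<le> L" using lip[of 0] lipschitz_on_nonneg by auto
  have bdd: "bdd_below ((\<lambda>y. f t y + L * dist x y) ` C)" if t: "0 \<le> t" for t x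
  proof -
    have "continuous_on C (\<lambda>y. f t y + L * dist x y)"
      by (intro continuous_intros lipschitz_on_continuous_on[OF lip[OF t]])
    then show ?thesis
      using C(1) by (meson bounded_imp_bdd_below compact_continuous_image compact_imp_bounded)
  qed
  \<comment> \<open>The Lipschitz bound in \<open>x\<close> and the continuity in \<open>t\<close>
    both reduce to this comparison of two infima.\<close>
  have le: "g t x \<le> g s z + e"
    if "0 \<le> t" "\<And>y. y \<in> C \<Longrightarrow> f t y + L * dist x y \<le> f s y + L * dist z y + e" for t x s z e
  proof -
    have "g t x - e \<le> f s y + L * dist z y" if "y \<in> C" for y
      using cINF_lower[OF bdd[OF \<open>0 \<le> t\<close>] that, of x] \<open>\<And>y. y \<in> C \<Longrightarrow> _\<close>[OF that]
      unfolding g_def by linarith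
    then have "g t x - e \<le> g s z"
      unfolding g_def[of s z] by (intro cINF_greatest C(2))
    then show ?thesis by simp
  qed
  show "g t x = f t x" if t: "0 \<le> t" and x: "x \<in> C" for t x
  proof (rule antisym)
    show "g t x \<le> f t x"
      using cINF_lower[OF bdd[OF t] x, of x] by (simp add: g_def)
    show "f t x \<le> g t x"
      unfolding g_def
    proof (intro cINF_greatest C(2))
      fix y assume "y \<in> C"
      then show "f t x \<le> f t y + L * dist x y"
        using lipschitz_onD[OF lip[OF t] x, of y] by (simp add: dist_real_def)
    qed
  qed
  show "L-lipschitz_on UNIV (g t)" if t: "0 \<le> t" for t
  proof (rule lipschitz_onI[OF _ L])
    have *: "g t x \<le> g t z + L * dist x z" for x z
    proof (rule le[OF t])
      fix y
      have "L * dist x y \<le> L * (dist x z + dist z y)" using L by (intro mult_left_mono dist_triangle)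
      then show "f t y + L * dist x y \<le> f t y + L * dist z y + L * dist x z" by (simp add: algebra_simps)
    qed
    fix x z
    show "dist (g t x) (g t z) \<le> L * dist x z"
      using *[of x z] *[of z x] by (simp add: dist_real_def abs_le_iff dist_commute)
  qed
  show "continuous_on {0..} (\<lambda>t. g t x)" for x
    unfolding continuous_on_iff
  proof (intro ballI allI impI)
    fix t e :: real assume t: "t \<in> {0..}" and e: "0 < e"
    \<comment> \<open>Compactness of \<open>C\<close> makes the modulus of continuity in time the
      same for all \<open>y\<close>, so that it survives the infimum.\<close>
    have "uniformly_continuous_on ({0..t + 1} \<times> C) (\<lambda>(t, x). f t x)"
      using C(1) by (intro compact_uniformly_continuous continuous_on_subset[OF cont] compact_Times) auto
    then obtain d where d: "d > 0" "\<And>p q. p \<in> {0..t + 1} \<times> C \<Longrightarrow> q \<in> {0..t + 1} \<times> C \<Longrightarrow> dist q p < d \<Longrightarrow>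
        dist (case q of (t, x) \<Rightarrow> f t x) (case p of (t, x) \<Rightarrow> f t x) < e / 2"
      unfolding uniformly_continuous_on_def using e by (metis half_gt_zero)
    have "dist (g s x) (g t x) < e" if s: "s \<in> {0..}" "dist s t < min 1 d" for s
    proof -
      have fle: "f s y \<le> f t y + e / 2 \<and> f t y \<le> f s y + e / 2" if "y \<in> C" for y
      proof -
        have "dist (f s y) (f t y) < e / 2"
          using d(2)[of "(t, y)" "(s, y)"] s t that by (auto simp: dist_Pair_Pair dist_real_def)
        then have "\<bar>f s y - f t y\<bar> < e / 2" by (simp only: dist_real_def)
        then show ?thesis by linarith
      qed
      have "g s x \<le> g t x + e / 2" "g t x \<le> g s x + e / 2"
        using s t fle by (auto intro!: le)
      then show ?thesis using e by (simp add: dist_real_def abs_less_iff)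
    qed
    then show "\<exists>d>0. \<forall>s\<in>{0..}. dist s t < d \<longrightarrow> dist (g s x) (g t x) < e"
      using d(1) by (intro exI[of _ "min 1 d"]) auto
  qed
qed

text \<open>Extending coordinate by coordinate multiplies the constant by the dimension, so the new
  constant \<open>M\<close> is left unspecified.\<close>

lemma lipschitz_extension:
  fixes f :: "real \<Rightarrow> 'a::metric_space \<Rightarrow> 'b::euclidean_space"
  assumes C: "compact C" "C \<noteq> {}"
    and lip: "\<And>t. 0 \<le> t \<Longrightarrow> L-lipschitz_on C (f t)"
    and cont: "continuous_on ({0..} \<times> C) (\<lambda>(t, x). f t x)"
  obtains g M where "\<And>t x. 0 \<le> t \<Longrightarrow> x \<in> C \<Longrightarrow> g t x = f t x"
    "\<And>t. 0 \<le> t \<Longrightarrow> M-lipschitz_on UNIV (g t)" "\<And>x. continuous_on {0..} (\<lambda>t. g t x)"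
proof -
  have "\<exists>g. (\<forall>t x. 0 \<le> t \<longrightarrow> x \<in> C \<longrightarrow> g t x = f t x \<bullet> b) \<and> (\<forall>t. 0 \<le> t \<longrightarrow> L-lipschitz_on UNIV (g t)) \<and>
      (\<forall>x. continuous_on {0..} (\<lambda>t. g t x))" if b: "b \<in> Basis" for b
  proof (rule lipschitz_extension_real[OF C, of L "\<lambda>t x. f t x \<bullet> b"])
    fix t :: real assume t: "0 \<le> t"
    show "L-lipschitz_on C (\<lambda>x. f t x \<bullet> b)"
    proof (rule lipschitz_onI)
      fix x y assume "x \<in> C" "y \<in> C"
      have "dist (f t x \<bullet> b) (f t y \<bullet> b) = \<bar>(f t x - f t y) \<bullet> b\<bar>" by (simp add: dist_real_def inner_diff_left)
      also have "\<dots> \<le> dist (f t x) (f t y)" using Basis_le_norm[OF b] by (simp add: dist_norm)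
      also have "\<dots> \<le> L * dist x y" by (rule lipschitz_onD[OF lip[OF t] \<open>x \<in> C\<close> \<open>y \<in> C\<close>])
      finally show "dist (f t x \<bullet> b) (f t y \<bullet> b) \<le> L * dist x y" .
    qed (use lip[OF t] lipschitz_on_nonneg in auto)
  next
    show "continuous_on ({0..} \<times> C) (\<lambda>(t, x). f t x \<bullet> b)"
      using cont by (auto simp: case_prod_unfold intro!: continuous_intros)
  qed blast
  then obtain h where h: "\<And>b t x. b \<in> Basis \<Longrightarrow> 0 \<le> t \<Longrightarrow> x \<in> C \<Longrightarrow> h b t x = f t x \<bullet> b"
    "\<And>b t. b \<in> Basis \<Longrightarrow> 0 \<le> t \<Longrightarrow> L-lipschitz_on UNIV (h b t)"
    "\<And>b x. b \<in> Basis \<Longrightarrow> continuous_on {0..} (\<lambda>t. h b t x)"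
    by metis
  define g where "g t x = (\<Sum>b\<in>Basis. h b t x *\<^sub>R b)" for t x
  have L: "0 \<le> L" using lip[of 0] lipschitz_on_nonneg by auto
  show ?thesis
  proof (rule that[of g "real DIM('b) * L"])
    show "g t x = f t x" if "0 \<le> t" "x \<in> C" for t x
      using that h(1) by (simp add: g_def euclidean_representation cong: sum.cong)
    show "continuous_on {0..} (\<lambda>t. g t x)" for x
      unfolding g_def by (intro continuous_intros h(3))
    show "(real DIM('b) * L)-lipschitz_on UNIV (g t)" if t: "0 \<le> t" for t
    proof (rule lipschitz_onI)
      fix x y :: 'a
      have "dist (g t x) (g t y) = norm (\<Sum>b\<in>Basis. (h b t x - h b t y) *\<^sub>R b)"
        by (simp add: g_def dist_norm sum_subtractf scaleR_diff_left)
      also have "\<dots> \<le> (\<Sum>b::'b\<in>Basis. L * dist x y)"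
        by (intro sum_norm_le) (use lipschitz_onD[OF h(2)[OF _ t], of _ x y] in \<open>auto simp: dist_real_def\<close>)
      finally show "dist (g t x) (g t y) \<le> real DIM('b) * L * dist x y" by simp
    qed (use L in simp)
  qed
qed

text \<open>A limit inferior equal to 0 yields arbitrarily small good \<open>h\<close>, not all
  small \<open>h\<close>; this is the kind of step that \<open>dini_gronwall\<close>
  accepts.\<close>

lemma tangent_coneD:
  assumes "z \<in> tangent_cone S q" "0 < \<eta>" "0 < \<delta>"
  obtains h where "0 < h" "h < \<delta>" "infdist (q + h *\<^sub>R z) S \<le> \<eta> * h"
proof (rule ccontr)
  assume "\<not> thesis"
  then have "\<eta> * h < infdist (q + h *\<^sub>R z) S" if "0 < h" "h < \<delta>" for h
    using that assms \<open>\<not> thesis\<close> not_le by (metis \<open>\<And>h. \<lbrakk>0 < h; h < \<delta>; infdist (q + h *\<^sub>R z) S \<le> \<eta> * h\<rbrakk> \<Longrightarrow> thesis\<close>)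
  then have "\<forall>\<^sub>F h in at_right 0. ereal \<eta> \<le> ereal (infdist (q + h *\<^sub>R z) S / h)"
    unfolding eventually_at_right[OF \<open>0 < \<delta>\<close>] using \<open>0 < \<delta>\<close>
    by (intro exI[of _ \<delta>]) (auto simp: field_simps intro: less_imp_le)
  then have "ereal \<eta> \<le> Liminf (at_right 0) (\<lambda>h. ereal (infdist (q + h *\<^sub>R z) S / h))"
    by (rule Liminf_bounded)
  then show False using assms by (simp add: tangent_cone_def)
qed

text \<open>Tangency of \<open>- w\<close> to \<open>S\<close> keeps trajectories that start off \<open>S\<close> at a positive distance from it:
  backwards in time, the distance satisfies the Dini differential inequality \<open>e' \<le> L e\<close>.\<close>

lemma distance_along_tangent_field:
  fixes w :: "real \<Rightarrow> real^3 \<Rightarrow> real^3"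
  assumes S: "closed S" "S \<noteq> {}" and T: "0 \<le> T"
    and lip: "\<And>t. t \<in> {0..T} \<Longrightarrow> L-lipschitz_on UNIV (w t)"
    and tangent: "\<And>t q. t \<in> {0..T} \<Longrightarrow> q \<in> S \<Longrightarrow> - w t q \<in> tangent_cone S q"
    and x: "\<And>t. t \<in> {0..T} \<Longrightarrow> (x has_vector_derivative w t (x t)) (at t within {0..T})"
  shows "infdist (x 0) S \<le> exp (L * T) * infdist (x T) S"
proof -
  have L: "0 \<le> L" using lip[of 0] T lipschitz_on_nonneg by auto
  have "infdist (x (T - T)) S \<le> exp (L * T) * (infdist (x (T - 0)) S + 0 * T)"
  proof (rule dini_gronwall[where e = "\<lambda>\<sigma>. infdist (x (T - \<sigma>)) S"])
    have "continuous_on {0..T} x" using x by (rule continuous_on_vector_derivative)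
    then have "continuous_on {0..T} (\<lambda>\<sigma>. x (T - \<sigma>))"
      by (rule continuous_on_compose2) (auto intro!: continuous_intros)
    then show "continuous_on {0..T} (\<lambda>\<sigma>. infdist (x (T - \<sigma>)) S)"
      by (intro continuous_on_infdist)
  next
    fix \<sigma> \<eta> \<delta> :: real
    assume \<sigma>: "0 \<le> \<sigma>" "\<sigma> < T" and \<eta>: "0 < \<eta>" and \<delta>: "0 < \<delta>" "\<delta> \<le> T - \<sigma>"
    define s where "s = T - \<sigma>"
    have s: "s \<in> {0..T}" using \<sigma> by (auto simp: s_def)
    \<comment> \<open>From the nearest point \<open>q\<close> the step \<open>- h w(s, q)\<close>
      stays close to \<open>S\<close> by tangency. The backward trajectory from \<open>x s\<close>
      makes nearly the step \<open>- h w(s, x s)\<close>, and the two steps differ by at most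
      \<open>h * (L * dist (x s) q)\<close>.\<close>
    obtain q where q: "q \<in> S" "infdist (x s) S = dist (x s) q"
      using infdist_attains_inf[OF S] by blast
    obtain d where d: "d > 0" "\<And>r. r \<in> {0..T} \<Longrightarrow> \<bar>r - s\<bar> < d \<Longrightarrow>
        norm (x r - x s - (r - s) *\<^sub>R w s (x s)) \<le> \<eta> / 2 * \<bar>r - s\<bar>"
      using has_vector_derivative_within_bound[OF x[OF s], of "\<eta> / 2"] \<eta> by auto
    obtain h where h: "0 < h" "h < min d \<delta>" "infdist (q + h *\<^sub>R (- w s q)) S \<le> \<eta> / 2 * h"
      using tangent_coneD[OF tangent[OF s q(1)], of "\<eta> / 2" "min d \<delta>"] \<eta> \<delta> d by auto
    have a: "norm (x (s - h) - x s + h *\<^sub>R w s (x s)) \<le> \<eta> / 2 * h"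
      using d(2)[of "s - h"] h \<delta> s by (auto simp: s_def)
    have b: "norm (h *\<^sub>R w s q - h *\<^sub>R w s (x s)) \<le> h * (L * dist (x s) q)"
      using lipschitz_onD[OF lip[OF s], of q "x s"] h
      by (simp add: dist_norm norm_minus_commute flip: scaleR_diff_right)
    have "dist (x (s - h)) (q + h *\<^sub>R (- w s q)) =
        norm ((x (s - h) - x s + h *\<^sub>R w s (x s)) + (h *\<^sub>R w s q - h *\<^sub>R w s (x s)) + (x s - q))"
      by (simp add: dist_norm algebra_simps)
    also have "\<dots> \<le> \<eta> / 2 * h + h * (L * dist (x s) q) + dist (x s) q"
      by (intro norm_triangle_mono a b) (simp add: dist_norm)
    finally have "infdist (x (s - h)) S \<le> dist (x s) q + h * (L * dist (x s) q + 0 + \<eta>)"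
      using infdist_triangle[of "x (s - h)" S "q + h *\<^sub>R (- w s q)"] h(3) by (simp add: algebra_simps)
    then show "\<exists>h>0. h < \<delta> \<and> infdist (x (T - (\<sigma> + h))) S \<le>
        infdist (x (T - \<sigma>)) S + h * (L * infdist (x (T - \<sigma>)) S + 0 + \<eta>)"
      using h q(2) by (intro exI[of _ h]) (auto simp: s_def algebra_simps)
  qed (use T L in \<open>auto simp: infdist_nonneg\<close>)
  then show ?thesis by simp
qed

definition slice_embed :: "(real^3) \<Rightarrow>\<^sub>L (real \<times> (real^3))" where
  "slice_embed = Blinfun (\<lambda>\<eta>. (0, \<eta>))"

lemma slice_embed_apply [simp]: "blinfun_apply slice_embed \<eta> = (0, \<eta>)"
  unfolding slice_embed_def
  by (subst bounded_linear_Blinfun_apply) (auto intro!: bounded_linear_intros bounded_linear_Pair)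

section \<open>Invariance of the domain and the flow map\<close>

locale velocity_field =
  fixes \<Omega> :: "(real^3) set" and v :: "real \<times> (real^3) \<Rightarrow> real^3" and L :: real
    and v' :: "real \<times> (real^3) \<Rightarrow> (real \<times> (real^3)) \<Rightarrow>\<^sub>L (real^3)"
    and D2v :: "3 \<Rightarrow> real \<Rightarrow> real^3 \<Rightarrow> (real^3) \<Rightarrow>\<^sub>L (real^3)"
  assumes open_\<Omega>: "open \<Omega>" and connected_\<Omega>: "connected \<Omega>" and bounded_\<Omega>: "bounded \<Omega>"
    and v_cont: "continuous_on ({0..} \<times> closure \<Omega>) v"
    and v_lip: "\<And>t. 0 \<le> t \<Longrightarrow> L-lipschitz_on (closure \<Omega>) (\<lambda>x. v (t, x))"
    and v_tangent: "H2 \<Omega> v"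
    and v_deriv: "\<And>p. p \<in> {0..} \<times> \<Omega> \<Longrightarrow> (v has_derivative v' p) (at p within {0..} \<times> \<Omega>)"
    and v'_cont: "continuous_on ({0..} \<times> \<Omega>) v'"
    and v'_deriv: "\<And>i t x. 0 \<le> t \<Longrightarrow> x \<in> \<Omega> \<Longrightarrow>
      ((\<lambda>x. v' (t, x) (0, axis i 1)) has_derivative D2v i t x) (at x)"
    and D2v_cont: "\<And>i. continuous_on ({0..} \<times> \<Omega>) (\<lambda>(t, x). D2v i t x)"
begin

lemma L_nonneg: "0 \<le> L"
  using v_lip[of 0] lipschitz_on_nonneg by auto

text \<open>\<open>v\<close> is extended to a Lipschitz field \<open>w\<close> on the whole space,
  whose solution exists for all times. If it met \<open>frontier \<Omega>\<close>, the distance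
  estimate would put its starting point there. By connectedness of its path it therefore never
  leaves \<Omega>, where \<open>w\<close> agrees with \<open>v\<close>.\<close>

lemma solution_exists:
  assumes \<xi>: "\<xi> \<in> \<Omega>"
  shows "\<exists>x. solution_through \<Omega> v 0 \<xi> x \<and> (\<forall>s\<ge>0. x s \<in> \<Omega>)"
proof -
  have C: "compact (closure \<Omega>)" "closure \<Omega> \<noteq> {}"
    using bounded_\<Omega> \<xi> by (auto simp: compact_closure)
  have "\<Omega> \<noteq> UNIV" using bounded_\<Omega> not_bounded_UNIV by metis
  then have fr: "closed (frontier \<Omega>)" "frontier \<Omega> \<noteq> {}" using \<xi> by (auto simp: frontier_eq_empty)
  obtain w M where w: "\<And>t x. 0 \<le> t \<Longrightarrow> x \<in> closure \<Omega> \<Longrightarrow> w t x = v (t, x)"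
    "\<And>t. 0 \<le> t \<Longrightarrow> M-lipschitz_on UNIV (w t)" "\<And>x. continuous_on {0..} (\<lambda>t. w t x)"
    using lipschitz_extension[OF C, of L "\<lambda>t x. v (t, x)"] v_lip v_cont by auto
  obtain x where x: "x 0 = \<xi>" "\<And>t. 0 \<le> t \<Longrightarrow> (x has_vector_derivative w t (x t)) (at t within {0..})"
    using lipschitz_ode_exists_global[of w "\<lambda>_. M" \<xi>] w by auto
  have off: "x T \<notin> frontier \<Omega>" if T: "0 \<le> T" for T
  proof
    assume "x T \<in> frontier \<Omega>"
    have "infdist (x 0) (frontier \<Omega>) \<le> exp (M * T) * infdist (x T) (frontier \<Omega>)"
    proof (rule distance_along_tangent_field[OF fr T])
      fix t assume t: "t \<in> {0..T}"
      show "M-lipschitz_on UNIV (w t)" using w(2) t by simp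
      show "(x has_vector_derivative w t (x t)) (at t within {0..T})"
        by (rule has_vector_derivative_within_subset[OF x(2)]) (use t in auto)
      show "- w t q \<in> tangent_cone (frontier \<Omega>) q" if "q \<in> frontier \<Omega>" for q
        using v_tangent that t w(1)[of t q] by (auto simp: H2_def frontier_def)
    qed
    also have "\<dots> = 0" using \<open>x T \<in> frontier \<Omega>\<close> by simp
    finally have "\<xi> \<in> frontier \<Omega>"
      using fr x(1) infdist_nonneg[of \<xi> "frontier \<Omega>"] by (simp add: in_closed_iff_infdist_zero)
    then show False using \<xi> open_\<Omega> by (simp add: frontier_def interior_open)
  qed
  have inside: "x s \<in> \<Omega>" if s: "0 \<le> s" for s
  proof (rule ccontr)
    assume "x s \<notin> \<Omega>"
    have cont: "continuous_on {0..} x"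
      by (rule continuous_on_vector_derivative[where f' = "\<lambda>t. w t (x t)"]) (auto intro: x)
    have "connected (x ` {0..s})"
      by (intro connected_continuous_image continuous_on_subset[OF cont]) auto
    moreover have "x ` {0..s} \<inter> \<Omega> \<noteq> {}" "x ` {0..s} - \<Omega> \<noteq> {}"
      using s \<xi> x(1) \<open>x s \<notin> \<Omega>\<close> by force+
    ultimately have "x ` {0..s} \<inter> frontier \<Omega> \<noteq> {}" by (rule connected_Int_frontier)
    then show False using off by auto
  qed
  show ?thesis
    using x inside w(1) closure_subset[of \<Omega>]
    by (intro exI[of _ x]) (auto simp: solution_through_def subset_eq)
qed

definition X :: "real \<Rightarrow> real^3 \<Rightarrow> real^3" where
  "X t \<xi> = flow \<Omega> v t 0 \<xi>"

text \<open>Uniqueness among solutions in \<open>closure \<Omega>\<close> resolves the definite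
  description in \<open>flow\<close>, so that \<open>X\<close> inherits the properties of the
  solution from \<open>solution_exists\<close>.\<close>

lemma X_solution:
  assumes "\<xi> \<in> \<Omega>"
  shows "X 0 \<xi> = \<xi>" "0 \<le> t \<Longrightarrow> X t \<xi> \<in> \<Omega>"
    "0 \<le> t \<Longrightarrow> ((\<lambda>s. X s \<xi>) has_vector_derivative v (t, X t \<xi>)) (at t within {0..})"
proof -
  obtain x where x: "solution_through \<Omega> v 0 \<xi> x" "\<And>s. 0 \<le> s \<Longrightarrow> x s \<in> \<Omega>"
    using solution_exists[OF assms] by blast
  have Xx: "X t \<xi> = x t" if t: "0 \<le> t" for t
    unfolding X_def flow_def
  proof (rule the_equality)
    fix y assume "\<exists>z. solution_through \<Omega> v 0 \<xi> z \<and> y = z t"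
    then obtain z where z: "solution_through \<Omega> v 0 \<xi> z" "y = z t" by blast
    have "norm (z t - x t) \<le> exp (L * t) * norm (z 0 - x 0)"
    proof (rule ode_unique[of t z "\<lambda>t x. v (t, x)" x L "closure \<Omega>"])
      fix s assume s: "s \<in> {0..t}"
      have "(u has_vector_derivative v (s, u s)) (at s within {0..t})" if "solution_through \<Omega> v 0 \<xi> u" for u
        by (rule has_vector_derivative_within_subset[of _ _ _ "{0..}"])
          (use that s in \<open>auto simp: solution_through_def\<close>)
      then show "(z has_vector_derivative v (s, z s)) (at s within {0..t})"
        "(x has_vector_derivative v (s, x s)) (at s within {0..t})"
        using x(1) z(1) by blast+
    qed (use x z t v_lip in \<open>auto simp: solution_through_def\<close>)
    then show "y = x t" using z x by (simp add: solution_through_def)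
  qed (use x in auto)
  show "X 0 \<xi> = \<xi>" "0 \<le> t \<Longrightarrow> X t \<xi> \<in> \<Omega>" using x Xx by (auto simp: solution_through_def)
  assume t: "0 \<le> t"
  have "(x has_vector_derivative v (t, X t \<xi>)) (at t within {0..})"
    using x(1) t Xx by (simp add: solution_through_def)
  then show "((\<lambda>s. X s \<xi>) has_vector_derivative v (t, X t \<xi>)) (at t within {0..})"
    by (rule has_vector_derivative_transform[rotated -1]) (use t Xx in auto)
qed

text \<open>The stability estimate for the time-reversed trajectories. It makes \<open>X t\<close>
  injective and bounds how far apart the initial points of close final points can be.\<close>

lemma X_expand:
  assumes t: "0 \<le> t" and "\<xi> \<in> \<Omega>" "\<zeta> \<in> \<Omega>"
  shows "norm (\<xi> - \<zeta>) \<le> exp (L * t) * norm (X t \<xi> - X t \<zeta>)"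
proof -
  have rev: "((\<lambda>\<sigma>. X (t - \<sigma>) \<xi>) has_vector_derivative - v (t - \<sigma>, X (t - \<sigma>) \<xi>)) (at \<sigma> within {0..t})"
    if "\<xi> \<in> \<Omega>" "\<sigma> \<in> {0..t}" for \<xi> \<sigma>
  proof -
    have "((\<lambda>s. X s \<xi>) \<circ> (\<lambda>\<sigma>. t - \<sigma>) has_vector_derivative (- 1) *\<^sub>R v (t - \<sigma>, X (t - \<sigma>) \<xi>)) (at \<sigma> within {0..t})"
    proof (rule vector_diff_chain_within)
      show "((\<lambda>\<sigma>. t - \<sigma>) has_vector_derivative - 1) (at \<sigma> within {0..t})"
        by (auto intro!: derivative_eq_intros)
      show "((\<lambda>s. X s \<xi>) has_vector_derivative v (t - \<sigma>, X (t - \<sigma>) \<xi>)) (at (t - \<sigma>) within (\<lambda>\<sigma>. t - \<sigma>) ` {0..t})"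
        by (rule has_vector_derivative_within_subset[OF X_solution(3)]) (use that in auto)
    qed
    then show ?thesis by (simp add: o_def)
  qed
  have "norm (X (t - t) \<xi> - X (t - t) \<zeta>) \<le> exp (L * t) * norm (X (t - 0) \<xi> - X (t - 0) \<zeta>)"
  proof (rule ode_unique[of t "\<lambda>\<sigma>. X (t - \<sigma>) \<xi>" "\<lambda>\<sigma> x. - v (t - \<sigma>, x)" "\<lambda>\<sigma>. X (t - \<sigma>) \<zeta>" L "closure \<Omega>"])
    fix \<sigma> assume \<sigma>: "\<sigma> \<in> {0..t}"
    then show "L-lipschitz_on (closure \<Omega>) (\<lambda>x. - v (t - \<sigma>, x))"
      using v_lip[of "t - \<sigma>"] by (simp add: lipschitz_on_minus)
    show "X (t - \<sigma>) \<xi> \<in> closure \<Omega>" "X (t - \<sigma>) \<zeta> \<in> closure \<Omega>"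
      using X_solution(2)[OF assms(2), of "t - \<sigma>"] X_solution(2)[OF assms(3), of "t - \<sigma>"]
        \<sigma> closure_subset[of \<Omega>] by auto
  qed (use rev assms in auto)
  then show ?thesis using X_solution(1) assms by simp
qed

definition Vx :: "real \<Rightarrow> real^3 \<Rightarrow> (real^3) \<Rightarrow>\<^sub>L (real^3)" where
  "Vx t x = v' (t, x) o\<^sub>L slice_embed"

lemma Vx_deriv:
  assumes "0 \<le> t" "x \<in> \<Omega>"
  shows "((\<lambda>x. v (t, x)) has_derivative Vx t x) (at x)"
proof -
  have "((\<lambda>x. v (t, x)) has_derivative (\<lambda>\<eta>. v' (t, x) (0, \<eta>))) (at x within \<Omega>)"
  proof (rule has_derivative_in_compose[where g = v and f = "\<lambda>x. (t, x)"])
    show "((\<lambda>x. (t, x)) has_derivative (\<lambda>\<eta>. (0, \<eta>))) (at x within \<Omega>)"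
      by (auto intro!: derivative_eq_intros)
    show "(v has_derivative v' (t, x)) (at (t, x) within (\<lambda>x. (t, x)) ` \<Omega>)"
      by (rule has_derivative_subset[OF v_deriv]) (use assms in auto)
  qed
  then show ?thesis
    using assms open_\<Omega> by (simp add: Vx_def[abs_def] at_within_open[of x \<Omega>] o_def blinfun_compose.rep_eq)
qed

lemma Vx_cont: "continuous_on ({0..} \<times> \<Omega>) (\<lambda>(t, x). Vx t x)"
  unfolding Vx_def case_prod_unfold
  by (intro continuous_intros) (use v'_cont in simp)

sublocale xflow: C1_flow "\<lambda>t x. v (t, x)" Vx X \<Omega> \<Omega>
  by unfold_locales (auto intro!: open_\<Omega> Vx_deriv Vx_cont X_solution)

end

section \<open>Continuously differentiable functions and transport of covectors\<close>

text \<open>In finite dimension an operator-valued map is continuous as soon as its values on basis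
  vectors are; the derivative may therefore be given as a plain function.\<close>

lemma C1_onI:
  fixes f :: "'a::euclidean_space \<Rightarrow> 'b::real_normed_vector"
  assumes "openin (top_of_set A) S"
    and der: "\<And>p. p \<in> S \<Longrightarrow> (f has_derivative f' p) (at p within S)"
    and cont: "\<And>b. b \<in> Basis \<Longrightarrow> continuous_on S (\<lambda>p. f' p b)"
  shows "C1_on A S f"
  unfolding C1_on_def
proof (intro conjI exI[of _ "\<lambda>p. Blinfun (f' p)"] ballI)
  have eq: "blinfun_apply (Blinfun (f' p)) = f' p" if "p \<in> S" for p
    using der[OF that] by (simp add: bounded_linear_Blinfun_apply has_derivative_bounded_linear)
  show "(f has_derivative blinfun_apply (Blinfun (f' p))) (at p within S)" if "p \<in> S" for p
    using der[OF that] eq[OF that] by simp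
  show "continuous_on S (\<lambda>p. Blinfun (f' p))"
    by (rule continuous_on_blinfun_componentwise) (use cont eq in \<open>simp cong: continuous_on_cong\<close>)
qed (rule assms)

lemma C1_onE:
  assumes "C1_on A S f"
  obtains f' where "openin (top_of_set A) S"
    "\<And>p. p \<in> S \<Longrightarrow> (f has_derivative blinfun_apply (f' p)) (at p within S)" "continuous_on S f'"
  using assms unfolding C1_on_def by blast

lemma C1_on_openin: "C1_on A S f \<Longrightarrow> openin (top_of_set A) S"
  by (simp add: C1_on_def)

lemma C1_on_continuous: "C1_on A S f \<Longrightarrow> continuous_on S f"
  by (meson C1_onE has_derivative_continuous_on)

lemma C1_on_compose:
  assumes f: "C1_on A S f" and g: "C1_on B T g" and "f ` S \<subseteq> T"
  shows "C1_on A S (\<lambda>x. g (f x))"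
proof -
  obtain f' where f': "openin (top_of_set A) S"
    "\<And>p. p \<in> S \<Longrightarrow> (f has_derivative blinfun_apply (f' p)) (at p within S)" "continuous_on S f'"
    using C1_onE[OF f] by metis
  obtain g' where g': "\<And>p. p \<in> T \<Longrightarrow> (g has_derivative blinfun_apply (g' p)) (at p within T)" "continuous_on T g'"
    using C1_onE[OF g] by metis
  have "((\<lambda>x. g (f x)) has_derivative blinfun_apply (g' (f p) o\<^sub>L f' p)) (at p within S)" if "p \<in> S" for p
    unfolding blinfun_compose.rep_eq o_def
  proof (rule has_derivative_in_compose[where g = g])
    show "(f has_derivative blinfun_apply (f' p)) (at p within S)" using f'(2) that .
    show "(g has_derivative blinfun_apply (g' (f p))) (at (f p) within f ` S)"
      by (rule has_derivative_subset[OF g'(1)]) (use assms(3) that in auto)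
  qed
  moreover have "continuous_on S (\<lambda>p. g' (f p) o\<^sub>L f' p)"
    by (rule bounded_bilinear.continuous_on[OF bounded_bilinear_blinfun_compose
          continuous_on_compose2[OF g'(2) C1_on_continuous[OF f] assms(3)] f'(3)])
  ultimately show ?thesis
    unfolding C1_on_def using f'(1) by (intro conjI exI[of _ "\<lambda>p. g' (f p) o\<^sub>L f' p"]) auto
qed

lemma C1_on_bounded_linear:
  fixes f :: "'a::real_normed_vector \<Rightarrow> 'b::real_normed_vector"
  assumes "bounded_linear f" and "openin (top_of_set A) S"
  shows "C1_on A S f"
  unfolding C1_on_def
  by (intro conjI exI[of _ "\<lambda>_. Blinfun f"])
    (use assms in \<open>auto simp: bounded_linear_Blinfun_apply intro: bounded_linear_imp_has_derivative\<close>)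

lemma C1_on_Pair:
  fixes f :: "'a::euclidean_space \<Rightarrow> 'b::real_normed_vector" and g :: "'a \<Rightarrow> 'c::real_normed_vector"
  assumes f: "C1_on A S f" and g: "C1_on A S g"
  shows "C1_on A S (\<lambda>x. (f x, g x))"
proof -
  obtain f' where f': "\<And>p. p \<in> S \<Longrightarrow> (f has_derivative blinfun_apply (f' p)) (at p within S)" "continuous_on S f'"
    using C1_onE[OF f] by metis
  obtain g' where g': "\<And>p. p \<in> S \<Longrightarrow> (g has_derivative blinfun_apply (g' p)) (at p within S)" "continuous_on S g'"
    using C1_onE[OF g] by metis
  show ?thesis
    by (rule C1_onI[where f' = "\<lambda>p h. (f' p h, g' p h)"])
      (auto intro!: C1_on_openin[OF f] has_derivative_Pair f' g' continuous_intros)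
qed

lemma C1_on_bilinear:
  fixes mul :: "'b::euclidean_space \<Rightarrow> 'c::euclidean_space \<Rightarrow> 'd::real_normed_vector"
    and f :: "'a::euclidean_space \<Rightarrow> 'b" and g :: "'a \<Rightarrow> 'c"
  assumes "bounded_bilinear mul" and f: "C1_on A S f" and g: "C1_on A S g"
  shows "C1_on A S (\<lambda>x. mul (f x) (g x))"
proof -
  interpret bounded_bilinear mul by fact
  obtain f' where f': "\<And>p. p \<in> S \<Longrightarrow> (f has_derivative blinfun_apply (f' p)) (at p within S)" "continuous_on S f'"
    using C1_onE[OF f] by metis
  obtain g' where g': "\<And>p. p \<in> S \<Longrightarrow> (g has_derivative blinfun_apply (g' p)) (at p within S)" "continuous_on S g'"
    using C1_onE[OF g] by metis
  show ?thesis
    by (rule C1_onI[where f' = "\<lambda>p h. mul (f p) (g' p h) + mul (f' p h) (g p)"])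
      (auto intro!: C1_on_openin[OF f] FDERIV f' g' continuous_intros continuous_on
        C1_on_continuous[OF f] C1_on_continuous[OF g])
qed

lemmas C1_on_scaleR = C1_on_bilinear[OF bounded_bilinear_scaleR]
  and C1_on_inner = C1_on_bilinear[OF bounded_bilinear_inner]

lemma C1_on_add:
  fixes f :: "'a::euclidean_space \<Rightarrow> 'b::real_normed_vector"
  assumes f: "C1_on A S f" and g: "C1_on A S g"
  shows "C1_on A S (\<lambda>x. f x + g x)"
  using C1_on_compose[OF C1_on_Pair[OF f g] C1_on_bounded_linear[of "\<lambda>p. fst p + snd p" UNIV UNIV]]
  by (simp add: bounded_linear_add bounded_linear_fst bounded_linear_snd)

lemma C1_on_minus: "C1_on A S f \<Longrightarrow> C1_on A S (\<lambda>x. - f x)"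
  using C1_on_compose[of A S f UNIV UNIV uminus]
  by (simp add: C1_on_bounded_linear bounded_linear_minus bounded_linear_ident)

lemma C1_on_linear_compose:
  "C1_on A S f \<Longrightarrow> bounded_linear g \<Longrightarrow> C1_on A S (\<lambda>x. g (f x))"
  by (rule C1_on_compose[where B = UNIV and T = UNIV]) (auto intro: C1_on_bounded_linear)

lemma C1_on_cong:
  assumes "C1_on A S f" "\<And>x. x \<in> S \<Longrightarrow> f x = g x"
  shows "C1_on A S g"
  using assms unfolding C1_on_def
  by (metis has_derivative_transform)

lemma C1_on_sgn: "C1_on UNIV (- {0}) (sgn :: 'a::euclidean_space \<Rightarrow> 'a)"
proof -
  have inv: "C1_on UNIV (- {0}) (inverse :: real \<Rightarrow> real)"
    by (rule C1_onI[where f' = "\<lambda>x h. - (inverse x * h * inverse x)"])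
      (auto intro!: has_derivative_inverse' continuous_intros derivative_eq_intros)
  have nrm: "C1_on UNIV (- {0}) (norm :: 'a \<Rightarrow> real)"
  proof (rule C1_onI[where f' = "\<lambda>x h. h \<bullet> sgn x"])
    show "(norm has_derivative (\<lambda>h. h \<bullet> sgn p)) (at p within - {0})" if "p \<in> - {0}" for p :: 'a
      using that by (intro has_derivative_at_withinI[OF has_derivative_norm]) simp
    show "continuous_on (- {0}) (\<lambda>x. b \<bullet> sgn x)" for b :: 'a
      by (intro continuous_intros) auto
  qed auto
  have "C1_on UNIV (- {0}) (\<lambda>x::'a. inverse (norm x) *\<^sub>R x)"
    by (intro C1_on_scaleR C1_on_compose[OF nrm inv] C1_on_bounded_linear bounded_linear_ident) auto
  then show ?thesis by (simp add: sgn_div_norm[abs_def])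
qed

section \<open>Total derivatives from continuous partial derivatives\<close>

lemma has_derivative_vec_lambda:
  fixes f :: "'a::real_normed_vector \<Rightarrow> 'n::finite \<Rightarrow> real"
  assumes "\<And>i. ((\<lambda>x. f x i) has_derivative (\<lambda>h. f' h i)) F"
  shows "((\<lambda>x. \<chi> i. f x i) has_derivative (\<lambda>h. \<chi> i. f' h i)) F"
proof -
  have eq: "(\<chi> i. a i) = (\<Sum>i\<in>UNIV. a i *\<^sub>R axis i 1)" for a :: "'n \<Rightarrow> real"
    by (simp add: vec_eq_iff axis_def if_distrib cong: if_cong)
  show ?thesis unfolding eq by (intro has_derivative_sum has_derivative_scaleR_left assms)
qed

text \<open>The mean value inequality along a coordinate segment, applied to \<open>f\<close> minus
  the linear function with slope \<open>D\<close>; convexity keeps the segment in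
  \<open>B\<close>.\<close>

lemma partial_increment:
  fixes f :: "real^3 \<Rightarrow> 'b::real_normed_vector"
  assumes "convex B" and partial: "\<And>z. z \<in> B \<Longrightarrow> ((\<lambda>h. f (z + h *\<^sub>R axis i 1)) has_vector_derivative d z) (at 0)"
    and near: "\<And>z. z \<in> B \<Longrightarrow> norm (d z - D) \<le> e"
    and z: "z \<in> B" "z + s *\<^sub>R axis i 1 \<in> B"
  shows "norm (f (z + s *\<^sub>R axis i 1) - f z - s *\<^sub>R D) \<le> e * \<bar>s\<bar>"
proof -
  have seg: "z + u *\<^sub>R axis i 1 \<in> B" if u: "u \<in> closed_segment 0 s" for u
  proof -
    obtain l where l: "0 \<le> l" "l \<le> 1" "u = l * s" using u by (auto simp: in_segment)
    have "(1 - l) *\<^sub>R z + l *\<^sub>R (z + s *\<^sub>R axis i 1) \<in> B"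
      by (rule convexD_alt[OF assms(1) z l(1,2)])
    then show ?thesis by (simp add: l algebra_simps)
  qed
  have "norm ((\<lambda>u. f (z + u *\<^sub>R axis i 1) - u *\<^sub>R D) s - (\<lambda>u. f (z + u *\<^sub>R axis i 1) - u *\<^sub>R D) 0) \<le> e * norm (s - 0)"
  proof (rule differentiable_bound[of "closed_segment 0 s" _ "\<lambda>u h. h *\<^sub>R (d (z + u *\<^sub>R axis i 1) - D)"])
    fix u assume u: "u \<in> closed_segment 0 s"
    have "((\<lambda>h. f ((z + u *\<^sub>R axis i 1) + h *\<^sub>R axis i 1)) \<circ> (\<lambda>w. w - u) has_vector_derivative 1 *\<^sub>R d (z + u *\<^sub>R axis i 1)) (at u)"
      by (rule vector_diff_chain_at) (use partial[OF seg[OF u]] in \<open>auto intro!: derivative_eq_intros\<close>)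
    then have "((\<lambda>w. f (z + w *\<^sub>R axis i 1)) has_vector_derivative d (z + u *\<^sub>R axis i 1)) (at u)"
      by (simp add: o_def algebra_simps)
    then have "((\<lambda>w. f (z + w *\<^sub>R axis i 1)) has_derivative (\<lambda>h. h *\<^sub>R d (z + u *\<^sub>R axis i 1))) (at u)"
      by (simp add: has_vector_derivative_def)
    then show "((\<lambda>u. f (z + u *\<^sub>R axis i 1) - u *\<^sub>R D) has_derivative (\<lambda>h. h *\<^sub>R (d (z + u *\<^sub>R axis i 1) - D)))
        (at u within closed_segment 0 s)"
      unfolding scaleR_diff_right
      by (rule has_derivative_at_withinI[OF has_derivative_diff
            [OF _ bounded_linear_imp_has_derivative[OF bounded_linear_scaleR_left]]])
    show "onorm (\<lambda>h. h *\<^sub>R (d (z + u *\<^sub>R axis i 1) - D)) \<le> e"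
      by (rule onorm_le) (use mult_right_mono[OF near[OF seg[OF u]] abs_ge_zero] in \<open>auto simp: mult_ac\<close>)
  qed auto
  then show ?thesis by (simp add: algebra_simps)
qed

text \<open>The passage from \<open>x\<close> to \<open>y\<close> is made along three coordinate
  segments, each contributing an error of at most \<open>e / 3 * norm (y - x)\<close>.\<close>

lemma continuous_partials_has_derivative:
  fixes f :: "real^3 \<Rightarrow> 'b::real_normed_vector"
  assumes "open U" and x: "x \<in> U"
    and partial: "\<And>i z. z \<in> U \<Longrightarrow> ((\<lambda>h. f (z + h *\<^sub>R axis i 1)) has_vector_derivative d i z) (at 0)"
    and cont: "\<And>i. continuous_on U (d i)"
  shows "(f has_derivative (\<lambda>\<eta>. \<Sum>i\<in>UNIV. \<eta> $ i *\<^sub>R d i x)) (at x)"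
  unfolding has_derivative_at_alt
proof (intro conjI allI impI)
  show "bounded_linear (\<lambda>\<eta>. \<Sum>i\<in>UNIV. \<eta> $ i *\<^sub>R d i x)"
    by (intro bounded_linear_sum bounded_linear_scaleR_left[THEN bounded_linear_compose] bounded_linear_vec_nth)
  fix e :: real assume e: "0 < e"
  obtain r0 where r0: "r0 > 0" "ball x r0 \<subseteq> U" using assms(1) x openE by blast
  have "\<exists>r>0. \<forall>z\<in>U. dist z x < r \<longrightarrow> norm (d i z - d i x) \<le> e / 3" for i
    using cont[of i, unfolded continuous_on_iff, rule_format, OF x, of "e / 3"] e
    by (auto simp: dist_norm intro: less_imp_le)
  then obtain r where r: "\<And>i. r i > 0" "\<And>i z. z \<in> U \<Longrightarrow> dist z x < r i \<Longrightarrow> norm (d i z - d i x) \<le> e / 3"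
    by metis
  define R where "R = min r0 (min (r 1) (min (r 2) (r 3)))"
  have R: "R > 0" using r0 r by (auto simp: R_def)
  have RU: "ball x R \<subseteq> U" using r0 by (auto simp: R_def)
  have near: "norm (d i z - d i x) \<le> e / 3" if "z \<in> ball x R" for i z
  proof -
    have "R \<le> r i" using exhaust_3[of i] by (auto simp: R_def)
    then show ?thesis using r(2)[of z i] that RU by (simp add: dist_commute subset_eq)
  qed
  have "norm (f y - f x - (\<Sum>i\<in>UNIV. (y - x) $ i *\<^sub>R d i x)) \<le> e * norm (y - x)" if y: "norm (y - x) < R" for y
  proof -
    define h where "h = y - x"
    define z1 where "z1 = x + h $ 1 *\<^sub>R axis 1 1"
    define z2 where "z2 = z1 + h $ 2 *\<^sub>R axis 2 1"
    have y_eq: "y = z2 + h $ 3 *\<^sub>R axis 3 1"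
      by (simp add: z2_def z1_def h_def vec_eq_iff forall_3 axis_def)
    \<comment> \<open>Replacing coordinates by 0 does not increase the norm, so the corners
      \<open>z1\<close> and \<open>z2\<close> of the path stay in the ball.\<close>
    have le: "norm (\<chi> i. c i * h $ i) \<le> norm h" if "\<And>i. \<bar>c i\<bar> \<le> 1" for c :: "3 \<Rightarrow> real"
      using that by (intro norm_le_componentwise_cart) (auto simp: abs_mult intro: mult_left_le_one_le)
    have "norm (z1 - x) \<le> norm h" "norm (z2 - x) \<le> norm h"
    proof -
      have "z1 - x = (\<chi> i. (if i = 1 then 1 else 0) * h $ i)" "z2 - x = (\<chi> i. (if i = 3 then 0 else 1) * h $ i)"
        by (simp_all add: z1_def z2_def vec_eq_iff forall_3 axis_def)
      then show "norm (z1 - x) \<le> norm h" "norm (z2 - x) \<le> norm h"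
        using le[of "\<lambda>i. if i = 1 then 1 else 0"] le[of "\<lambda>i. if i = 3 then 0 else 1"] by auto
    qed
    then have B: "x \<in> ball x R" "z1 \<in> ball x R" "z2 \<in> ball x R" "y \<in> ball x R"
      using y R by (auto simp: dist_norm norm_minus_commute h_def)
    have inc: "norm (f (z + s *\<^sub>R axis i 1) - f z - s *\<^sub>R d i x) \<le> e / 3 * \<bar>s\<bar>"
      if "z \<in> ball x R" "z + s *\<^sub>R axis i 1 \<in> ball x R" for z s i
      by (rule partial_increment[OF convex_ball partial near that]) (use RU in auto)
    have inc': "norm (f (z + h $ i *\<^sub>R axis i 1) - f z - h $ i *\<^sub>R d i x) \<le> e / 3 * norm h"
      if "z \<in> ball x R" "z + h $ i *\<^sub>R axis i 1 \<in> ball x R" for z i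
      by (rule order_trans[OF inc[OF that] mult_left_mono[OF component_le_norm_cart]]) (use e in simp)
    have a: "norm (f z1 - f x - h $ 1 *\<^sub>R d 1 x) \<le> e / 3 * norm h"
      unfolding z1_def by (rule inc') (use B in \<open>auto simp: z1_def\<close>)
    have b: "norm (f z2 - f z1 - h $ 2 *\<^sub>R d 2 x) \<le> e / 3 * norm h"
      unfolding z2_def by (rule inc') (use B in \<open>auto simp: z2_def\<close>)
    have c: "norm (f y - f z2 - h $ 3 *\<^sub>R d 3 x) \<le> e / 3 * norm h"
      unfolding y_eq by (rule inc') (use B y_eq in auto)
    have "f y - f x - (\<Sum>i\<in>UNIV. (y - x) $ i *\<^sub>R d i x) =
        (f z1 - f x - h $ 1 *\<^sub>R d 1 x) + (f z2 - f z1 - h $ 2 *\<^sub>R d 2 x) + (f y - f z2 - h $ 3 *\<^sub>R d 3 x)"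
      by (simp add: sum_3 h_def)
    then have "norm (f y - f x - (\<Sum>i\<in>UNIV. (y - x) $ i *\<^sub>R d i x)) \<le> e / 3 * norm h + e / 3 * norm h + e / 3 * norm h"
      using norm_triangle_mono[OF norm_triangle_mono[OF a b] c] by (simp only:)
    then show ?thesis by (simp add: h_def)
  qed
  then show "\<exists>\<delta>>0. \<forall>y. norm (y - x) < \<delta> \<longrightarrow>
      norm (f y - f x - (\<Sum>i\<in>UNIV. (y - x) $ i *\<^sub>R d i x)) \<le> e * norm (y - x)"
    using R by blast
qed

text \<open>\<open>H1\<close> gives second derivatives as iterated partial derivatives. The first
  partial derivatives are columns of \<open>v'\<close> by uniqueness of derivatives, and continuity
  of the second ones makes these columns differentiable in \<open>x\<close>.\<close>

lemma H1_velocity_field: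
  assumes \<Omega>: "open \<Omega>" "connected \<Omega>" "bounded \<Omega>" and H: "H1 \<Omega> v" "H2 \<Omega> v"
  obtains L v' D2v where "velocity_field \<Omega> v L v' D2v"
proof -
  obtain L where L: "\<And>t. t \<ge> 0 \<Longrightarrow> L-lipschitz_on (closure \<Omega>) (\<lambda>x. v (t, x))"
    using H(1) unfolding H1_def by blast
  obtain v' where v': "\<And>p. p \<in> {0..} \<times> \<Omega> \<Longrightarrow> (v has_derivative blinfun_apply (v' p)) (at p within {0..} \<times> \<Omega>)"
    "continuous_on ({0..} \<times> \<Omega>) v'"
    using H(1) C1_onE[of spacetime "{0..} \<times> \<Omega>" v] unfolding H1_def by metis
  obtain d d2 where d: "\<And>i p. p \<in> {0..} \<times> \<Omega> \<Longrightarrow> has_partial_x v i (d i p) p"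
    "\<And>i j p. p \<in> {0..} \<times> \<Omega> \<Longrightarrow> has_partial_x (d i) j (d2 i j p) p"
    "\<And>i. continuous_on ({0..} \<times> \<Omega>) (d i)" "\<And>i j. continuous_on ({0..} \<times> \<Omega>) (d2 i j)"
    using H(1) unfolding H1_def by metis
  have d_eq: "v' (t, x) (0, axis i 1) = d i (t, x)" if t: "0 \<le> t" and x: "x \<in> \<Omega>" for t x i
  proof -
    define S where "S = (\<lambda>h. x + h *\<^sub>R axis i 1) -` \<Omega>"
    have S: "open S" "0 \<in> S" unfolding S_def
      using x by (auto intro!: open_vimage \<Omega>(1) continuous_intros)
    have "((\<lambda>h. v (t, x + h *\<^sub>R axis i 1)) has_derivative (\<lambda>h. v' (t, x) (0, h *\<^sub>R axis i 1))) (at 0 within S)"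
    proof (rule has_derivative_in_compose[where g = v and f = "\<lambda>h. (t, x + h *\<^sub>R axis i 1)"])
      show "((\<lambda>h. (t, x + h *\<^sub>R axis i 1)) has_derivative (\<lambda>h. (0, h *\<^sub>R axis i 1))) (at 0 within S)"
        by (auto intro!: derivative_eq_intros)
      have "(v has_derivative v' (t, x)) (at (t, x) within (\<lambda>h. (t, x + h *\<^sub>R axis i 1)) ` S)"
        by (rule has_derivative_subset[OF v'(1)]) (use t x in \<open>auto simp: S_def\<close>)
      then show "(v has_derivative v' (t, x)) (at (t, x + 0 *\<^sub>R axis i 1) within (\<lambda>h. (t, x + h *\<^sub>R axis i 1)) ` S)"
        by simp
    qed
    moreover have "v' (t, x) (0, h *\<^sub>R axis i 1) = h *\<^sub>R v' (t, x) (0, axis i 1)" for h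
      using blinfun.scaleR_right[of "v' (t, x)" h "(0, axis i 1)"] by simp
    ultimately have "((\<lambda>h. v (t, x + h *\<^sub>R axis i 1)) has_vector_derivative v' (t, x) (0, axis i 1)) (at 0)"
      using at_within_open[OF S(2,1)] by (simp add: has_vector_derivative_def)
    moreover have "((\<lambda>h. v (t, x + h *\<^sub>R axis i 1)) has_vector_derivative d i (t, x)) (at 0)"
      using d(1)[of "(t, x)" i] t x by (simp add: has_partial_x_def)
    ultimately show ?thesis by (rule vector_derivative_unique_at)
  qed
  define D2v where "D2v i t x = Blinfun (\<lambda>\<eta>. \<Sum>j\<in>UNIV. \<eta> $ j *\<^sub>R d2 i j (t, x))" for i t x
  have D2v: "blinfun_apply (D2v i t x) = (\<lambda>\<eta>. \<Sum>j\<in>UNIV. \<eta> $ j *\<^sub>R d2 i j (t, x))" for i t x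
    unfolding D2v_def
    by (intro bounded_linear_Blinfun_apply bounded_linear_sum
        bounded_linear_scaleR_left[THEN bounded_linear_compose] bounded_linear_vec_nth)
  have "velocity_field \<Omega> v L v' D2v"
  proof unfold_locales
    fix i :: 3 and t :: real and x assume t: "0 \<le> t" and x: "x \<in> \<Omega>"
    have "((\<lambda>x. d i (t, x)) has_derivative (\<lambda>\<eta>. \<Sum>j\<in>UNIV. \<eta> $ j *\<^sub>R d2 i j (t, x))) (at x)"
    proof (rule continuous_partials_has_derivative[OF \<Omega>(1) x])
      fix j z assume "z \<in> \<Omega>"
      then show "((\<lambda>h. d i (t, z + h *\<^sub>R axis j 1)) has_vector_derivative d2 i j (t, z)) (at 0)"
        using d(2)[of "(t, z)" i j] t by (simp add: has_partial_x_def)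
    next
      show "continuous_on \<Omega> (\<lambda>z. d2 i j (t, z))" for j
        by (rule continuous_on_compose2[OF d(4)]) (use t in \<open>auto intro!: continuous_intros\<close>)
    qed
    then show "((\<lambda>x. v' (t, x) (0, axis i 1)) has_derivative D2v i t x) (at x)"
      unfolding D2v
      by (rule has_derivative_transform_within_open[OF _ \<Omega>(1) x]) (use t d_eq in simp)
  next
    fix i :: 3
    show "continuous_on ({0..} \<times> \<Omega>) (\<lambda>(t, x). D2v i t x)"
      by (rule continuous_on_blinfun_componentwise)
        (auto simp: case_prod_unfold D2v intro!: continuous_on_sum continuous_on_scaleR continuous_on_const d(4))
  qed (use \<Omega> H L v' in \<open>auto simp: H1_def\<close>)
  then show ?thesis by (rule that)
qed

section \<open>The adjoint variational equation and its flow\<close>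

context velocity_field
begin

text \<open>The transpose of \<open>Vx t x\<close>. In coordinates each entry is an inner product
  with a column, and the columns are differentiable in \<open>x\<close> by
  \<open>v'_deriv\<close>.\<close>

definition Vadj :: "real \<Rightarrow> real^3 \<Rightarrow> real^3 \<Rightarrow> real^3" where
  "Vadj t x q = (\<chi> i. Vx t x (axis i 1) \<bullet> q)"

lemma Vadj_inner: "Vadj t x q \<bullet> \<eta> = q \<bullet> Vx t x \<eta>"
proof -
  have "Vx t x \<eta> = Vx t x (\<Sum>i\<in>UNIV. \<eta> $ i *\<^sub>R axis i 1)"
    by (simp add: basis_expansion flip: scalar_mult_eq_scaleR)
  also have "\<dots> = (\<Sum>i\<in>UNIV. \<eta> $ i *\<^sub>R Vx t x (axis i 1))" by (simp add: blinfun.sum_right blinfun.scaleR_right)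
  finally have "q \<bullet> Vx t x \<eta> = (\<Sum>i\<in>UNIV. \<eta> $ i * (q \<bullet> Vx t x (axis i 1)))" by (simp add: inner_sum_right)
  then show ?thesis by (simp add: Vadj_def inner_vec_def inner_commute mult.commute)
qed

text \<open>The linearization of the coupled right-hand side. Second derivatives of \<open>v\<close>
  enter in the last component, where the matrix of \<open>Vadj\<close> is differentiated in the
  point.\<close>

definition costate_deriv :: "real \<Rightarrow> (real^3) \<times> (real^3) \<Rightarrow> ((real^3) \<times> (real^3)) \<Rightarrow>\<^sub>L ((real^3) \<times> (real^3))" where
  "costate_deriv t z = Blinfun (\<lambda>h. (Vx t (fst z) (fst h),
    - (\<chi> i. Vx t (fst z) (axis i 1) \<bullet> snd h + D2v i t (fst z) (fst h) \<bullet> snd z)))"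

lemma costate_deriv:
  assumes "0 \<le> t" "fst z \<in> \<Omega>"
  shows "((\<lambda>z. (v (t, fst z), - Vadj t (fst z) (snd z))) has_derivative costate_deriv t z) (at z)"
    (is "(?f has_derivative _) _")
    and "blinfun_apply (costate_deriv t z) = (\<lambda>h. (Vx t (fst z) (fst h),
    - (\<chi> i. Vx t (fst z) (axis i 1) \<bullet> snd h + D2v i t (fst z) (fst h) \<bullet> snd z)))" (is "_ = ?D")
proof -
  have fst: "(fst has_derivative fst) (at z)" "(snd has_derivative snd) (at z)"
    by (auto intro!: derivative_eq_intros)
  have 1: "((\<lambda>z. v (t, fst z)) has_derivative (\<lambda>h. Vx t (fst z) (fst h))) (at z)"
    using has_derivative_compose[OF fst(1) Vx_deriv[OF assms]] .
  have 2: "((\<lambda>z. Vx t (fst z) (axis i 1)) has_derivative (\<lambda>h. D2v i t (fst z) (fst h))) (at z)" for i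
    using has_derivative_compose[OF fst(1) v'_deriv[OF assms, of i]] by (simp add: Vx_def)
  have 3: "((\<lambda>z. (\<chi> i. Vx t (fst z) (axis i 1) \<bullet> snd z)) has_derivative
      (\<lambda>h. (\<chi> i. Vx t (fst z) (axis i 1) \<bullet> snd h + D2v i t (fst z) (fst h) \<bullet> snd z))) (at z)"
    by (intro has_derivative_vec_lambda has_derivative_inner 2 fst)
  have D: "(?f has_derivative ?D) (at z)"
    unfolding Vadj_def by (intro has_derivative_Pair 1 has_derivative_minus 3)
  show "blinfun_apply (costate_deriv t z) = ?D"
    unfolding costate_deriv_def
    by (rule bounded_linear_Blinfun_apply[OF has_derivative_bounded_linear[OF D]])
  then show "(?f has_derivative costate_deriv t z) (at z)" using D by simp
qed

lemma continuous_on_Vx: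
  assumes "continuous_on S f" "continuous_on S g" "\<And>p. p \<in> S \<Longrightarrow> 0 \<le> f p" "\<And>p. p \<in> S \<Longrightarrow> g p \<in> \<Omega>"
  shows "continuous_on S (\<lambda>p. Vx (f p) (g p))"
  using continuous_on_compose2[OF Vx_cont continuous_on_Pair[OF assms(1,2)]] assms(3,4) by fastforce

lemma continuous_on_D2v:
  assumes "continuous_on S f" "continuous_on S g" "\<And>p. p \<in> S \<Longrightarrow> 0 \<le> f p" "\<And>p. p \<in> S \<Longrightarrow> g p \<in> \<Omega>"
  shows "continuous_on S (\<lambda>p. D2v i (f p) (g p))"
  using continuous_on_compose2[OF D2v_cont continuous_on_Pair[OF assms(1,2)]] assms(3,4) by fastforce

lemma costate_deriv_cont: "continuous_on ({0..} \<times> (\<Omega> \<times> UNIV)) (\<lambda>(t, z). costate_deriv t z)"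
proof (rule continuous_on_blinfun_componentwise)
  fix b :: "(real^3) \<times> (real^3)" assume "b \<in> Basis"
  have "continuous_on ({0..} \<times> (\<Omega> \<times> UNIV)) (\<lambda>p. (Vx (fst p) (fst (snd p)) (fst b),
      - (\<chi> i. Vx (fst p) (fst (snd p)) (axis i 1) \<bullet> snd b + D2v i (fst p) (fst (snd p)) (fst b) \<bullet> snd (snd p))))"
    by (intro continuous_intros continuous_on_Vx continuous_on_D2v) auto
  then show "continuous_on ({0..} \<times> (\<Omega> \<times> UNIV)) (\<lambda>p. (case p of (t, z) \<Rightarrow> costate_deriv t z) b)"
    by (rule continuous_on_eq) (auto simp: costate_deriv(2))
qed

definition costate :: "real \<Rightarrow> real^3 \<Rightarrow> real^3 \<Rightarrow> real^3" where
  "costate t \<xi> q = (SOME p. p 0 = q \<and>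
    (\<forall>t\<ge>0. (p has_vector_derivative - Vadj t (X t \<xi>) (p t)) (at t within {0..}))) t"

lemma costate_exists:
  assumes \<xi>: "\<xi> \<in> \<Omega>"
  shows "\<exists>p. p 0 = q \<and> (\<forall>t\<ge>0. (p has_vector_derivative - Vadj t (X t \<xi>) (p t)) (at t within {0..}))"
proof -
  have "\<exists>B>0. \<forall>t\<in>{0..T}. norm (Vx t (X t \<xi>)) \<le> B" for T
    using xflow.A_bound[OF \<xi>, of T] by metis
  then obtain B where B: "\<And>T. B T > 0 \<and> (\<forall>t\<in>{0..T}. norm (Vx t (X t \<xi>)) \<le> B T)" by metis
  show ?thesis
  \<comment> \<open>The factor 3 comes from bounding the norm by the sum of three components, each
    at most \<open>B T * norm (p - q)\<close>.\<close>
  proof (rule lipschitz_ode_exists_global[where L = "\<lambda>T. 3 * B T" and F = "\<lambda>t q. - Vadj t (X t \<xi>) q"])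
    show "continuous_on {0..} (\<lambda>t. - Vadj t (X t \<xi>) q)" for q
      unfolding Vadj_def
      by (intro continuous_intros continuous_on_vec_lambda xflow.A_cont_along \<xi>)
  next
    fix t T :: real assume t: "0 \<le> t" "t \<le> T"
    have "dist (- Vadj t (X t \<xi>) p) (- Vadj t (X t \<xi>) q) \<le> 3 * B T * dist p q" for p q
    proof -
      have comp: "\<bar>(Vadj t (X t \<xi>) p - Vadj t (X t \<xi>) q) $ i\<bar> \<le> B T * norm (p - q)" for i
      proof -
        have "\<bar>(Vadj t (X t \<xi>) p - Vadj t (X t \<xi>) q) $ i\<bar> = \<bar>Vx t (X t \<xi>) (axis i 1) \<bullet> (p - q)\<bar>"
          by (simp add: Vadj_def inner_diff_right)
        also have "\<dots> \<le> norm (Vx t (X t \<xi>) (axis i 1)) * norm (p - q)" by (rule Cauchy_Schwarz_ineq2)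
        also have "\<dots> \<le> B T * norm (p - q)"
        proof (rule mult_right_mono)
          have "norm (Vx t (X t \<xi>) (axis i 1)) \<le> norm (Vx t (X t \<xi>))"
            using norm_blinfun[of "Vx t (X t \<xi>)" "axis i 1"] by (simp add: norm_axis_1)
          then show "norm (Vx t (X t \<xi>) (axis i 1)) \<le> B T" using B[of T] t by force
        qed simp
        finally show ?thesis .
      qed
      have "norm (Vadj t (X t \<xi>) p - Vadj t (X t \<xi>) q) \<le> of_nat (card (UNIV :: 3 set)) * (B T * norm (p - q))"
        by (rule order_trans[OF norm_le_l1_cart sum_bounded_above[OF comp]])
      then show ?thesis by (simp add: dist_norm norm_minus_commute)
    qed
    then show "(3 * B T)-lipschitz_on UNIV (\<lambda>q. - Vadj t (X t \<xi>) q)"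
      using B[of T] by (intro lipschitz_onI) auto
  qed
qed

lemma costate_init: "\<xi> \<in> \<Omega> \<Longrightarrow> costate 0 \<xi> q = q"
  and costate_vderiv: "\<xi> \<in> \<Omega> \<Longrightarrow> 0 \<le> t \<Longrightarrow>
    ((\<lambda>t. costate t \<xi> q) has_vector_derivative - Vadj t (X t \<xi>) (costate t \<xi> q)) (at t within {0..})"
  using someI_ex[OF costate_exists, of \<xi> q] unfolding costate_def by auto

text \<open>The coupled field need not be globally Lipschitz, so its flow is assembled in two
  stages: the trajectory first, then a linear equation along it. \<open>C1_flow\<close> turns this
  into joint differentiability in time, initial point and initial covector.\<close>

sublocale costate_flow: C1_flow "\<lambda>t z. (v (t, fst z), - Vadj t (fst z) (snd z))" costate_deriv
  "\<lambda>t z. (X t (fst z), costate t (fst z) (snd z))" "\<Omega> \<times> UNIV" "\<Omega> \<times> UNIV"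
proof unfold_locales
  show "open (\<Omega> \<times> (UNIV :: (real^3) set))" by (intro open_Times open_\<Omega> open_UNIV)
qed (auto intro!: costate_deriv(1) costate_deriv_cont X_solution costate_init
    has_vector_derivative_Pair costate_vderiv)

text \<open>If \<open>q\<close> is normal to the initial surface, then its costate is normal to the moving surface,
  whose tangent space at \<open>X t \<xi>\<close> is the image of the initial one under \<open>W t \<xi>\<close>.\<close>

lemma costate_pairing:
  assumes \<xi>: "\<xi> \<in> \<Omega>" and t: "0 \<le> t"
  shows "costate t \<xi> q \<bullet> xflow.W t \<xi> \<eta> = q \<bullet> \<eta>"
proof -
  have "((\<lambda>t. costate t \<xi> q \<bullet> xflow.W t \<xi> \<eta>) has_derivative (\<lambda>h. 0)) (at s within {0..})" if s: "s \<in> {0..}" for s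
  proof -
    have 1: "((\<lambda>t. xflow.W t \<xi> \<eta>) has_derivative (\<lambda>h. h *\<^sub>R Vx s (X s \<xi>) (xflow.W s \<xi> \<eta>))) (at s within {0..})"
    proof -
      have "((\<lambda>t. xflow.W t \<xi> \<eta>) has_vector_derivative (Vx s (X s \<xi>) o\<^sub>L xflow.W s \<xi>) \<eta>) (at s within {0..})"
        by (rule bounded_linear.has_vector_derivative[OF blinfun.bounded_linear_left xflow.W_deriv[OF \<xi>]]) (use s in simp)
      then show ?thesis by (simp add: has_vector_derivative_def)
    qed
    have 2: "((\<lambda>t. costate t \<xi> q) has_derivative (\<lambda>h. h *\<^sub>R - Vadj s (X s \<xi>) (costate s \<xi> q))) (at s within {0..})"
      using costate_vderiv[OF \<xi>, of s q] s by (simp add: has_vector_derivative_def)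
    \<comment> \<open>\<open>Vadj\<close> is adjoint to \<open>Vx\<close>, so the two terms of the
      product rule cancel.\<close>
    show ?thesis
      by (rule has_derivative_eq_rhs[OF has_derivative_inner[OF 2 1]])
        (simp add: fun_eq_iff Vadj_inner)
  qed
  then have "\<exists>c. \<forall>s\<in>{0..}. costate s \<xi> q \<bullet> xflow.W s \<xi> \<eta> = c"
    by (intro has_derivative_zero_constant) auto
  then have "costate t \<xi> q \<bullet> xflow.W t \<xi> \<eta> = costate 0 \<xi> q \<bullet> xflow.W 0 \<xi> \<eta>" using t by auto
  then show ?thesis using costate_init xflow.W_init \<xi> by simp
qed

lemma C1_on_costate:
  "C1_on ({0..} \<times> UNIV) ({0..} \<times> (\<Omega> \<times> UNIV)) (\<lambda>(t, z). (X t (fst z), costate t (fst z) (snd z)))"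
proof (rule C1_onI[where f' = "\<lambda>(t, z). \<lambda>(\<tau>, \<eta>). \<tau> *\<^sub>R (v (t, X t (fst z)),
    - Vadj t (X t (fst z)) (costate t (fst z) (snd z))) + costate_flow.W t z \<eta>"])
  show "openin (top_of_set ({0..} \<times> UNIV)) ({0::real..} \<times> (\<Omega> \<times> (UNIV :: (real^3) set)))"
    using open_\<Omega> by (intro openin_Times) (auto intro: open_Times)
  define S where "S = {0::real..} \<times> (\<Omega> \<times> (UNIV :: (real^3) set))"
  have der: "((\<lambda>(t, z). (X t (fst z), costate t (fst z) (snd z))) has_derivative
      (case p of (t, z) \<Rightarrow> \<lambda>(\<tau>, \<eta>). \<tau> *\<^sub>R (v (t, X t (fst z)),
    - Vadj t (X t (fst z)) (costate t (fst z) (snd z))) + costate_flow.W t z \<eta>)) (at p within S)" if "p \<in> S" for p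
    using costate_flow.Z_has_derivative[of "fst p" "snd p"] that by (auto simp: S_def case_prod_unfold)
  then show "\<And>p. p \<in> {0..} \<times> \<Omega> \<times> UNIV \<Longrightarrow> ((\<lambda>(t, z). (X t (fst z), costate t (fst z) (snd z))) has_derivative
      (case p of (t, z) \<Rightarrow> \<lambda>(\<tau>, \<eta>). \<tau> *\<^sub>R (v (t, X t (fst z)),
    - Vadj t (X t (fst z)) (costate t (fst z) (snd z))) + costate_flow.W t z \<eta>)) (at p within {0..} \<times> \<Omega> \<times> UNIV)"
    by (simp add: S_def)
  fix b :: "real \<times> (real^3) \<times> (real^3)"
  have Zc: "continuous_on S (\<lambda>p. (X (fst p) (fst (snd p)), costate (fst p) (fst (snd p)) (snd (snd p))))"
    using has_derivative_continuous_on[OF der] by (simp add: case_prod_unfold)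
  have Xc: "continuous_on S (\<lambda>p. X (fst p) (fst (snd p)))"
    and Pc: "continuous_on S (\<lambda>p. costate (fst p) (fst (snd p)) (snd (snd p)))"
    using continuous_on_fst[OF Zc] continuous_on_snd[OF Zc] by auto
  have 1: "continuous_on S (\<lambda>p. v (fst p, X (fst p) (fst (snd p))))"
    by (rule continuous_on_compose2[OF v_cont])
      (use X_solution(2) closure_subset[of \<Omega>] in \<open>auto simp: S_def subset_eq intro!: continuous_intros Xc[unfolded S_def]\<close>)
  have 2: "continuous_on S (\<lambda>p. Vx (fst p) (X (fst p) (fst (snd p))))"
    by (intro continuous_on_Vx Xc continuous_intros) (use X_solution(2) in \<open>auto simp: S_def\<close>)
  have 3: "continuous_on S (\<lambda>p. costate_flow.W (fst p) (snd p))"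
    using costate_flow.W_cont by (simp add: S_def case_prod_unfold)
  have "continuous_on S (\<lambda>p. fst b *\<^sub>R (v (fst p, X (fst p) (fst (snd p))),
    - (\<chi> i. Vx (fst p) (X (fst p) (fst (snd p))) (axis i 1) \<bullet> costate (fst p) (fst (snd p)) (snd (snd p))))
    + costate_flow.W (fst p) (snd p) (snd b))"
    by (intro continuous_intros continuous_on_vec_lambda 1 2 3 Pc)
  then show "continuous_on ({0..} \<times> \<Omega> \<times> UNIV) (\<lambda>p. (case p of (t, z) \<Rightarrow> \<lambda>(\<tau>, \<eta>). \<tau> *\<^sub>R (v (t, X t (fst z)),
    - Vadj t (X t (fst z)) (costate t (fst z) (snd z))) + costate_flow.W t z \<eta>) b)"
    by (simp add: S_def case_prod_unfold Vadj_def)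
qed

end

section \<open>Eikonal functions and an implicit function theorem\<close>

text \<open>The mean value theorem along \<open>a\<close>, applied to the increment of
  \<open>f\<close> by \<open>b\<close>, turns the second difference into a difference of gradients,
  which the linearization of \<open>n\<close> at \<open>x\<close> replaces by
  \<open>D b\<close>.\<close>

lemma second_difference_bound:
  fixes f :: "'a::real_inner \<Rightarrow> real" and n :: "'a \<Rightarrow> 'a"
  assumes f: "\<And>y. y \<in> ball x r \<Longrightarrow> (f has_derivative (\<lambda>\<eta>. n y \<bullet> \<eta>)) (at y)"
    and D: "linear D" "\<And>y. y \<in> ball x r \<Longrightarrow> norm (n y - n x - D (y - x)) \<le> e * norm (y - x)"
    and small: "norm a + norm b < r" "0 \<le> e"
  shows "\<bar>f (x + a + b) - f (x + a) - f (x + b) + f x - D b \<bullet> a\<bar> \<le> 2 * e * (norm a + norm b) * (norm a + norm b)"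
proof -
  have in1: "x + s *\<^sub>R a \<in> ball x r" "x + s *\<^sub>R a + b \<in> ball x r" if "s \<in> {0..1}" for s
  proof -
    have "norm (s *\<^sub>R a) \<le> norm a" using that by (simp add: mult_left_le_one_le)
    then have "norm (s *\<^sub>R a) < r" "norm (s *\<^sub>R a + b) < r"
      using small norm_triangle_ineq[of "s *\<^sub>R a" b] norm_ge_zero[of b] by linarith+
    moreover have "dist x (x + c) = norm c" for c by (simp add: dist_norm)
    then have "dist x (x + s *\<^sub>R a) = norm (s *\<^sub>R a)" "dist x (x + s *\<^sub>R a + b) = norm (s *\<^sub>R a + b)"
      by (simp_all only: add.assoc)
    ultimately show "x + s *\<^sub>R a \<in> ball x r" "x + s *\<^sub>R a + b \<in> ball x r" by simp_all
  qed
  define g where "g s = f (x + s *\<^sub>R a + b) - f (x + s *\<^sub>R a)" for s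
  have g: "(g has_derivative (\<lambda>h. n (x + s *\<^sub>R a + b) \<bullet> (h *\<^sub>R a) - n (x + s *\<^sub>R a) \<bullet> (h *\<^sub>R a))) (at s within {0..1})"
    if s: "s \<in> {0..1}" for s
    unfolding g_def
  proof (rule has_derivative_diff)
    show "((\<lambda>s. f (x + s *\<^sub>R a + b)) has_derivative (\<lambda>h. n (x + s *\<^sub>R a + b) \<bullet> (h *\<^sub>R a))) (at s within {0..1})"
      by (rule has_derivative_compose[where f = "\<lambda>s. x + s *\<^sub>R a + b" and f' = "\<lambda>h. h *\<^sub>R a"])
        (auto intro!: derivative_eq_intros f[OF in1(2)[OF s]])
    show "((\<lambda>s. f (x + s *\<^sub>R a)) has_derivative (\<lambda>h. n (x + s *\<^sub>R a) \<bullet> (h *\<^sub>R a))) (at s within {0..1})"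
      by (rule has_derivative_compose[where f = "\<lambda>s. x + s *\<^sub>R a" and f' = "\<lambda>h. h *\<^sub>R a"])
        (auto intro!: derivative_eq_intros f[OF in1(1)[OF s]])
  qed
  obtain s where s: "s \<in> {0..1}" "g 1 - g 0 = (n (x + s *\<^sub>R a + b) - n (x + s *\<^sub>R a)) \<bullet> a"
    using mvt_very_simple[of 0 1 g, OF _ g] by (auto simp: inner_diff_left)
  define R1 where "R1 = n (x + s *\<^sub>R a + b) - n x - D (x + s *\<^sub>R a + b - x)"
  define R2 where "R2 = n (x + s *\<^sub>R a) - n x - D (x + s *\<^sub>R a - x)"
  have sa: "norm (s *\<^sub>R a) \<le> norm a" using s by (simp add: mult_left_le_one_le)
  have R1: "norm R1 \<le> e * (norm a + norm b)"
    unfolding R1_def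
    by (rule order_trans[OF D(2)[OF in1(2)[OF s(1)]] mult_left_mono])
      (use sa norm_triangle_ineq[of "s *\<^sub>R a" b] small in \<open>auto simp: algebra_simps\<close>)
  have R2: "norm R2 \<le> e * (norm a + norm b)"
    unfolding R2_def
    by (rule order_trans[OF D(2)[OF in1(1)[OF s(1)]] mult_left_mono])
      (use sa small in \<open>auto intro: add_increasing2\<close>)
  have "D (s *\<^sub>R a + b) = D (s *\<^sub>R a) + D b" by (rule linear_add[OF D(1)])
  then have "n (x + s *\<^sub>R a + b) - n (x + s *\<^sub>R a) = D b + R1 - R2"
    by (simp add: R1_def R2_def add.assoc)
  then have "g 1 - g 0 - D b \<bullet> a = (R1 - R2) \<bullet> a" using s(2) by (simp add: inner_diff_left inner_add_left)
  also have "\<bar>\<dots>\<bar> \<le> norm (R1 - R2) * norm a" by (rule Cauchy_Schwarz_ineq2)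
  also have "\<dots> \<le> (2 * e * (norm a + norm b)) * (norm a + norm b)"
    using R1 R2 norm_triangle_ineq4[of R1 R2] small by (intro mult_mono) auto
  finally show ?thesis by (simp add: g_def algebra_simps)
qed

text \<open>The second difference is symmetric in its two increments, and by
  \<open>second_difference_bound\<close> both pairings approximate it. With increments scaled by
  \<open>h\<close>, the pairings and the error are both of order \<open>h * h\<close>, and the
  factor \<open>e\<close> in the error is arbitrary.\<close>

lemma gradient_derivative_symmetric:
  fixes f :: "'a::real_inner \<Rightarrow> real" and n :: "'a \<Rightarrow> 'a"
  assumes "open U" and x: "x \<in> U"
    and f: "\<And>y. y \<in> U \<Longrightarrow> (f has_derivative (\<lambda>\<eta>. n y \<bullet> \<eta>)) (at y)"
    and n: "(n has_derivative D) (at x)"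
  shows "D b \<bullet> a = D a \<bullet> b"
proof -
  have lin: "linear D" using n has_derivative_linear by blast
  define m where "m = norm a + norm b"
  have "\<bar>D b \<bullet> a - D a \<bullet> b\<bar> \<le> 0 + \<epsilon>" if \<epsilon>: "0 < \<epsilon>" for \<epsilon>
  proof -
    \<comment> \<open>Chosen so that \<open>4 * e * m * m \<le> \<epsilon>\<close>; the summand 1
      covers \<open>m = 0\<close>.\<close>
    define e where "e = \<epsilon> / (4 * m * m + 1)"
    have m: "0 \<le> m" by (simp add: m_def)
    have e: "0 < e" unfolding e_def by (intro divide_pos_pos add_nonneg_pos \<epsilon>) (use m in auto)
    obtain r0 where r0: "r0 > 0" "ball x r0 \<subseteq> U" using assms(1) x openE by blast
    obtain r1 where r1: "r1 > 0" "\<And>y. norm (y - x) < r1 \<Longrightarrow> norm (n y - n x - D (y - x)) \<le> e * norm (y - x)"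
      using n e unfolding has_derivative_at_alt by blast
    define r where "r = min r0 r1"
    have r: "r > 0" using r0 r1 by (simp add: r_def)
    define h where "h = r / (2 * (m + 1))"
    have h: "h > 0" using r m by (simp add: h_def)
    have "h * m < r" using r m by (simp add: h_def field_simps) (smt (verit) mult_nonneg_nonneg)
    then have small: "norm (h *\<^sub>R a) + norm (h *\<^sub>R b) < r" "norm (h *\<^sub>R b) + norm (h *\<^sub>R a) < r"
      using h by (simp_all add: m_def algebra_simps)
    have near: "norm (n y - n x - D (y - x)) \<le> e * norm (y - x)" if "y \<in> ball x r" for y
      using r1(2)[of y] that by (simp add: r_def dist_norm norm_minus_commute)
    have fb: "(f has_derivative (\<lambda>\<eta>. n y \<bullet> \<eta>)) (at y)" if "y \<in> ball x r" for y
      using f[of y] that r0 by (auto simp: r_def)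
    have sc: "norm (h *\<^sub>R a) + norm (h *\<^sub>R b) = h * m" using h by (simp add: m_def algebra_simps)
    have 1: "\<bar>f (x + h *\<^sub>R a + h *\<^sub>R b) - f (x + h *\<^sub>R a) - f (x + h *\<^sub>R b) + f x - D (h *\<^sub>R b) \<bullet> (h *\<^sub>R a)\<bar> \<le> 2 * e * (h * m) * (h * m)"
      using second_difference_bound[OF fb lin near small(1)] e sc by simp
    have 2: "\<bar>f (x + h *\<^sub>R b + h *\<^sub>R a) - f (x + h *\<^sub>R b) - f (x + h *\<^sub>R a) + f x - D (h *\<^sub>R a) \<bullet> (h *\<^sub>R b)\<bar> \<le> 2 * e * (h * m) * (h * m)"
      using second_difference_bound[OF fb lin near small(2)] e sc by (simp add: add.commute[of "\<bar>h\<bar> * norm b"])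
    have "x + h *\<^sub>R b + h *\<^sub>R a = x + h *\<^sub>R a + h *\<^sub>R b" by simp
    with 2 have 2: "\<bar>f (x + h *\<^sub>R a + h *\<^sub>R b) - f (x + h *\<^sub>R a) - f (x + h *\<^sub>R b) + f x - D (h *\<^sub>R a) \<bullet> (h *\<^sub>R b)\<bar> \<le> 2 * e * (h * m) * (h * m)"
      by simp
    have "\<bar>D (h *\<^sub>R b) \<bullet> (h *\<^sub>R a) - D (h *\<^sub>R a) \<bullet> (h *\<^sub>R b)\<bar> \<le> 4 * e * (h * m) * (h * m)" using 1 2 by linarith
    then have "h * h * \<bar>D b \<bullet> a - D a \<bullet> b\<bar> \<le> h * h * (4 * e * m * m)"
      using h by (simp add: linear_scale[OF lin] abs_mult mult_ac flip: right_diff_distrib)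
    then have "\<bar>D b \<bullet> a - D a \<bullet> b\<bar> \<le> 4 * e * m * m"
      using h by (simp add: mult_le_cancel_left_pos)
    also have "\<dots> = \<epsilon> * (4 * m * m / (4 * m * m + 1))" by (simp add: e_def)
    also have "\<dots> \<le> \<epsilon> * 1" using \<epsilon> m by (intro mult_left_mono) (auto simp: divide_le_eq_1 add_nonneg_pos)
    finally show ?thesis by simp
  qed
  then have "\<bar>D b \<bullet> a - D a \<bullet> b\<bar> \<le> 0" by (rule field_le_epsilon)
  then show ?thesis by simp
qed

section \<open>Functions whose gradient has length one\<close>

locale eikonal =
  fixes N :: "'a::euclidean_space set" and f :: "'a \<Rightarrow> real" and n :: "'a \<Rightarrow> 'a" and Dn :: "'a \<Rightarrow> 'a \<Rightarrow>\<^sub>L 'a"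
  assumes open_N: "open N"
    and f_deriv: "\<And>y. y \<in> N \<Longrightarrow> (f has_derivative (\<lambda>\<eta>. n y \<bullet> \<eta>)) (at y)"
    and n_deriv: "\<And>y. y \<in> N \<Longrightarrow> (n has_derivative Dn y) (at y)"
    and Dn_cont: "continuous_on N Dn"
    and norm_n: "\<And>y. y \<in> N \<Longrightarrow> norm (n y) = 1"
begin

lemma n_cont: "continuous_on N n"
  using n_deriv by (meson continuous_at_imp_continuous_on has_derivative_continuous)

text \<open>Differentiating \<open>n y \<bullet> n y = 1\<close> shows that all values of
  \<open>Dn y\<close> are orthogonal to \<open>n y\<close>. For the value at
  \<open>Dn y (n y)\<close>, symmetry of \<open>Dn y\<close> turns this into the vanishing of the
  square of \<open>Dn y (n y)\<close>.\<close>

lemma Dn_normal: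
  assumes y: "y \<in> N"
  shows "Dn y (n y) = 0"
proof -
  have "((\<lambda>y. n y \<bullet> n y) has_derivative (\<lambda>\<eta>. n y \<bullet> Dn y \<eta> + Dn y \<eta> \<bullet> n y)) (at y)"
    by (intro has_derivative_inner n_deriv y)
  moreover have "((\<lambda>y. n y \<bullet> n y) has_derivative (\<lambda>\<eta>. 0)) (at y)"
    by (rule has_derivative_transform_within_open[OF _ open_N y, of "\<lambda>_. 1"])
      (use norm_n in \<open>auto simp: dot_square_norm\<close>)
  ultimately have "(\<lambda>\<eta>. n y \<bullet> Dn y \<eta> + Dn y \<eta> \<bullet> n y) = (\<lambda>\<eta>. 0)" by (rule has_derivative_unique)
  from fun_cong[OF this, of "Dn y (n y)"] have "Dn y (Dn y (n y)) \<bullet> n y = 0" by (simp add: inner_commute)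
  then show ?thesis
    using gradient_derivative_symmetric[OF open_N y f_deriv n_deriv[OF y], of "Dn y (n y)" "n y"] by simp
qed

text \<open>The gradient is constant along its own lines, since it differentiates to zero in its own
  direction.\<close>

lemma normal_line:
  assumes line: "\<And>\<tau>. \<tau> \<in> {0..1} \<Longrightarrow> x + (\<tau> * r) *\<^sub>R n x \<in> N"
  shows "n (x + r *\<^sub>R n x) = n x" "f (x + r *\<^sub>R n x) = f x + r"
proof -
  define y where "y \<tau> = x + (\<tau> * r) *\<^sub>R n x" for \<tau>
  have yN: "y \<tau> \<in> N" if "\<tau> \<in> {0..1}" for \<tau> using line that by (simp add: y_def)
  have y0: "y 0 = x" "y 1 = x + r *\<^sub>R n x" by (simp_all add: y_def)
  have y: "(y has_derivative (\<lambda>h. (h * r) *\<^sub>R n x)) (at \<tau> within {0..1})" for \<tau>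
    unfolding y_def by (auto intro!: derivative_eq_intros)
  have ycont: "continuous_on {0..1} y" unfolding y_def by (intro continuous_intros)
  have "bounded ((\<lambda>\<tau>. Dn (y \<tau>)) ` {0..1})"
    by (intro compact_imp_bounded compact_continuous_image compact_Icc continuous_on_compose2[OF Dn_cont ycont])
      (use yN in auto)
  then obtain B where B: "B > 0" "\<And>\<tau>. \<tau> \<in> {0..1} \<Longrightarrow> norm (Dn (y \<tau>)) \<le> B" by (auto simp: bounded_pos)
  have u: "norm ((\<lambda>\<tau>. n (y \<tau>) - n x) \<tau>) \<le> exp (\<bar>r\<bar> * B * \<tau>) * (norm ((\<lambda>\<tau>. n (y \<tau>) - n x) 0) + 0 * \<tau>)"
    if \<tau>: "\<tau> \<in> {0..1}" for \<tau>
  proof (rule gronwall_norm[OF _ _ _ _ \<tau>])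
    fix \<sigma> :: real assume \<sigma>: "\<sigma> \<in> {0..1}"
    have "((\<lambda>\<tau>. n (y \<tau>)) has_derivative (\<lambda>h. Dn (y \<sigma>) ((h * r) *\<^sub>R n x))) (at \<sigma> within {0..1})"
      by (rule has_derivative_compose[OF y n_deriv[OF yN[OF \<sigma>]]])
    then have "((\<lambda>\<tau>. n (y \<tau>)) has_vector_derivative r *\<^sub>R Dn (y \<sigma>) (n x)) (at \<sigma> within {0..1})"
      by (simp add: has_vector_derivative_def blinfun.scaleR_right)
    then show "((\<lambda>\<tau>. n (y \<tau>) - n x) has_vector_derivative r *\<^sub>R Dn (y \<sigma>) (n x)) (at \<sigma> within {0..1})"
      by (simp add: has_vector_derivative_diff_const)
    \<comment> \<open>\<open>Dn (y \<sigma>)\<close> annihilates \<open>n (y \<sigma>)\<close>, so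
      the derivative is bounded by the deviation \<open>n (y \<sigma>) - n x\<close> itself, which
      starts at 0.\<close>
    have "Dn (y \<sigma>) (n x) = - Dn (y \<sigma>) (n (y \<sigma>) - n x)"
      using Dn_normal[OF yN[OF \<sigma>]] by (simp add: blinfun.diff_right)
    also have "norm \<dots> \<le> B * norm (n (y \<sigma>) - n x)"
      using norm_blinfun[of "Dn (y \<sigma>)"] B(2)[OF \<sigma>]
      by (metis (no_types, lifting) mult_right_mono norm_ge_zero norm_minus_cancel order_trans)
    finally have "norm (Dn (y \<sigma>) (n x)) \<le> B * norm (n (y \<sigma>) - n x)" .
    then show "norm (r *\<^sub>R Dn (y \<sigma>) (n x)) \<le> \<bar>r\<bar> * B * norm (n (y \<sigma>) - n x) + 0"
      by (simp add: mult.assoc mult_left_mono)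
  qed (use B in auto)
  have const: "n (y \<tau>) = n x" if "\<tau> \<in> {0..1}" for \<tau>
    using u[OF that] by (simp add: y0)
  show "n (x + r *\<^sub>R n x) = n x" using const[of 1] by (simp add: y0)
  have "((\<lambda>\<tau>. f (y \<tau>)) has_derivative (\<lambda>h. n (y \<tau>) \<bullet> ((h * r) *\<^sub>R n x))) (at \<tau> within {0..1})" if "\<tau> \<in> {0..1}" for \<tau>
    by (rule has_derivative_compose[OF y f_deriv[OF yN[OF that]]])
  from mvt_very_simple[of 0 1 "\<lambda>\<tau>. f (y \<tau>)", OF _ this] obtain \<tau> where
    "\<tau> \<in> {0..1}" "f (y 1) - f (y 0) = n (y \<tau>) \<bullet> (r *\<^sub>R n x)" by auto
  then show "f (x + r *\<^sub>R n x) = f x + r"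
    using const norm_n[of x] yN[of 0] by (simp add: y0 dot_square_norm)
qed

end

text \<open>Compactness of \<open>[0, T] \<times> K \<times> K\<close>: near a diagonal pair the
  injective derivative gives the bound, near any other pair injectivity of \<open>H t\<close> on
  \<open>K\<close> keeps the values apart. Both conditions are imposed on \<open>K\<close>, while
  the conclusion holds on a neighborhood of \<open>K\<close>; this is what yields charts of uniform
  thickness.\<close>

lemma uniform_lower_bound:
  fixes H :: "real \<Rightarrow> 'a::euclidean_space \<Rightarrow> 'b::euclidean_space" and D :: "real \<Rightarrow> 'a \<Rightarrow> 'a \<Rightarrow>\<^sub>L 'b"
  assumes S: "open S" and K: "compact K" "K \<subseteq> S"
    and H_cont: "continuous_on ({0..} \<times> S) (\<lambda>(t, z). H t z)"
    and H_deriv: "\<And>t z. 0 \<le> t \<Longrightarrow> z \<in> S \<Longrightarrow> (H t has_derivative D t z) (at z)"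
    and D_cont: "continuous_on ({0..} \<times> S) (\<lambda>(t, z). D t z)"
    and inj: "\<And>t z z'. 0 \<le> t \<Longrightarrow> z \<in> K \<Longrightarrow> z' \<in> K \<Longrightarrow> H t z = H t z' \<Longrightarrow> z = z'"
    and ker: "\<And>t z \<eta>. 0 \<le> t \<Longrightarrow> z \<in> K \<Longrightarrow> D t z \<eta> = 0 \<Longrightarrow> \<eta> = 0"
  obtains d c where "d > 0" "c > 0" "\<And>k z. k \<in> K \<Longrightarrow> dist k z < d \<Longrightarrow> z \<in> S"
    "\<And>t k k' z z'. t \<in> {0..T} \<Longrightarrow> k \<in> K \<Longrightarrow> k' \<in> K \<Longrightarrow> dist k z < d \<Longrightarrow> dist k' z' < d \<Longrightarrow>
      c * norm (z - z') \<le> norm (H t z - H t z')"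
proof -
  define P where "P c p = (case p of (t, z, z') \<Rightarrow> z \<in> S \<and> z' \<in> S \<and>
    (0 \<le> t \<longrightarrow> c * norm (z - z') \<le> norm (H t z - H t z')))" for c :: real and p :: "real \<times> 'a \<times> 'a"
  \<comment> \<open>\<open>max T 0\<close> keeps time 0 in the interval for negative
    \<open>T\<close>, where the conclusion \<open>z \<in> S\<close> is still asserted.\<close>
  have local: "\<exists>d>0. \<exists>c>0. \<forall>x. dist k x < d \<longrightarrow> P c x" if k: "k \<in> {0..max T 0} \<times> K \<times> K" for k
  proof -
    obtain t0 z0 z0' where k_eq: "k = (t0, z0, z0')" and t0: "0 \<le> t0" and z0: "z0 \<in> K" "z0' \<in> K"
      using k by auto
    obtain r0 where r0: "r0 > 0" "ball z0 r0 \<subseteq> S" using S z0 K openE by blast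
    obtain r0' where r0': "r0' > 0" "ball z0' r0' \<subseteq> S" using S z0 K openE by blast
    have comp: "dist t0 t < d" "dist z0 z < d" "dist z0' z' < d" if "dist k (t, z, z') < d" for t z z' d
      using that dist_fst_le[of k "(t, z, z')"] dist_snd_le[of k "(t, z, z')"]
        dist_fst_le[of "(z0, z0')" "(z, z')"] dist_snd_le[of "(z0, z0')" "(z, z')"] by (auto simp: k_eq)
    show ?thesis
    proof (cases "z0 = z0'")
      case True
      have "linear (D t0 z0)" by (simp add: blinfun.bounded_linear_right bounded_linear.linear)
      moreover have "inj (D t0 z0)"
        using ker[OF t0 z0(1)] by (simp add: linear_injective_0[OF calculation])
      ultimately obtain B where B: "B > 0" "\<And>\<eta>. B * norm \<eta> \<le> norm (D t0 z0 \<eta>)"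
        using linear_inj_bounded_below_pos by metis
      have "(t0, z0) \<in> {0..} \<times> S" using t0 z0 K by auto
      then obtain d where d: "d > 0" "\<And>t z. 0 \<le> t \<Longrightarrow> z \<in> S \<Longrightarrow> dist (t, z) (t0, z0) < d \<Longrightarrow> dist (D t z) (D t0 z0) < B / 2"
        using D_cont[unfolded continuous_on_iff, rule_format, of "(t0, z0)" "B / 2"] B(1) by auto
      define \<delta> where "\<delta> = min r0 (d / 2)"
      have \<delta>: "\<delta> > 0" "ball z0 \<delta> \<subseteq> S" using d r0 by (auto simp: \<delta>_def)
      have "P (B / 2) (t, z, z')" if near: "dist k (t, z, z') < \<delta>" for t z z'
      proof -
        have zz: "z \<in> ball z0 \<delta>" "z' \<in> ball z0 \<delta>" "dist t0 t < d / 2"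
          using comp[OF near] True by (auto simp: \<delta>_def)
        have "B / 2 * norm (z - z') \<le> norm (H t z - H t z')" if t: "0 \<le> t"
        proof -
          have "norm ((\<lambda>y. H t y - D t0 z0 y) z - (\<lambda>y. H t y - D t0 z0 y) z') \<le> B / 2 * norm (z - z')"
          proof (rule differentiable_bound[of "ball z0 \<delta>" _ "\<lambda>y. blinfun_apply (D t y - D t0 z0)"])
            fix y assume y: "y \<in> ball z0 \<delta>"
            then have yS: "y \<in> S" using \<delta> by auto
            have "((\<lambda>y. H t y - D t0 z0 y) has_derivative (\<lambda>\<eta>. D t y \<eta> - D t0 z0 \<eta>)) (at y)"
              by (intro has_derivative_diff H_deriv t yS bounded_linear_imp_has_derivative blinfun.bounded_linear_right)
            then show "((\<lambda>y. H t y - D t0 z0 y) has_derivative blinfun_apply (D t y - D t0 z0)) (at y within ball z0 \<delta>)"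
              by (simp add: blinfun.diff_left[abs_def] has_derivative_at_withinI)
            have "dist z0 y < d / 2" using y by (auto simp: \<delta>_def)
            then have "dist (t, y) (t0, z0) < d"
              using zz(3) sqrt_sum_squares_half_less[of "dist t t0" d "dist y z0"]
              by (simp add: dist_Pair_Pair dist_commute)
            then show "onorm (blinfun_apply (D t y - D t0 z0)) \<le> B / 2"
              using d(2)[OF t yS] by (simp add: dist_norm flip: norm_blinfun.rep_eq)
          qed (use zz in auto)
          then have "norm (D t0 z0 (z - z')) - norm (H t z - H t z') \<le> B / 2 * norm (z - z')"
            using norm_triangle_ineq2[of "D t0 z0 (z - z')" "H t z - H t z'"]
            by (simp add: blinfun.diff_right norm_minus_commute algebra_simps)
          then show ?thesis using B(2)[of "z - z'"] by (simp add: field_simps)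
        qed
        then show ?thesis using zz \<delta>(2) by (auto simp: P_def)
      qed
      then show ?thesis using \<delta>(1) B(1) by (intro exI[of _ \<delta>] conjI exI[of _ "B / 2"]) auto
    next
      case False
      define \<Delta> where "\<Delta> p = norm (H (fst p) (fst (snd p)) - H (fst p) (snd (snd p)))" for p
      have "continuous_on ({0..} \<times> (S \<times> S)) \<Delta>"
      proof -
        have *: "continuous_on A (\<lambda>p. H (g p) (h p))" if "continuous_on A g" "continuous_on A h"
          "\<And>p. p \<in> A \<Longrightarrow> 0 \<le> g p" "\<And>p. p \<in> A \<Longrightarrow> h p \<in> S" for A :: "(real \<times> 'a \<times> 'a) set" and g h
          using continuous_on_compose2[OF H_cont continuous_on_Pair[OF that(1,2)]] that(3,4) by fastforce
        show ?thesis unfolding \<Delta>_def by (intro continuous_on_norm continuous_on_diff * continuous_intros) auto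
      qed
      moreover have "k \<in> {0..} \<times> (S \<times> S)" using t0 z0 K by (auto simp: k_eq)
      moreover have pos: "0 < \<Delta> k" using inj[OF t0 z0] False by (auto simp: \<Delta>_def k_eq)
      ultimately obtain d where d: "d > 0" "\<And>p. p \<in> {0..} \<times> (S \<times> S) \<Longrightarrow> dist p k < d \<Longrightarrow> dist (\<Delta> p) (\<Delta> k) < \<Delta> k / 2"
        unfolding continuous_on_iff by (metis half_gt_zero)
      define \<delta> where "\<delta> = min d (min 1 (min r0 r0'))"
      \<comment> \<open>Since \<open>\<delta> \<le> 1\<close>, the distance between \<open>z\<close>
        and \<open>z'\<close> is at most \<open>M\<close>.\<close>
      define M where "M = dist z0 z0' + 2"
      have M: "M > 0" by (simp add: M_def add_nonneg_pos)
      have "P (\<Delta> k / (2 * M)) (t, z, z')" if near: "dist k (t, z, z') < \<delta>" for t z z'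
      proof -
        have zz: "dist z0 z < \<delta>" "dist z0' z' < \<delta>" using comp[OF near] by auto
        then have S': "z \<in> S" "z' \<in> S" using r0 r0' by (auto simp: \<delta>_def)
        have "\<Delta> k / (2 * M) * norm (z - z') \<le> norm (H t z - H t z')" if t: "0 \<le> t"
        proof -
          have "\<Delta> k / 2 \<le> \<Delta> (t, z, z')"
          proof -
            have "dist (\<Delta> (t, z, z')) (\<Delta> k) < \<Delta> k / 2"
              using d(2)[of "(t, z, z')"] near t S' by (simp add: \<delta>_def dist_commute)
            then show ?thesis unfolding dist_real_def by linarith
          qed
          moreover have "norm (z - z') \<le> M"
            using zz dist_triangle[of z z' z0] dist_triangle[of z0 z' z0']
            by (simp add: M_def \<delta>_def dist_norm[symmetric] dist_commute)
          then have "\<Delta> k / (2 * M) * norm (z - z') \<le> \<Delta> k / (2 * M) * M"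
            using pos M by (intro mult_left_mono) auto
          ultimately show ?thesis using M by (simp add: \<Delta>_def)
        qed
        then show ?thesis using S' by (simp add: P_def)
      qed
      moreover have "\<delta> > 0" using d r0 r0' by (simp add: \<delta>_def)
      ultimately show ?thesis using pos M by (intro exI[of _ \<delta>] conjI exI[of _ "\<Delta> k / (2 * M)"]) auto
    qed
  qed
  have mono: "P c' x" if "P c x" "0 < c'" "c' \<le> c" for c c' x
  proof -
    obtain t z z' where x: "x = (t, z, z')" by (cases x)
    have "c' * norm (z - z') \<le> c * norm (z - z')" using that(3) by (intro mult_right_mono) auto
    then show ?thesis using that(1) by (auto simp: P_def x)
  qed
  show ?thesis
  proof (rule compact_uniform_nbhd[OF compact_Times[OF compact_Icc[of 0 "max T 0"] compact_Times[OF K(1) K(1)]], of P, OF local mono])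
    fix d c :: real
    assume d: "d > 0" "c > 0" "\<And>k x. k \<in> {0..max T 0} \<times> K \<times> K \<Longrightarrow> dist k x < d \<Longrightarrow> P c x"
    have PP: "P c (t, z, z')" if "t \<in> {0..max T 0}" "k \<in> K" "k' \<in> K" "dist k z < d / 2" "dist k' z' < d / 2" for t k k' z z'
      using d(3)[of "(t, k, k')" "(t, z, z')"] that sqrt_sum_squares_half_less[of "dist k z" d "dist k' z'"]
      by (simp add: dist_Pair_Pair)
    show ?thesis
    proof (rule that[of "d / 2" c])
      show "z \<in> S" if "k \<in> K" "dist k z < d / 2" for k z
        using PP[of 0 k k z z] that by (simp add: P_def)
      show "c * norm (z - z') \<le> norm (H t z - H t z')"
        if "t \<in> {0..T}" "k \<in> K" "k' \<in> K" "dist k z < d / 2" "dist k' z' < d / 2" for t k k' z z'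
        using PP[of t k k' z z'] that by (auto simp: P_def)
    qed (use d in auto)
  qed
qed

text \<open>The identity \<open>D q (M q - M p) = (D p - D q) M p\<close> controls the difference,
  because \<open>D q\<close> stretches every vector by at least \<open>1 / (2 * m)\<close> once it
  is close to \<open>D p\<close>.\<close>

lemma continuous_on_blinfun_inverse:
  fixes D M :: "'x::metric_space \<Rightarrow> 'a::euclidean_space \<Rightarrow>\<^sub>L 'a"
  assumes D: "continuous_on S D"
    and MD: "\<And>p h. p \<in> S \<Longrightarrow> M p (D p h) = h" and DM: "\<And>p h. p \<in> S \<Longrightarrow> D p (M p h) = h"
  shows "continuous_on S M"
  unfolding continuous_on_def
proof
  fix p assume p: "p \<in> S"
  define m where "m = norm (M p) + 1"
  have m: "m > 0" by (simp add: m_def add_nonneg_pos)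
  have lim: "((\<lambda>q. norm (D q - D p)) \<longlongrightarrow> 0) (at p within S)"
    using D p by (auto simp: continuous_on_def intro!: tendsto_eq_intros)
  have ev: "eventually (\<lambda>q. norm (D q - D p) < 1 / (2 * m)) (at p within S)"
    by (rule order_tendstoD(2)[OF lim]) (use m in simp)
  have bound: "norm (M q - M p) \<le> 2 * m * m * norm (D q - D p)" if q: "q \<in> S" and close: "norm (D q - D p) < 1 / (2 * m)" for q
  proof -
    have expand: "norm h \<le> 2 * m * norm (D q h)" for h
    proof -
      have "norm h \<le> m * norm (D p h)"
      proof -
        have "norm h = norm (M p (D p h))" using MD[OF p] by simp
        also have "\<dots> \<le> norm (M p) * norm (D p h)" by (rule norm_blinfun)
        also have "\<dots> \<le> m * norm (D p h)" by (intro mult_right_mono) (auto simp: m_def)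
        finally show ?thesis .
      qed
      also have "norm (D p h) \<le> norm (D q h) + norm (D q - D p) * norm h"
        using norm_triangle_sub[of "D p h" "D q h"] norm_blinfun[of "D q - D p" h]
        by (simp add: blinfun.diff_left norm_minus_commute)
      also have "\<dots> \<le> norm (D q h) + 1 / (2 * m) * norm h"
        using close by (intro add_left_mono mult_right_mono) auto
      finally show ?thesis using m by (simp add: field_simps)
    qed
    have "norm ((M q - M p) h) \<le> 2 * m * m * norm (D q - D p) * norm h" for h
    proof -
      have "D q ((M q - M p) h) = (D p - D q) (M p h)"
        using DM[OF p] DM[OF q] by (simp add: blinfun.diff_left blinfun.diff_right)
      then have "norm ((M q - M p) h) \<le> 2 * m * norm ((D p - D q) (M p h))" using expand by metis
      also have "\<dots> \<le> 2 * m * (norm (D q - D p) * (m * norm h))"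
      proof (intro mult_left_mono)
        have "norm (M p h) \<le> m * norm h"
          using norm_blinfun[of "M p" h] mult_right_mono[of "norm (M p)" m "norm h"] by (simp add: m_def)
        then have "norm (D q - D p) * norm (M p h) \<le> norm (D q - D p) * (m * norm h)"
          by (intro mult_left_mono) auto
        then show "norm ((D p - D q) (M p h)) \<le> norm (D q - D p) * (m * norm h)"
          using norm_blinfun[of "D p - D q" "M p h"] by (simp add: norm_minus_commute)
      qed (use m in simp)
      finally show ?thesis by (simp add: mult_ac)
    qed
    then show ?thesis using m by (intro norm_blinfun_bound) auto
  qed
  have "((\<lambda>q. M q - M p) \<longlongrightarrow> 0) (at p within S)"
  proof (rule Lim_null_comparison)
    show "eventually (\<lambda>q. norm (M q - M p) \<le> 2 * m * m * norm (D q - D p)) (at p within S)"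
      using ev by (auto simp: eventually_at_filter bound elim!: eventually_mono)
    show "((\<lambda>q. 2 * m * m * norm (D q - D p)) \<longlongrightarrow> 0) (at p within S)"
      using tendsto_mult_right_zero[OF lim] by simp
  qed
  then show "(M \<longlongrightarrow> M p) (at p within S)" by (simp add: LIM_zero_iff)
qed

text \<open>The lower bound on the increments of \<open>H\<close> takes the place of the continuity of \<open>g\<close>.\<close>

lemma implicit_function_C1:
  fixes H :: "real \<times> 'a::euclidean_space \<Rightarrow> 'a" and g :: "real \<times> 'c::euclidean_space \<Rightarrow> 'a"
  assumes \<Theta>: "openin (top_of_set ({0..} \<times> UNIV)) \<Theta>"
    and H_deriv: "\<And>p. p \<in> {0..} \<times> S \<Longrightarrow> (H has_derivative blinfun_apply (H' p)) (at p within {0..} \<times> S)"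
    and H'_cont: "continuous_on ({0..} \<times> S) H'"
    and J: "bounded_linear J" and gS: "\<And>p. p \<in> \<Theta> \<Longrightarrow> g p \<in> S"
    and sol: "\<And>p. p \<in> \<Theta> \<Longrightarrow> H (fst p, g p) = J (snd p)"
    and ker: "\<And>p \<eta>. p \<in> \<Theta> \<Longrightarrow> H' (fst p, g p) (0, \<eta>) = 0 \<Longrightarrow> \<eta> = 0"
    and lower: "\<And>p. p \<in> \<Theta> \<Longrightarrow> \<exists>d>0. \<exists>c>0. \<forall>q\<in>\<Theta>. dist q p < d \<longrightarrow>
      c * norm (g q - g p) \<le> norm (H (fst q, g q) - H (fst q, g p))"
  shows "C1_on ({0..} \<times> UNIV) \<Theta> g"
proof -
  interpret J: bounded_linear J by (rule J)
  have \<Theta>_sub: "0 \<le> fst p" if "p \<in> \<Theta>" for p using openin_imp_subset[OF \<Theta>] that by auto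
  then have pS: "(fst p, g p) \<in> {0..} \<times> S" if "p \<in> \<Theta>" for p using gS that by auto
  define E where "E = Blinfun (\<lambda>\<eta>::'a. (0::real, \<eta>))"
  have E: "blinfun_apply E = (\<lambda>\<eta>. (0, \<eta>))"
    unfolding E_def by (intro bounded_linear_Blinfun_apply bounded_linear_Pair bounded_linear_zero bounded_linear_ident)
  define D where "D p = H' (fst p, g p) o\<^sub>L E" for p
  have D: "D p \<eta> = H' (fst p, g p) (0, \<eta>)" for p \<eta> by (simp add: D_def E)
  define M where "M p = Blinfun (inv (D p))" for p
  have linD: "linear (D p)" for p by (simp add: blinfun.bounded_linear_right bounded_linear.linear)
  have injD: "inj (D p)" if "p \<in> \<Theta>" for p
    using ker[OF that] by (simp add: linear_injective_0[OF linD] D)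
  have M: "blinfun_apply (M p) = inv (D p)" "surj (D p)" if "p \<in> \<Theta>" for p
  proof -
    show "blinfun_apply (M p) = inv (D p)"
      unfolding M_def
      by (intro bounded_linear_Blinfun_apply inj_linear_imp_inv_bounded_linear injD that blinfun.bounded_linear_right)
    show "surj (D p)" using linear_injective_imp_surjective[OF linD injD[OF that]] by simp
  qed
  have MD: "M p (D p h) = h" if "p \<in> \<Theta>" for p h using M(1)[OF that] injD[OF that] by simp
  have DM: "D p (M p h) = h" if "p \<in> \<Theta>" for p h using M[OF that] by (simp add: surj_f_inv_f)
  \<comment> \<open>\<open>lower\<close> compares two states at the same time \<open>fst q\<close>.
    The change of \<open>H\<close> from \<open>(fst q, g p)\<close> to \<open>(fst p, g p)\<close>
    is estimated by differentiability at the latter point, the remaining difference by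
    \<open>sol\<close>.\<close>
  have lip: "\<exists>d>0. \<exists>C>0. \<forall>q\<in>\<Theta>. dist q p < d \<longrightarrow> norm (g q - g p) \<le> C * norm (q - p)" if p: "p \<in> \<Theta>" for p
  proof -
    obtain d1 c where d1: "d1 > 0" "c > 0" "\<And>q. q \<in> \<Theta> \<Longrightarrow> dist q p < d1 \<Longrightarrow>
        c * norm (g q - g p) \<le> norm (H (fst q, g q) - H (fst q, g p))"
      using lower[OF p] by blast
    obtain d2 where d2: "d2 > 0" "\<And>q. q \<in> {0..} \<times> S \<Longrightarrow> norm (q - (fst p, g p)) < d2 \<Longrightarrow>
        norm (H q - H (fst p, g p) - H' (fst p, g p) (q - (fst p, g p))) \<le> 1 * norm (q - (fst p, g p))"
      using H_deriv[OF pS[OF p]] unfolding has_derivative_within_alt by (metis zero_less_one)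
    obtain B where B: "B > 0" "\<And>x. norm (J x) \<le> B * norm x" using J.pos_bounded by (metis mult.commute)
    define C where "C = (B + norm (H' (fst p, g p)) + 1) / c"
    have C: "C > 0" using B d1 by (simp add: C_def add_pos_nonneg)
    have "norm (g q - g p) \<le> C * norm (q - p)" if q: "q \<in> \<Theta>" "dist q p < min d1 d2" for q
    proof -
      let ?s = "(fst q, g p)"
      have diff: "?s - (fst p, g p) = (fst q - fst p, 0)" by simp
      have qp: "norm (fst q - fst p) \<le> norm (q - p)" "norm (snd q - snd p) \<le> norm (q - p)"
        using dist_fst_le[of q p] dist_snd_le[of q p] by (auto simp: dist_norm)
      have "norm (H ?s - H (fst p, g p) - H' (fst p, g p) (fst q - fst p, 0)) \<le> norm (fst q - fst p, 0::'a)"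
        using d2(2)[of ?s] q \<Theta>_sub[OF q(1)] gS[OF p] qp by (simp add: diff dist_norm norm_Pair)
      then have "norm (H ?s - H (fst p, g p)) \<le> norm (fst q - fst p) + norm (H' (fst p, g p) (fst q - fst p, 0))"
        using norm_triangle_sub[of "H ?s - H (fst p, g p)" "H' (fst p, g p) (fst q - fst p, 0)"] by (simp add: norm_Pair)
      also have "norm (H' (fst p, g p) (fst q - fst p, 0)) \<le> norm (H' (fst p, g p)) * norm (q - p)"
        by (rule order_trans[OF norm_blinfun mult_left_mono]) (use qp in \<open>auto simp: norm_Pair\<close>)
      finally have 1: "norm (H ?s - H (fst p, g p)) \<le> (norm (H' (fst p, g p)) + 1) * norm (q - p)"
        using qp by (simp add: algebra_simps)
      have "norm (J (snd q) - J (snd p)) \<le> B * norm (snd q - snd p)" using B(2) by (simp flip: J.diff)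
      also have "\<dots> \<le> B * norm (q - p)" using B(1) qp by (intro mult_left_mono) auto
      finally have 2: "norm (H (fst q, g q) - H (fst p, g p)) \<le> B * norm (q - p)"
        using sol[OF q(1)] sol[OF p] by simp
      have "c * norm (g q - g p) \<le> norm (H (fst q, g q) - H ?s)" using d1(3)[OF q(1)] q(2) by simp
      also have "\<dots> \<le> norm (H (fst q, g q) - H (fst p, g p)) + norm (H ?s - H (fst p, g p))"
        using norm_triangle_ineq4[of "H (fst q, g q) - H (fst p, g p)" "H ?s - H (fst p, g p)"] by simp
      also have "\<dots> \<le> (B + norm (H' (fst p, g p)) + 1) * norm (q - p)" using 1 2 by (simp add: algebra_simps)
      finally show ?thesis using d1(2) by (simp add: C_def field_simps)
    qed
    then show ?thesis using C d1(1) d2(1) by (intro exI[of _ "min d1 d2"] conjI exI[of _ C]) auto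
  qed
  have gcont: "continuous_on \<Theta> g"
    unfolding continuous_on_iff
  proof (intro ballI allI impI)
    fix p and e :: real assume p: "p \<in> \<Theta>" and e: "0 < e"
    obtain d C where d: "d > 0" "C > 0" "\<And>q. q \<in> \<Theta> \<Longrightarrow> dist q p < d \<Longrightarrow> norm (g q - g p) \<le> C * norm (q - p)"
      using lip[OF p] by blast
    have "dist (g q) (g p) < e" if "q \<in> \<Theta>" "dist q p < min d (e / C)" for q
    proof -
      have "norm (g q - g p) \<le> C * norm (q - p)" using d(3) that by simp
      also have "\<dots> < e" using that d(2) by (simp add: dist_norm field_simps)
      finally show ?thesis by (simp add: dist_norm)
    qed
    then show "\<exists>d>0. \<forall>q\<in>\<Theta>. dist q p < d \<longrightarrow> dist (g q) (g p) < e"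
      using d e by (intro exI[of _ "min d (e / C)"]) auto
  qed
  \<comment> \<open>Obtained by differentiating \<open>H (fst p, g p) = J (snd p)\<close> and
    solving for the derivative of \<open>g\<close>.\<close>
  define g' where "g' p h = M p (J (snd h) - H' (fst p, g p) (fst h, 0))" for p and h :: "real \<times> 'c"
  have "(g has_derivative g' p) (at p within \<Theta>)" if p: "p \<in> \<Theta>" for p
    unfolding has_derivative_within_alt
  proof (intro conjI allI impI)
    show "bounded_linear (g' p)"
      unfolding g'_def
      by (intro blinfun.bounded_linear_right[THEN bounded_linear_compose] bounded_linear_sub
          J[THEN bounded_linear_compose] bounded_linear_Pair bounded_linear_fst bounded_linear_snd bounded_linear_zero)
    fix e :: real assume e: "0 < e"
    obtain d C where d: "d > 0" "C > 0" "\<And>q. q \<in> \<Theta> \<Longrightarrow> dist q p < d \<Longrightarrow> norm (g q - g p) \<le> C * norm (q - p)"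
      using lip[OF p] by blast
    define m where "m = (norm (M p) + 1) * (1 + C)"
    have m: "m > 0" using d by (simp add: m_def add_nonneg_pos)
    obtain d2 where d2: "d2 > 0" "\<And>q. q \<in> {0..} \<times> S \<Longrightarrow> norm (q - (fst p, g p)) < d2 \<Longrightarrow>
        norm (H q - H (fst p, g p) - H' (fst p, g p) (q - (fst p, g p))) \<le> e / m * norm (q - (fst p, g p))"
      using H_deriv[OF pS[OF p]] e m unfolding has_derivative_within_alt by (metis divide_pos_pos)
    have "norm (g q - g p - g' p (q - p)) \<le> e * norm (q - p)" if q: "q \<in> \<Theta>" "norm (q - p) < min d (d2 / (1 + C))" for q
    proof -
      have gq: "norm (g q - g p) \<le> C * norm (q - p)" using d(3)[OF q(1)] q(2) by (simp add: dist_norm)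
      have inc: "norm ((fst q, g q) - (fst p, g p)) \<le> (1 + C) * norm (q - p)"
        using norm_Pair_le[of "fst q - fst p" "g q - g p"] gq dist_fst_le[of q p]
        by (simp add: algebra_simps dist_norm)
      also have "\<dots> < d2" using q(2) d(2) by (simp add: field_simps)
      finally have close: "norm ((fst q, g q) - (fst p, g p)) < d2" .
      have "J (snd q - snd p) - H' (fst p, g p) ((fst q, g q) - (fst p, g p)) =
          H (fst q, g q) - H (fst p, g p) - H' (fst p, g p) ((fst q, g q) - (fst p, g p))"
        using sol[OF p] sol[OF q(1)] by (simp add: J.diff)
      also have "norm \<dots> \<le> e / m * norm ((fst q, g q) - (fst p, g p))"
        by (rule d2(2)[OF pS[OF q(1)] close])
      also have "\<dots> \<le> e / m * ((1 + C) * norm (q - p))" using e m inc by (intro mult_left_mono) auto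
      finally have R: "norm (J (snd q - snd p) - H' (fst p, g p) ((fst q, g q) - (fst p, g p))) \<le> e / m * ((1 + C) * norm (q - p))" .
      have "(fst q, g q) - (fst p, g p) = (fst q - fst p, 0) + (0, g q - g p)" by simp
      then have "H' (fst p, g p) ((fst q, g q) - (fst p, g p)) = H' (fst p, g p) (fst q - fst p, 0) + D p (g q - g p)"
        by (simp only: blinfun.add_right D)
      then have "g q - g p - g' p (q - p) = - M p (J (snd q - snd p) - H' (fst p, g p) ((fst q, g q) - (fst p, g p)))"
        using MD[OF p] by (simp add: g'_def fst_diff snd_diff blinfun.diff_right blinfun.add_right)
      then have "norm (g q - g p - g' p (q - p)) \<le> norm (M p) * (e / m * ((1 + C) * norm (q - p)))"
        using R norm_blinfun[of "M p" "J (snd q - snd p) - H' (fst p, g p) ((fst q, g q) - (fst p, g p))"]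
        by (simp only: norm_minus_cancel) (meson mult_left_mono norm_ge_zero order_trans)
      also have "\<dots> \<le> (norm (M p) + 1) * (e / m * ((1 + C) * norm (q - p)))"
        using e m d by (intro mult_right_mono) auto
      also have "\<dots> = e * (m / m) * norm (q - p)"
      proof -
        have "a * (e / m * (b * c)) = e * (a * b / m) * c" for a b c :: real by simp
        then show ?thesis by (simp only: m_def)
      qed
      also have "\<dots> = e * norm (q - p)" using m by simp
      finally show ?thesis .
    qed
    then show "\<exists>d>0. \<forall>q\<in>\<Theta>. norm (q - p) < d \<longrightarrow> norm (g q - g p - g' p (q - p)) \<le> e * norm (q - p)"
      using d d2 by (intro exI[of _ "min d (d2 / (1 + C))"]) auto
  qed
  moreover have "continuous_on \<Theta> (\<lambda>p. g' p b)" for b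
  proof -
    have H'g: "continuous_on \<Theta> (\<lambda>p. H' (fst p, g p))"
      by (rule continuous_on_compose2[OF H'_cont]) (use pS gcont in \<open>auto intro!: continuous_intros\<close>)
    have "continuous_on \<Theta> D"
      unfolding D_def by (rule bounded_bilinear.continuous_on[OF bounded_bilinear_blinfun_compose H'g continuous_on_const])
    then have "continuous_on \<Theta> M" by (rule continuous_on_blinfun_inverse) (use MD DM in auto)
    then show ?thesis
      unfolding g'_def by (intro blinfun.continuous_on continuous_on_diff continuous_on_const H'g)
  qed
  ultimately show ?thesis by (intro C1_onI[OF \<Theta>, of g g']) auto
qed

section \<open>The moving interface\<close>

text \<open>The inequality, tested on \<open>z + h *\<^sub>R \<eta>\<close> with small
  \<open>h\<close>, passes to the derivative. This makes the spatial derivative of \<open>H\<close>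
  injective at chart points with \<open>r \<noteq> 0\<close>.\<close>

lemma has_derivative_lower_bound:
  assumes f: "(f has_derivative f') (at z)" and "0 < r"
    and lower: "\<And>z'. dist z z' < r \<Longrightarrow> c * norm (z' - z) \<le> norm (f z' - f z)"
  shows "c * norm \<eta> \<le> norm (f' \<eta>)"
proof (cases "\<eta> = 0")
  case True
  then show ?thesis by simp
next
  case False
  have lin: "linear f'" using f has_derivative_linear by blast
  have "c * norm \<eta> \<le> norm (f' \<eta>) + e" if "0 < e" for e
  proof -
    define e' where "e' = e / norm \<eta>"
    have e': "0 < e'" using that False by (simp add: e'_def)
    obtain d where d: "d > 0" "\<And>y. norm (y - z) < d \<Longrightarrow> norm (f y - f z - f' (y - z)) \<le> e' * norm (y - z)"
      using f e' unfolding has_derivative_at_alt by blast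
    define h where "h = min d r / (2 * norm \<eta>)"
    have h: "0 < h" "h * norm \<eta> < d" "h * norm \<eta> < r"
      using d \<open>0 < r\<close> False by (auto simp: h_def min_def)
    have "c * norm (h *\<^sub>R \<eta>) \<le> norm (f (z + h *\<^sub>R \<eta>) - f z)"
      using lower[of "z + h *\<^sub>R \<eta>"] h by (simp add: dist_norm)
    also have "\<dots> \<le> norm (f' (h *\<^sub>R \<eta>)) + norm (f (z + h *\<^sub>R \<eta>) - f z - f' (h *\<^sub>R \<eta>))"
      by (rule norm_triangle_sub)
    also have "\<dots> \<le> norm (f' (h *\<^sub>R \<eta>)) + e' * norm (h *\<^sub>R \<eta>)"
      using d(2)[of "z + h *\<^sub>R \<eta>"] h by simp
    finally have "h * (c * norm \<eta>) \<le> h * (norm (f' \<eta>) + e' * norm \<eta>)"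
      using h by (simp add: linear_scale[OF lin] algebra_simps)
    then have "c * norm \<eta> \<le> norm (f' \<eta>) + e' * norm \<eta>" using h(1) by simp
    then show ?thesis using False by (simp add: e'_def)
  qed
  then show ?thesis by (rule field_le_epsilon)
qed

lemma openin_halfspace: "open A \<Longrightarrow> openin (top_of_set ({0::real..} \<times> UNIV)) ({0..} \<times> A)"
  by (intro openin_Times) auto

lemma slice_has_derivative:
  fixes f :: "real \<times> 'a::euclidean_space \<Rightarrow> 'b::real_normed_vector"
  assumes "(f has_derivative f') (at (t, z) within {0..} \<times> S)" "0 \<le> t" "z \<in> S" "open S"
  shows "((\<lambda>z. f (t, z)) has_derivative (\<lambda>\<zeta>. f' (0, \<zeta>))) (at z)"
proof -
  have "((\<lambda>z. f (t, z)) has_derivative (\<lambda>\<zeta>. f' (0, \<zeta>))) (at z within S)"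
  proof (rule has_derivative_in_compose[where g = f and f = "\<lambda>z. (t, z)"])
    show "((\<lambda>z. (t, z)) has_derivative (\<lambda>\<zeta>. (0, \<zeta>))) (at z within S)"
      by (auto intro!: derivative_eq_intros)
    show "(f has_derivative f') (at (t, z) within (\<lambda>z. (t, z)) ` S)"
      by (rule has_derivative_subset[OF assms(1)]) (use assms in auto)
  qed
  then show ?thesis using at_within_open[OF assms(3,4)] by simp
qed

context velocity_field
begin

abbreviation W where "W \<equiv> xflow.W"

text \<open>If \<open>W t \<xi> \<eta> = 0\<close>, pairing with the costate that starts from \<eta>
  itself gives \<open>\<eta> \<bullet> \<eta> = 0\<close>; so \<open>W t \<xi>\<close> is injective,
  hence onto.\<close>

lemma W_surj:
  assumes "0 \<le> t" "\<xi> \<in> \<Omega>"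
  obtains \<eta> where "W t \<xi> \<eta> = z"
proof -
  have lin: "linear (W t \<xi>)" by (simp add: blinfun.bounded_linear_right bounded_linear.linear)
  have "\<eta> = 0" if "W t \<xi> \<eta> = 0" for \<eta>
    using costate_pairing[OF assms(2,1), of \<eta> \<eta>] that by simp
  then have "inj (W t \<xi>)" by (simp add: linear_injective_0[OF lin])
  then have "surj (W t \<xi>)" using linear_injective_imp_surjective[OF lin] by simp
  then show ?thesis using that by (metis surjD)
qed

lemma C1_on_v: "C1_on spacetime ({0..} \<times> \<Omega>) v"
  unfolding C1_on_def
proof (intro conjI exI[of _ v'] ballI)
  show "openin (top_of_set spacetime) ({0..} \<times> \<Omega>)"
    using open_\<Omega> by (intro openin_Times) auto
qed (use v_deriv v'_cont in auto)

end

section \<open>Normals, the chart map and nearest points\<close>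

locale moving_interface = velocity_field \<Omega> v L v' D2v + eikonal N \<phi>0 n Dn
  for \<Omega> v L v' D2v N \<phi>0 n Dn +
  fixes \<Sigma>0 :: "(real^3) set"
  assumes N_sub: "N \<subseteq> \<Omega>" and \<Sigma>0_compact: "compact \<Sigma>0" and \<Sigma>0_sub: "\<Sigma>0 \<subseteq> N"
    and \<Sigma>0_ne: "\<Sigma>0 \<noteq> {}" and zero_set: "\<And>x. x \<in> \<Omega> \<Longrightarrow> \<phi>0 x = 0 \<longleftrightarrow> x \<in> \<Sigma>0"
begin

definition p :: "real \<Rightarrow> real^3 \<Rightarrow> real^3" where "p t y = costate t y (n y)"

definition \<nu> :: "real \<Rightarrow> real^3 \<Rightarrow> real^3" where "\<nu> t y = sgn (p t y)"

text \<open>Parametrization \<open>(y, r) \<mapsto> X t y + r \<nu> t y\<close> of a neighborhood of the interface by a point \<open>y\<close> of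
  \<open>\<Sigma>0\<close> and a signed distance \<open>r\<close>. The last component turns the constraint \<open>y \<in> \<Sigma>0\<close> into an
  equation, so that \<open>y\<close> ranges over an open set.\<close>

definition H :: "real \<times> (real^3) \<times> real \<Rightarrow> (real^3) \<times> real" where
  "H q = (X (fst q) (fst (snd q)) + snd (snd q) *\<^sub>R \<nu> (fst q) (fst (snd q)), \<phi>0 (fst (snd q)))"

lemma p_pairing: "0 \<le> t \<Longrightarrow> y \<in> N \<Longrightarrow> p t y \<bullet> W t y \<eta> = n y \<bullet> \<eta>"
  unfolding p_def using costate_pairing N_sub by blast

lemma p_nonzero: "0 \<le> t \<Longrightarrow> y \<in> N \<Longrightarrow> p t y \<noteq> 0"
  using p_pairing[of t y "n y"] norm_n[of y] by (auto simp: dot_square_norm)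

lemma norm_\<nu>: "0 \<le> t \<Longrightarrow> y \<in> N \<Longrightarrow> norm (\<nu> t y) = 1"
  using p_nonzero by (simp add: \<nu>_def norm_sgn)

lemma \<nu>_scaled: "norm (p t y) *\<^sub>R \<nu> t y = p t y"
  by (cases "p t y = 0") (simp_all add: \<nu>_def sgn_div_norm)

lemma p_inner_\<nu>: "p t y \<bullet> \<nu> t y = norm (p t y)"
  by (cases "p t y = 0") (simp_all add: \<nu>_def sgn_div_norm dot_square_norm power2_eq_square)

lemma \<nu>_tangent: "0 \<le> t \<Longrightarrow> y \<in> N \<Longrightarrow> n y \<bullet> \<eta> = 0 \<Longrightarrow> \<nu> t y \<bullet> W t y \<eta> = 0"
  using p_pairing[of t y \<eta>] by (simp add: \<nu>_def sgn_div_norm)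

lemma C1_on_n: "C1_on UNIV N n"
  unfolding C1_on_def
proof (intro conjI exI[of _ Dn] ballI)
  show "(n has_derivative blinfun_apply (Dn y)) (at y within N)" if "y \<in> N" for y
    by (rule has_derivative_at_withinI[OF n_deriv[OF that]])
qed (use open_N Dn_cont in simp_all)

lemma C1_on_\<phi>0: "C1_on UNIV N \<phi>0"
proof (rule C1_onI[where f' = "\<lambda>y \<eta>. n y \<bullet> \<eta>"])
  show "(\<phi>0 has_derivative (\<lambda>\<eta>. n y \<bullet> \<eta>)) (at y within N)" if "y \<in> N" for y
    by (rule has_derivative_at_withinI[OF f_deriv[OF that]])
qed (use open_N in \<open>auto intro!: continuous_intros n_cont\<close>)

lemma C1_on_X_costate:
  "C1_on spacetime ({0..} \<times> N) (\<lambda>q. (X (fst q) (snd q), p (fst q) (snd q)))"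
proof -
  have s: "C1_on spacetime ({0..} \<times> N) snd" "C1_on spacetime ({0..} \<times> N) fst"
    by (intro C1_on_bounded_linear openin_halfspace open_N bounded_linear_snd bounded_linear_fst)+
  have "C1_on spacetime ({0..} \<times> N) (\<lambda>q. n (snd q))"
    by (rule C1_on_compose[OF s(1) C1_on_n]) auto
  then have "C1_on spacetime ({0..} \<times> N) (\<lambda>q. (fst q, (snd q, n (snd q))))"
    by (intro C1_on_Pair s)
  moreover have "(\<lambda>q. (fst q, (snd q, n (snd q)))) ` ({0..} \<times> N) \<subseteq> {0::real..} \<times> (\<Omega> \<times> UNIV)"
    using N_sub by auto
  ultimately show ?thesis
    using C1_on_compose[OF _ C1_on_costate] by (fastforce simp: p_def)
qed

lemma C1_on_X: "C1_on spacetime ({0..} \<times> N) (\<lambda>q. X (fst q) (snd q))"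
  using C1_on_linear_compose[OF C1_on_X_costate bounded_linear_fst] by simp

lemma C1_on_p: "C1_on spacetime ({0..} \<times> N) (\<lambda>q. p (fst q) (snd q))"
  using C1_on_linear_compose[OF C1_on_X_costate bounded_linear_snd] by simp

lemma C1_on_\<nu>: "C1_on spacetime ({0..} \<times> N) (\<lambda>q. \<nu> (fst q) (snd q))"
  unfolding \<nu>_def by (rule C1_on_compose[OF C1_on_p C1_on_sgn]) (use p_nonzero in auto)

lemma C1_on_H: "C1_on ({0..} \<times> UNIV) ({0..} \<times> (N \<times> UNIV)) H"
proof -
  have o: "openin (top_of_set ({0..} \<times> UNIV)) ({0::real..} \<times> (N \<times> (UNIV :: real set)))"
    by (intro openin_halfspace open_Times open_N open_UNIV)
  have y: "C1_on ({0..} \<times> UNIV) ({0::real..} \<times> (N \<times> (UNIV :: real set))) (\<lambda>q. (fst q, fst (snd q)))"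
    by (intro C1_on_bounded_linear o bounded_linear_Pair bounded_linear_fst
        bounded_linear_compose[OF bounded_linear_fst bounded_linear_snd])
  have y': "C1_on ({0..} \<times> UNIV) ({0::real..} \<times> (N \<times> (UNIV :: real set))) (\<lambda>q. fst (snd q))"
    by (intro C1_on_bounded_linear o bounded_linear_compose[OF bounded_linear_fst bounded_linear_snd])
  have r: "C1_on ({0..} \<times> UNIV) ({0::real..} \<times> (N \<times> (UNIV :: real set))) (\<lambda>q. snd (snd q))"
    by (intro C1_on_bounded_linear o bounded_linear_compose[OF bounded_linear_snd bounded_linear_snd])
  have 1: "C1_on ({0..} \<times> UNIV) ({0..} \<times> (N \<times> (UNIV :: real set))) (\<lambda>q. X (fst q) (fst (snd q)))"
    using C1_on_compose[OF y C1_on_X] by fastforce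
  have 2: "C1_on ({0..} \<times> UNIV) ({0..} \<times> (N \<times> (UNIV :: real set))) (\<lambda>q. \<nu> (fst q) (fst (snd q)))"
    using C1_on_compose[OF y C1_on_\<nu>] by fastforce
  have 3: "C1_on ({0..} \<times> UNIV) ({0::real..} \<times> (N \<times> (UNIV :: real set))) (\<lambda>q. \<phi>0 (fst (snd q)))"
    by (rule C1_on_compose[OF y' C1_on_\<phi>0]) auto
  show ?thesis
    unfolding H_def[abs_def] by (intro C1_on_Pair C1_on_add C1_on_scaleR 1 2 3 r)
qed

text \<open>At \<open>r = 0\<close> the derivative of \<nu> is multiplied by 0, and what remains
  maps \<open>(\<eta>, s)\<close> to \<open>(W t y \<eta> + s \<nu>, n y \<bullet> \<eta>)\<close>.
  Pairing the first component with \<open>p t y\<close> removes \<open>W t y \<eta>\<close> for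
  tangential \<eta> and forces \<open>s = 0\<close>; injectivity of \<open>W t y\<close> does the
  rest.\<close>

lemma H_deriv_kernel:
  assumes H': "(H has_derivative H') (at (t, (y, 0)) within {0..} \<times> (N \<times> UNIV))"
    and t: "0 \<le> t" and y: "y \<in> N" and zero: "H' (0, \<zeta>) = 0"
  shows "\<zeta> = 0"
proof -
  have y\<Omega>: "y \<in> \<Omega>" using y N_sub by auto
  have slice: "((\<lambda>z. H (t, z)) has_derivative (\<lambda>\<zeta>. H' (0, \<zeta>))) (at (y, 0))"
    by (rule slice_has_derivative[OF H' t]) (use y open_N in \<open>auto intro: open_Times\<close>)
  obtain V where V: "((\<lambda>q. \<nu> (fst q) (snd q)) has_derivative V) (at (t, y) within {0..} \<times> N)"
    by (rule C1_onE[OF C1_on_\<nu>]) (use t y in force)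
  have fs: "(fst has_derivative fst) (at (y, 0 :: real))" "(snd has_derivative snd) (at (y, 0 :: real))"
    by (auto intro!: derivative_eq_intros)
  have a: "((\<lambda>z::(real^3)\<times>real. X t (fst z)) has_derivative (\<lambda>\<zeta>. W t y (fst \<zeta>))) (at (y, 0))"
    by (rule has_derivative_compose[OF fs(1)]) (use xflow.Z_deriv_x[OF t y\<Omega>] in simp)
  have b: "((\<lambda>z::(real^3)\<times>real. \<nu> t (fst z)) has_derivative (\<lambda>\<zeta>. V (0, fst \<zeta>))) (at (y, 0))"
    by (rule has_derivative_compose[OF fs(1)]) (use slice_has_derivative[OF V t y open_N] in simp)
  have c: "((\<lambda>z::(real^3)\<times>real. \<phi>0 (fst z)) has_derivative (\<lambda>\<zeta>. n y \<bullet> fst \<zeta>)) (at (y, 0))"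
    by (rule has_derivative_compose[OF fs(1)]) (use f_deriv[OF y] in simp)
  have "((\<lambda>z. H (t, z)) has_derivative
      (\<lambda>\<zeta>. (W t y (fst \<zeta>) + (0 *\<^sub>R V (0, fst \<zeta>) + snd \<zeta> *\<^sub>R \<nu> t y), n y \<bullet> fst \<zeta>))) (at (y, 0))"
    unfolding H_def fst_conv snd_conv
    using has_derivative_Pair[OF has_derivative_add[OF a has_derivative_scaleR[OF fs(2) b]] c] by simp
  from has_derivative_unique[OF slice this] zero
  have "(0 :: (real^3) \<times> real) = (W t y (fst \<zeta>) + snd \<zeta> *\<^sub>R \<nu> t y, n y \<bullet> fst \<zeta>)"
    by (auto dest!: fun_cong[of _ _ \<zeta>])
  then have 1: "W t y (fst \<zeta>) + snd \<zeta> *\<^sub>R \<nu> t y = 0" and 2: "n y \<bullet> fst \<zeta> = 0"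
    by (simp_all add: zero_prod_def)
  have "0 = p t y \<bullet> (W t y (fst \<zeta>) + snd \<zeta> *\<^sub>R \<nu> t y)" using 1 by simp
  also have "\<dots> = snd \<zeta> * norm (p t y)"
    using p_pairing[OF t y] 2 by (simp add: inner_add_right p_inner_\<nu>)
  finally have s: "snd \<zeta> = 0" using p_nonzero[OF t y] by simp
  then have "W t y (fst \<zeta>) = 0" using 1 by simp
  then have "fst \<zeta> = 0" using costate_pairing[OF y\<Omega> t, of "fst \<zeta>" "fst \<zeta>"] by simp
  then show ?thesis using s by (simp add: prod_eq_iff)
qed

text \<open>The curve \<open>s \<mapsto> c s\<close> with prescribed tangent \<open>\<eta>\<close> is the projection to \<open>\<Sigma>0\<close> of a straight line.\<close>

lemma nearest_point_orthogonal:
  assumes t: "0 \<le> t" and \<xi>: "\<xi> \<in> \<Sigma>0" and near: "\<And>\<zeta>. \<zeta> \<in> \<Sigma>0 \<Longrightarrow> norm (x - X t \<xi>) \<le> norm (x - X t \<zeta>)"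
    and \<eta>: "n \<xi> \<bullet> \<eta> = 0"
  shows "(x - X t \<xi>) \<bullet> W t \<xi> \<eta> = 0"
proof -
  have \<xi>N: "\<xi> \<in> N" and \<xi>\<Omega>: "\<xi> \<in> \<Omega>" using \<xi> \<Sigma>0_sub N_sub by auto
  have \<phi>\<xi>: "\<phi>0 \<xi> = 0" using zero_set[OF \<xi>\<Omega>] \<xi> by simp
  obtain \<rho> where \<rho>: "\<rho> > 0" "ball \<xi> \<rho> \<subseteq> N" using open_N \<xi>N openE by blast
  define c where "c s = (\<xi> + s *\<^sub>R \<eta>) - \<phi>0 (\<xi> + s *\<^sub>R \<eta>) *\<^sub>R n (\<xi> + s *\<^sub>R \<eta>)" for s
  have line: "((\<lambda>s. \<xi> + s *\<^sub>R \<eta>) has_derivative (\<lambda>h. h *\<^sub>R \<eta>)) (at 0)" by (auto intro!: derivative_eq_intros)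
  have a: "((\<lambda>s. \<phi>0 (\<xi> + s *\<^sub>R \<eta>)) has_derivative (\<lambda>h. n \<xi> \<bullet> (h *\<^sub>R \<eta>))) (at 0)"
    by (rule has_derivative_compose[OF line]) (use f_deriv[OF \<xi>N] in simp)
  have b: "((\<lambda>s. n (\<xi> + s *\<^sub>R \<eta>)) has_derivative (\<lambda>h. Dn \<xi> (h *\<^sub>R \<eta>))) (at 0)"
    by (rule has_derivative_compose[OF line]) (use n_deriv[OF \<xi>N] in simp)
  have c: "(c has_derivative (\<lambda>h. h *\<^sub>R \<eta>)) (at 0)"
    unfolding c_def
    by (rule has_derivative_eq_rhs[OF has_derivative_diff[OF line has_derivative_scaleR[OF a b]]])
      (simp add: \<phi>\<xi> \<eta>)
  have c0: "c 0 = \<xi>" by (simp add: c_def \<phi>\<xi>)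
  have "isCont (\<lambda>s. \<phi>0 (\<xi> + s *\<^sub>R \<eta>)) 0" using a has_derivative_continuous by blast
  then obtain d1 where d1: "d1 > 0" "\<And>s. \<bar>s\<bar> < d1 \<Longrightarrow> \<bar>\<phi>0 (\<xi> + s *\<^sub>R \<eta>)\<bar> < \<rho> / 2"
    using \<rho>(1) \<phi>\<xi> unfolding continuous_at_eps_delta by (auto dest: spec[of _ "\<rho> / 2"])
  \<comment> \<open>Half of \<rho> is reserved for the straight displacement and half, through
    \<open>d1\<close>, for the projection step along \<open>n\<close>.\<close>
  define d where "d = min d1 (\<rho> / (2 * (norm \<eta> + 1)))"
  have d: "d > 0" using d1 \<rho> by (auto simp: d_def add_nonneg_pos)
  have c\<Sigma>: "c s \<in> \<Sigma>0" if s: "\<bar>s\<bar> < d" for s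
  proof -
    define y where "y = \<xi> + s *\<^sub>R \<eta>"
    have "\<bar>s\<bar> * norm \<eta> \<le> d * (norm \<eta> + 1)" using s by (intro mult_mono) auto
    also have "\<dots> \<le> \<rho> / (2 * (norm \<eta> + 1)) * (norm \<eta> + 1)" by (intro mult_right_mono) (auto simp: d_def)
    also have "\<dots> = \<rho> / 2" using norm_ge_zero[of \<eta>] by (simp add: divide_simps add_nonneg_eq_0_iff)
    finally have y\<xi>: "norm (y - \<xi>) \<le> \<rho> / 2" by (simp add: y_def)
    have "y \<in> ball \<xi> \<rho>" using y\<xi> \<rho>(1) by (simp add: dist_norm norm_minus_commute)
    then have yN: "y \<in> N" using \<rho>(2) by auto
    have seg: "y + (\<tau> * - \<phi>0 y) *\<^sub>R n y \<in> N" if \<tau>: "\<tau> \<in> {0..1}" for \<tau>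
    proof -
      have "norm ((\<tau> * - \<phi>0 y) *\<^sub>R n y) \<le> \<bar>\<phi>0 y\<bar>"
        using norm_n[OF yN] \<tau> by (simp add: abs_mult mult_left_le_one_le)
      also have "\<dots> < \<rho> / 2" using d1(2)[of s] s by (simp add: y_def d_def)
      finally have "norm (y + (\<tau> * - \<phi>0 y) *\<^sub>R n y - \<xi>) < \<rho>"
        using y\<xi> norm_triangle_ineq[of "y - \<xi>" "(\<tau> * - \<phi>0 y) *\<^sub>R n y"] by (simp add: algebra_simps)
      then show ?thesis using \<rho>(2) by (auto simp: dist_norm norm_minus_commute subset_eq)
    qed
    have cs: "c s = y + (- \<phi>0 y) *\<^sub>R n y" by (simp add: c_def y_def)
    have "\<phi>0 (c s) = \<phi>0 y + - \<phi>0 y" unfolding cs by (rule normal_line(2)[OF seg])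
    moreover have "c s \<in> \<Omega>" using seg[of 1] N_sub by (auto simp: cs)
    ultimately show ?thesis using zero_set by auto
  qed
  have "((\<lambda>s. X t (c s)) has_derivative (\<lambda>h. W t \<xi> (h *\<^sub>R \<eta>))) (at 0)"
    by (rule has_derivative_compose[OF c]) (use xflow.Z_deriv_x[OF t \<xi>\<Omega>] c0 in simp)
  then have dX: "((\<lambda>s. x - X t (c s)) has_derivative (\<lambda>h. - W t \<xi> (h *\<^sub>R \<eta>))) (at 0)"
    by (auto intro!: derivative_eq_intros)
  have "((\<lambda>s. (x - X t (c s)) \<bullet> (x - X t (c s))) has_derivative (\<lambda>h. h * (- 2 * ((x - X t \<xi>) \<bullet> W t \<xi> \<eta>)))) (at 0)"
    by (rule has_derivative_eq_rhs[OF has_derivative_inner[OF dX dX]])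
      (simp add: c0 fun_eq_iff blinfun.scaleR_right inner_commute)
  then have D: "DERIV (\<lambda>s. (x - X t (c s)) \<bullet> (x - X t (c s))) 0 :> - 2 * ((x - X t \<xi>) \<bullet> W t \<xi> \<eta>)"
    unfolding has_field_derivative_def by (rule has_derivative_eq_rhs) (simp add: fun_eq_iff)
  have "- 2 * ((x - X t \<xi>) \<bullet> W t \<xi> \<eta>) = 0"
  proof (rule DERIV_local_min[OF D d], intro allI impI)
    fix s assume "\<bar>0 - s\<bar> < d"
    then have "norm (x - X t \<xi>) \<le> norm (x - X t (c s))" by (intro near c\<Sigma>) simp
    then show "(x - X t (c 0)) \<bullet> (x - X t (c 0)) \<le> (x - X t (c s)) \<bullet> (x - X t (c s))"
      by (simp add: c0 dot_square_norm power_mono)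
  qed
  then show ?thesis by simp
qed

text \<open>The vector from a nearest point to \<open>x\<close> annihilates the tangent space, so
  its pairing with \<open>W t \<xi>\<close> is a multiple of the pairing with
  \<open>n \<xi>\<close>, which is also what the costate produces. As \<open>W t \<xi>\<close> is
  onto, the vector is a multiple of \<open>p t \<xi>\<close>.\<close>

lemma nearest_point_normal:
  assumes t: "0 \<le> t" and \<xi>: "\<xi> \<in> \<Sigma>0" and near: "\<And>\<zeta>. \<zeta> \<in> \<Sigma>0 \<Longrightarrow> norm (x - X t \<xi>) \<le> norm (x - X t \<zeta>)"
  obtains r where "x = X t \<xi> + r *\<^sub>R \<nu> t \<xi>" "\<bar>r\<bar> = norm (x - X t \<xi>)"
proof -
  have \<xi>N: "\<xi> \<in> N" and \<xi>\<Omega>: "\<xi> \<in> \<Omega>" using \<xi> \<Sigma>0_sub N_sub by auto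
  define w where "w = x - X t \<xi>"
  define l where "l = w \<bullet> W t \<xi> (n \<xi>)"
  have all: "w \<bullet> W t \<xi> \<eta> = l * (p t \<xi> \<bullet> W t \<xi> \<eta>)" for \<eta>
  proof -
    define \<eta>' where "\<eta>' = \<eta> - (n \<xi> \<bullet> \<eta>) *\<^sub>R n \<xi>"
    have "n \<xi> \<bullet> \<eta>' = 0" using norm_n[OF \<xi>N] by (simp add: \<eta>'_def inner_diff_right dot_square_norm)
    then have "w \<bullet> W t \<xi> \<eta>' = 0" unfolding w_def by (intro nearest_point_orthogonal t \<xi> near)
    moreover have "W t \<xi> \<eta> = W t \<xi> \<eta>' + (n \<xi> \<bullet> \<eta>) *\<^sub>R W t \<xi> (n \<xi>)"
      by (simp add: \<eta>'_def blinfun.diff_right blinfun.scaleR_right)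
    ultimately show ?thesis using p_pairing[OF t \<xi>N, of \<eta>] by (simp add: inner_add_right l_def)
  qed
  \<comment> \<open>Testing the identity on a preimage of the difference shows that the difference
    has length 0.\<close>
  obtain \<eta> where "W t \<xi> \<eta> = w - l *\<^sub>R p t \<xi>" using W_surj[OF t \<xi>\<Omega>] by metis
  with all[of \<eta>] have "(w - l *\<^sub>R p t \<xi>) \<bullet> (w - l *\<^sub>R p t \<xi>) = 0" by (simp add: inner_diff_left)
  then have w: "w = (l * norm (p t \<xi>)) *\<^sub>R \<nu> t \<xi>"
    using \<nu>_scaled[of t \<xi>] by (metis eq_iff_diff_eq_0 inner_eq_zero_iff scaleR_scaleR)
  show ?thesis
  proof (rule that)
    show "x = X t \<xi> + (l * norm (p t \<xi>)) *\<^sub>R \<nu> t \<xi>" using w by (simp add: w_def algebra_simps)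
    show "\<bar>l * norm (p t \<xi>)\<bar> = norm (x - X t \<xi>)"
      using arg_cong[OF w, of norm] norm_\<nu>[OF t \<xi>N] by (simp add: w_def)
  qed
qed

lemma p_cont: "continuous_on ({0..} \<times> N) (\<lambda>q. p (fst q) (snd q))"
  by (rule C1_on_continuous[OF C1_on_p])

text \<open>To first order at \<open>\<xi>\<close>, \<open>p t \<xi> \<bullet> X t\<close> and \<open>\<phi>0\<close> have the same increments; hence a displacement \<open>r\<close>
  along \<open>\<nu> t \<xi>\<close> has the sign of \<open>\<phi>0\<close> at the initial position.\<close>

lemma sign_near_interface:
  assumes T: "0 \<le> T"
  obtains e where "e > 0" "\<And>t \<xi> z r. t \<in> {0..T} \<Longrightarrow> \<xi> \<in> \<Sigma>0 \<Longrightarrow> z \<in> \<Omega> \<Longrightarrow> \<bar>r\<bar> < e \<Longrightarrow>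
    X t z = X t \<xi> + r *\<^sub>R \<nu> t \<xi> \<Longrightarrow> sgn r = sgn (\<phi>0 z)"
proof -
  have cpt: "compact ({0..T} \<times> \<Sigma>0)" "{0..T} \<times> \<Sigma>0 \<noteq> {}"
    using \<Sigma>0_compact \<Sigma>0_ne T by (auto intro: compact_Times)
  have "continuous_on ({0..T} \<times> \<Sigma>0) (\<lambda>q. norm (p (fst q) (snd q)))"
    by (rule continuous_on_norm[OF continuous_on_subset[OF p_cont]]) (use \<Sigma>0_sub in auto)
  then obtain q0 where q0: "q0 \<in> {0..T} \<times> \<Sigma>0"
    "\<And>q. q \<in> {0..T} \<times> \<Sigma>0 \<Longrightarrow> norm (p (fst q0) (snd q0)) \<le> norm (p (fst q) (snd q))"
    using continuous_attains_inf[OF cpt] by blast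
  define m where "m = norm (p (fst q0) (snd q0))"
  have m: "m > 0" using q0(1) p_nonzero \<Sigma>0_sub by (auto simp: m_def)
  define E where "E = exp (L * T)"
  have E: "E > 0" by (simp add: E_def)
  \<comment> \<open>This choice bounds the error in \<open>est\<close> by half of the size of the
    leading term \<open>r * norm (p t \<xi>)\<close>, so that term decides the sign.\<close>
  define \<kappa> where "\<kappa> = m / (2 * E)"
  have \<kappa>: "\<kappa> > 0" using m E by (simp add: \<kappa>_def)
  \<comment> \<open>At \<open>q = (t, \<xi>, y)\<close> this is the derivative in \<open>y\<close>
    of \<open>p t \<xi> \<bullet> X t y - \<phi>0 y\<close>. It vanishes for
    \<open>y = \<xi>\<close> by \<open>p_pairing\<close>, so it is small near that diagonal.\<close>
  define B where "B q = (blinfun_inner_right (p (fst q) (fst (snd q))) o\<^sub>L W (fst q) (snd (snd q)))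
      - blinfun_inner_right (n (snd (snd q)))" for q :: "real \<times> (real^3) \<times> (real^3)"
  have B_cont: "continuous_on ({0..} \<times> N \<times> N) B"
  proof -
    have 1: "continuous_on ({0..} \<times> N \<times> N) (\<lambda>q. p (fst q) (fst (snd q)))"
      using continuous_on_compose2[OF p_cont, of "{0..} \<times> N \<times> N" "\<lambda>q. (fst q, fst (snd q))"]
      by (force intro!: continuous_intros)
    have 2: "continuous_on ({0..} \<times> N \<times> N) (\<lambda>q. W (fst q) (snd (snd q)))"
    proof -
      have "continuous_on ({0..} \<times> N \<times> N) (\<lambda>q::real \<times> (real^3) \<times> (real^3). (fst q, snd (snd q)))"
        by (intro continuous_intros)
      from continuous_on_compose2[OF xflow.W_cont this] N_sub show ?thesis by fastforce
    qed
    have 3: "continuous_on ({0..} \<times> N \<times> N) (\<lambda>q::real \<times> (real^3) \<times> (real^3). n (snd (snd q)))"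
      by (rule continuous_on_compose2[OF n_cont]) (auto intro!: continuous_intros)
    show ?thesis
      unfolding B_def
      by (intro continuous_on_diff bounded_bilinear.continuous_on[OF bounded_bilinear_blinfun_compose]
          bounded_linear.continuous_on[OF bounded_linear_blinfun_inner_right] 1 2 3)
  qed
  define K where "K = (\<lambda>(t, \<xi>). (t, \<xi>, \<xi>)) ` ({0..T} \<times> \<Sigma>0)"
  have "compact K"
    unfolding K_def
    by (intro compact_continuous_image compact_Times compact_Icc \<Sigma>0_compact)
      (auto simp: case_prod_unfold intro!: continuous_intros)
  moreover have "\<exists>d>0. \<exists>c>0::real. \<forall>q. dist k q < d \<longrightarrow> (0 \<le> fst q \<longrightarrow> snd q \<in> N \<times> N \<and> norm (B q) < \<kappa>)" if k: "k \<in> K" for k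
  proof -
    obtain t \<xi> where k_eq: "k = (t, \<xi>, \<xi>)" and t: "0 \<le> t" and \<xi>: "\<xi> \<in> N" using k \<Sigma>0_sub by (auto simp: K_def)
    have "B k = 0" using p_pairing[OF t \<xi>] by (intro blinfun_eqI) (simp add: B_def k_eq blinfun.diff_left)
    moreover have "k \<in> {0..} \<times> N \<times> N" using t \<xi> by (simp add: k_eq)
    ultimately obtain d where d: "d > 0" "\<And>q. q \<in> {0..} \<times> N \<times> N \<Longrightarrow> dist q k < d \<Longrightarrow> norm (B q) < \<kappa>"
      using B_cont[unfolded continuous_on_iff, rule_format, of k \<kappa>] \<kappa> by (auto simp: dist_norm)
    have "open (N \<times> N)" "(\<xi>, \<xi>) \<in> N \<times> N" using open_N \<xi> by (auto intro: open_Times)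
    then obtain r where r: "r > 0" "ball (\<xi>, \<xi>) r \<subseteq> N \<times> N" using openE by blast
    have "snd q \<in> N \<times> N" if "dist k q < r" for q
      using r(2) dist_snd_le[of k q] that by (auto simp: k_eq subset_eq)
    then have A: "\<forall>q. dist k q < min d r \<longrightarrow> (0 \<le> fst q \<longrightarrow> snd q \<in> N \<times> N \<and> norm (B q) < \<kappa>)"
      using d(2) by (auto simp: dist_commute mem_Times_iff)
    have B: "min d r > 0" using d(1) r(1) by simp
    show ?thesis by (intro exI[of _ "min d r"] conjI A B)
  qed
  ultimately obtain \<delta> where \<delta>: "\<delta> > 0" "\<And>k q. k \<in> K \<Longrightarrow> dist k q < \<delta> \<Longrightarrow> 0 \<le> fst q \<Longrightarrow> snd q \<in> N \<times> N \<and> norm (B q) < \<kappa>"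
    by (rule compact_uniform_nbhd[of K "\<lambda>_ q. 0 \<le> fst q \<longrightarrow> snd q \<in> N \<times> N \<and> norm (B q) < \<kappa>"]) auto
  show ?thesis
  proof (rule that[of "\<delta> / E"])
    show "\<delta> / E > 0" using \<delta> E by simp
    fix t \<xi> z r
    assume t: "t \<in> {0..T}" and \<xi>: "\<xi> \<in> \<Sigma>0" and z: "z \<in> \<Omega>" and r: "\<bar>r\<bar> < \<delta> / E"
      and rep: "X t z = X t \<xi> + r *\<^sub>R \<nu> t \<xi>"
    have t0: "0 \<le> t" and \<xi>N: "\<xi> \<in> N" and \<xi>\<Omega>: "\<xi> \<in> \<Omega>" using t \<xi> \<Sigma>0_sub N_sub by auto
    \<comment> \<open>A priori \<open>z\<close> is any point of \<Omega>; expansion places it near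
      \<xi>, where the linearization is valid.\<close>
    have "norm (z - \<xi>) \<le> exp (L * t) * norm (X t z - X t \<xi>)" by (rule X_expand[OF t0 z \<xi>\<Omega>])
    also have "\<dots> \<le> E * \<bar>r\<bar>"
      using norm_\<nu>[OF t0 \<xi>N] t L_nonneg by (auto simp: rep E_def intro!: mult_right_mono mult_left_mono)
    finally have z\<xi>: "norm (z - \<xi>) \<le> E * \<bar>r\<bar>" .
    also have "\<dots> < \<delta>" using r E by (simp add: field_simps)
    finally have zball: "z \<in> ball \<xi> \<delta>" by (simp add: dist_norm norm_minus_commute)
    have nearB: "y \<in> N" "norm (B (t, \<xi>, y)) < \<kappa>" if "y \<in> ball \<xi> \<delta>" for y
    proof -
      have "(t, \<xi>, \<xi>) \<in> K" using t \<xi> by (auto simp: K_def)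
      moreover have "dist (t, \<xi>, \<xi>) (t, \<xi>, y) < \<delta>" using that by (simp add: dist_Pair_Pair)
      ultimately show "y \<in> N" "norm (B (t, \<xi>, y)) < \<kappa>" using \<delta>(2)[of "(t, \<xi>, \<xi>)" "(t, \<xi>, y)"] t0 by auto
    qed
    have "norm ((\<lambda>y. p t \<xi> \<bullet> X t y - \<phi>0 y) z - (\<lambda>y. p t \<xi> \<bullet> X t y - \<phi>0 y) \<xi>) \<le> \<kappa> * norm (z - \<xi>)"
    proof (rule differentiable_bound[of "ball \<xi> \<delta>" _ "\<lambda>y. blinfun_apply (B (t, \<xi>, y))"])
      fix y assume y: "y \<in> ball \<xi> \<delta>"
      have yN: "y \<in> N" using nearB[OF y] by auto
      have "((\<lambda>y. p t \<xi> \<bullet> X t y - \<phi>0 y) has_derivative (\<lambda>\<eta>. p t \<xi> \<bullet> W t y \<eta> - n y \<bullet> \<eta>)) (at y)"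
        by (intro has_derivative_diff has_derivative_inner_right xflow.Z_deriv_x t0 f_deriv yN)
          (use yN N_sub in auto)
      then show "((\<lambda>y. p t \<xi> \<bullet> X t y - \<phi>0 y) has_derivative blinfun_apply (B (t, \<xi>, y))) (at y within ball \<xi> \<delta>)"
        by (simp add: B_def blinfun.diff_left[abs_def] has_derivative_at_withinI)
      show "onorm (blinfun_apply (B (t, \<xi>, y))) \<le> \<kappa>"
        using nearB(2)[OF y] by (simp flip: norm_blinfun.rep_eq)
    qed (use zball \<delta>(1) in auto)
    also have "\<dots> \<le> \<kappa> * (E * \<bar>r\<bar>)" using z\<xi> \<kappa> by (intro mult_left_mono) auto
    also have "\<dots> = m / 2 * \<bar>r\<bar>" using E by (simp add: \<kappa>_def)
    also have "\<dots> \<le> norm (p t \<xi>) / 2 * \<bar>r\<bar>"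
      using q0(2)[of "(t, \<xi>)"] t \<xi> by (intro mult_right_mono) (auto simp: m_def)
    finally have est: "\<bar>r * norm (p t \<xi>) - \<phi>0 z\<bar> \<le> norm (p t \<xi>) / 2 * \<bar>r\<bar>"
      using zero_set[OF \<xi>\<Omega>] \<xi> by (simp add: rep inner_add_right p_inner_\<nu>)
    have pp: "norm (p t \<xi>) > 0" using p_nonzero[OF t0 \<xi>N] by simp
    show "sgn r = sgn (\<phi>0 z)"
    proof (cases r "0 :: real" rule: linorder_cases)
      case less
      then have "r * norm (p t \<xi>) < 0" using pp by (simp add: mult_neg_pos)
      moreover have "norm (p t \<xi>) / 2 * \<bar>r\<bar> = - (r * norm (p t \<xi>)) / 2" using less by simp
      ultimately have "\<phi>0 z < 0" using est by linarith
      then show ?thesis using less by simp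
    next
      case equal
      then show ?thesis using est by simp
    next
      case greater
      then have "r * norm (p t \<xi>) > 0" using pp by simp
      moreover have "norm (p t \<xi>) / 2 * \<bar>r\<bar> = r * norm (p t \<xi>) / 2" using greater by simp
      ultimately have "\<phi>0 z > 0" using est by linarith
      then show ?thesis using greater by simp
    qed
  qed
qed

end

section \<open>The tubular neighborhood\<close>

text \<open>Uniqueness requires approach along each basis direction from within \<Theta>. The basis
  vectors have nonnegative time component, so small positive multiples stay in the half space even
  at \<open>t = 0\<close>.\<close>

lemma halfspace_derivative_unique:
  fixes f :: "real \<times> 'a::euclidean_space \<Rightarrow> 'b::real_normed_vector"
  assumes "openin (top_of_set ({0..} \<times> UNIV)) \<Theta>" and q: "q \<in> \<Theta>"
    and "(f has_derivative f') (at q within \<Theta>)" "(f has_derivative f'') (at q within \<Theta>)"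
  shows "f' = f''"
proof (rule frechet_derivative_unique_within[OF assms(3,4)])
  fix i :: "real \<times> 'a" and e :: real assume i: "i \<in> Basis" and e: "e > 0"
  obtain A where A: "open A" "\<Theta> = ({0..} \<times> UNIV) \<inter> A" using assms(1) by (auto simp: openin_open)
  then obtain r where r: "r > 0" "ball q r \<subseteq> A" using q openE by blast
  define d where "d = min e r / 2"
  have d: "0 < d" "d < e" "d < r" using e r by (auto simp: d_def)
  have "0 \<le> fst i" using i by (auto simp: Basis_prod_def)
  then have "q + d *\<^sub>R i \<in> {0..} \<times> UNIV" using q A d by (auto simp: mem_Times_iff)
  moreover have "q + d *\<^sub>R i \<in> A" using r(2) d norm_Basis[OF i] by (auto simp: dist_norm subset_eq)
  ultimately show "\<exists>d. 0 < \<bar>d\<bar> \<and> \<bar>d\<bar> < e \<and> q + d *\<^sub>R i \<in> \<Theta>"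
    using d A by (intro exI[of _ d]) auto
qed

lemma grad_eqI: "GDERIV f x :> D \<Longrightarrow> grad f x = D" for f :: "real^3 \<Rightarrow> real"
  unfolding grad_def
proof (rule the_equality)
  fix D' assume "GDERIV f x :> D" "GDERIV f x :> D'"
  then have "(\<lambda>h. h \<bullet> D') = (\<lambda>h. h \<bullet> D)" unfolding gderiv_def by (blast intro: has_derivative_unique)
  then show "D' = D" by (metis vector_eq_ldot)
qed

context moving_interface
begin

text \<open>Bundles what a tube radius must guarantee up to time \<open>T\<close>. Each clause
  passes to smaller radii, which allows a nonincreasing choice of radii.\<close>

definition admissible :: "real \<Rightarrow> real \<Rightarrow> bool" where
  "admissible T e \<longleftrightarrow>
    (\<exists>c>0. \<forall>t\<in>{0..T}. \<forall>k\<in>\<Sigma>0. \<forall>k'\<in>\<Sigma>0. \<forall>z z'. dist (k, 0) z < e \<longrightarrow> dist (k', 0) z' < e \<longrightarrow>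
      c * norm (z - z') \<le> norm (H (t, z) - H (t, z'))) \<and>
    (\<forall>k\<in>\<Sigma>0. \<forall>z. dist (k, 0 :: real) z < e \<longrightarrow> z \<in> N \<times> UNIV) \<and>
    (\<forall>t\<in>{0..T}. \<forall>\<xi>\<in>\<Sigma>0. ball (X t \<xi>) e \<subseteq> \<Omega>) \<and>
    (\<forall>t\<in>{0..T}. \<forall>\<xi>\<in>\<Sigma>0. \<forall>z\<in>\<Omega>. \<forall>r. \<bar>r\<bar> < e \<longrightarrow> X t z = X t \<xi> + r *\<^sub>R \<nu> t \<xi> \<longrightarrow> sgn r = sgn (\<phi>0 z))"

lemma admissible_lower: "admissible T e \<Longrightarrow>
    \<exists>c>0. \<forall>t\<in>{0..T}. \<forall>k\<in>\<Sigma>0. \<forall>k'\<in>\<Sigma>0. \<forall>z z'. dist (k, 0) z < e \<longrightarrow> dist (k', 0) z' < e \<longrightarrow>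
      c * norm (z - z') \<le> norm (H (t, z) - H (t, z'))"
  by (simp only: admissible_def)

lemma admissible_N: "admissible T e \<Longrightarrow> k \<in> \<Sigma>0 \<Longrightarrow> dist (k, 0 :: real) z < e \<Longrightarrow> z \<in> N \<times> UNIV"
  unfolding admissible_def by blast

lemma admissible_ball: "admissible T e \<Longrightarrow> t \<in> {0..T} \<Longrightarrow> \<xi> \<in> \<Sigma>0 \<Longrightarrow> ball (X t \<xi>) e \<subseteq> \<Omega>"
  by (simp only: admissible_def)

lemma admissible_sign: "admissible T e \<Longrightarrow> t \<in> {0..T} \<Longrightarrow> \<xi> \<in> \<Sigma>0 \<Longrightarrow> z \<in> \<Omega> \<Longrightarrow> \<bar>r\<bar> < e \<Longrightarrow>
    X t z = X t \<xi> + r *\<^sub>R \<nu> t \<xi> \<Longrightarrow> sgn r = sgn (\<phi>0 z)"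
  by (simp only: admissible_def)

lemma admissible_mono:
  assumes "admissible T e" and le: "e' \<le> e"
  shows "admissible T e'"
proof -
  obtain c where c: "c > 0" "\<forall>t\<in>{0..T}. \<forall>k\<in>\<Sigma>0. \<forall>k'\<in>\<Sigma>0. \<forall>z z'. dist (k, 0) z < e \<longrightarrow> dist (k', 0) z' < e \<longrightarrow>
      c * norm (z - z') \<le> norm (H (t, z) - H (t, z'))"
    using admissible_lower[OF assms(1)] by blast
  have less: "a < e" if "a < e'" for a using that le by simp
  show ?thesis
    unfolding admissible_def
  proof (intro conjI exI[of _ c] ballI allI impI)
    show "ball (X t \<xi>) e' \<subseteq> \<Omega>" if "t \<in> {0..T}" "\<xi> \<in> \<Sigma>0" for t \<xi>
      using admissible_ball[OF assms(1) that] subset_ball[OF le] by (rule subset_trans[rotated])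
    show "c * norm (z - z') \<le> norm (H (t, z) - H (t, z'))"
      if "t \<in> {0..T}" "k \<in> \<Sigma>0" "k' \<in> \<Sigma>0" "dist (k, 0) z < e'" "dist (k', 0) z' < e'" for t k k' z z'
      using c(2)[rule_format, OF that(1-3) less[OF that(4)] less[OF that(5)]] .
  qed (use c less in \<open>simp_all add: admissible_N[OF assms(1)] admissible_sign[OF assms(1)]\<close>)
qed

lemma X_continuous_on: "0 \<le> t \<Longrightarrow> continuous_on \<Omega> (X t)"
  by (intro continuous_at_imp_continuous_on ballI has_derivative_continuous[OF xflow.Z_deriv_x])

text \<open>On \<open>\<Sigma>0 \<times> {0}\<close> the first component of \<open>H\<close> is
  \<open>X t\<close>, injective by \<open>X_expand\<close>, and the derivative is injective by
  \<open>H_deriv_kernel\<close>; these are the two conditions of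
  \<open>uniform_lower_bound\<close>.\<close>

lemma lower_bound_near_interface:
  obtains d c where "d > 0" "c > 0" "\<And>k z. k \<in> \<Sigma>0 \<Longrightarrow> dist (k, 0 :: real) z < d \<Longrightarrow> z \<in> N \<times> UNIV"
    "\<And>t k k' z z'. t \<in> {0..T} \<Longrightarrow> k \<in> \<Sigma>0 \<Longrightarrow> k' \<in> \<Sigma>0 \<Longrightarrow> dist (k, 0) z < d \<Longrightarrow> dist (k', 0) z' < d \<Longrightarrow>
      c * norm (z - z') \<le> norm (H (t, z) - H (t, z'))"
proof -
  obtain H' where H': "\<And>q. q \<in> {0..} \<times> (N \<times> UNIV) \<Longrightarrow>
      (H has_derivative blinfun_apply (H' q)) (at q within {0..} \<times> (N \<times> UNIV))"
    "continuous_on ({0..} \<times> (N \<times> UNIV)) H'"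
    by (rule C1_onE[OF C1_on_H]) blast
  define E where "E = Blinfun (\<lambda>\<zeta>::(real^3) \<times> real. (0::real, \<zeta>))"
  have E: "blinfun_apply E = (\<lambda>\<zeta>. (0, \<zeta>))"
    unfolding E_def by (intro bounded_linear_Blinfun_apply bounded_linear_Pair bounded_linear_zero bounded_linear_ident)
  have oS: "open (N \<times> (UNIV :: real set))" by (intro open_Times open_N open_UNIV)
  show ?thesis
  proof (rule uniform_lower_bound[where S = "N \<times> UNIV" and K = "\<Sigma>0 \<times> {0}" and T = T
        and H = "\<lambda>t z. H (t, z)" and D = "\<lambda>t z. H' (t, z) o\<^sub>L E"])
    show "compact (\<Sigma>0 \<times> {0 :: real})" by (intro compact_Times \<Sigma>0_compact) auto
    show "\<Sigma>0 \<times> {0} \<subseteq> N \<times> (UNIV :: real set)" using \<Sigma>0_sub by auto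
    show "continuous_on ({0..} \<times> N \<times> UNIV) (\<lambda>(t, z). H (t, z))"
      using C1_on_continuous[OF C1_on_H] by simp
    show "((\<lambda>z. H (t, z)) has_derivative blinfun_apply (H' (t, z) o\<^sub>L E)) (at z)"
      if "0 \<le> t" "z \<in> N \<times> UNIV" for t z
      using slice_has_derivative[OF H'(1) _ _ oS, of t z] that by (simp add: blinfun_compose.rep_eq E o_def)
    show "continuous_on ({0..} \<times> N \<times> UNIV) (\<lambda>(t, z). H' (t, z) o\<^sub>L E)"
      using bounded_bilinear.continuous_on[OF bounded_bilinear_blinfun_compose H'(2) continuous_on_const]
      by (simp add: case_prod_unfold)
    show "z = z'" if "0 \<le> t" "z \<in> \<Sigma>0 \<times> {0}" "z' \<in> \<Sigma>0 \<times> {0}" "H (t, z) = H (t, z')" for t z z'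
    proof -
      have "fst z \<in> \<Omega>" "fst z' \<in> \<Omega>" using that \<Sigma>0_sub N_sub by auto
      then have "norm (fst z - fst z') \<le> exp (L * t) * norm (X t (fst z) - X t (fst z'))"
        by (intro X_expand that(1))
      also have "\<dots> = 0" using that by (auto simp: H_def)
      finally show ?thesis using that by auto
    qed
    show "\<zeta> = 0" if \<zeta>: "0 \<le> t" "z \<in> \<Sigma>0 \<times> {0}" "(H' (t, z) o\<^sub>L E) \<zeta> = 0" for t z \<zeta>
    proof -
      obtain y where z: "z = (y, 0)" "y \<in> N" using \<zeta>(2) \<Sigma>0_sub by auto
      show ?thesis
        by (rule H_deriv_kernel[OF H'(1), of t y]) (use \<zeta> z in \<open>auto simp: E\<close>)
    qed
  next
    fix d c :: real
    assume d: "d > 0" "c > 0" and dN: "\<And>k z. k \<in> \<Sigma>0 \<times> {0 :: real} \<Longrightarrow> dist k z < d \<Longrightarrow> z \<in> N \<times> UNIV"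
      and low: "\<And>t k k' z z'. t \<in> {0..T} \<Longrightarrow> k \<in> \<Sigma>0 \<times> {0} \<Longrightarrow> k' \<in> \<Sigma>0 \<times> {0} \<Longrightarrow>
        dist k z < d \<Longrightarrow> dist k' z' < d \<Longrightarrow> c * norm (z - z') \<le> norm (H (t, z) - H (t, z'))"
    show ?thesis
    proof (rule that[OF d])
      show "z \<in> N \<times> UNIV" if "k \<in> \<Sigma>0" "dist (k, 0 :: real) z < d" for k z
        using dN[of "(k, 0)" z] that by simp
      show "c * norm (z - z') \<le> norm (H (t, z) - H (t, z'))"
        if "t \<in> {0..T}" "k \<in> \<Sigma>0" "k' \<in> \<Sigma>0" "dist (k, 0) z < d" "dist (k', 0) z' < d" for t k k' z z'
        using low[of t "(k, 0)" "(k', 0)" z z'] that by simp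
    qed
  qed (use oS in simp_all)
qed

lemma admissible_exists:
  assumes T: "0 \<le> T"
  shows "\<exists>e>0. admissible T e"
proof -
  obtain d c where d: "d > 0" "c > 0" "\<And>k z. k \<in> \<Sigma>0 \<Longrightarrow> dist (k, 0 :: real) z < d \<Longrightarrow> z \<in> N \<times> UNIV"
    "\<And>t k k' z z'. t \<in> {0..T} \<Longrightarrow> k \<in> \<Sigma>0 \<Longrightarrow> k' \<in> \<Sigma>0 \<Longrightarrow> dist (k, 0) z < d \<Longrightarrow> dist (k', 0) z' < d \<Longrightarrow>
      c * norm (z - z') \<le> norm (H (t, z) - H (t, z'))"
    using lower_bound_near_interface[of T] by blast
  define R where "R = (\<lambda>q. X (fst q) (snd q)) ` ({0..T} \<times> \<Sigma>0)"
  have "compact R"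
    unfolding R_def
    by (intro compact_continuous_image compact_Times compact_Icc \<Sigma>0_compact
        continuous_on_subset[OF C1_on_continuous[OF C1_on_X]]) (use \<Sigma>0_sub in auto)
  moreover have "R \<subseteq> \<Omega>" using X_solution(2) \<Sigma>0_sub N_sub by (auto simp: R_def)
  ultimately obtain e1 where e1: "e1 > 0" "(\<Union>x\<in>R. ball x e1) \<subseteq> \<Omega>"
    using compact_subset_open_imp_ball_epsilon_subset[of R \<Omega>] open_\<Omega> by blast
  obtain e2 where e2: "e2 > 0" "\<And>t \<xi> z r. t \<in> {0..T} \<Longrightarrow> \<xi> \<in> \<Sigma>0 \<Longrightarrow> z \<in> \<Omega> \<Longrightarrow> \<bar>r\<bar> < e2 \<Longrightarrow>
    X t z = X t \<xi> + r *\<^sub>R \<nu> t \<xi> \<Longrightarrow> sgn r = sgn (\<phi>0 z)"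
    using sign_near_interface[OF T] by blast
  define e where "e = min d (min e1 e2)"
  have le: "e \<le> d" "e \<le> e1" "e \<le> e2" by (auto simp: e_def)
  have "ball (X t \<xi>) e \<subseteq> \<Omega>" if "t \<in> {0..T}" "\<xi> \<in> \<Sigma>0" for t \<xi>
  proof -
    have "X t \<xi> \<in> R" unfolding R_def using that by (intro image_eqI[of _ _ "(t, \<xi>)"]) auto
    then show ?thesis using e1(2) le(2) subset_ball by blast
  qed
  then have "admissible T e"
    unfolding admissible_def
    using le d(2) d(3)[OF _ order_less_le_trans[OF _ le(1)]]
      d(4)[OF _ _ _ order_less_le_trans[OF _ le(1)] order_less_le_trans[OF _ le(1)]]
      e2(2)[OF _ _ _ order_less_le_trans[OF _ le(3)]]
    by (intro conjI exI[of _ c]) simp_all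
  moreover have "e > 0" using d e1 e2 by (simp add: e_def)
  ultimately show ?thesis by blast
qed

text \<open>The radius must not increase in time, and the tube must stay relatively open; a right-continuous
  step function achieves both.\<close>

definition rad :: "nat \<Rightarrow> real" where
  "rad = (SOME \<epsilon>. (\<forall>k. 0 < \<epsilon> k \<and> admissible (real k) (\<epsilon> k)) \<and> antimono \<epsilon>)"

lemma rad: "0 < rad k" "admissible (real k) (rad k)" "antimono rad"
proof -
  obtain e where e: "\<And>k. 0 < e k \<and> admissible (real k) (e k)" using admissible_exists[of "real _"] by (metis of_nat_0_le_iff)
  define \<epsilon> where "\<epsilon> k = Min (e ` {..k})" for k :: nat
  have "0 < \<epsilon> k" for k unfolding \<epsilon>_def using e by (subst Min_gr_iff) auto
  moreover have "admissible (real k) (\<epsilon> k)" for k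
    by (rule admissible_mono[OF conjunct2[OF e]]) (auto simp: \<epsilon>_def)
  moreover have "antimono \<epsilon>" unfolding \<epsilon>_def by (intro antimonoI Min_antimono) auto
  ultimately have "\<exists>\<epsilon>. (\<forall>k. 0 < \<epsilon> k \<and> admissible (real k) (\<epsilon> k)) \<and> antimono \<epsilon>" by blast
  from someI_ex[OF this] show "0 < rad k" "admissible (real k) (rad k)" "antimono rad"
    unfolding rad_def by blast+
qed

section \<open>Time-dependent radius and the tube\<close>

definition horizon :: "real \<Rightarrow> real" where "horizon t = real (nat \<lfloor>t\<rfloor> + 1)"

definition eps :: "real \<Rightarrow> real" where "eps t = rad (nat \<lfloor>t\<rfloor> + 1)"

lemma eps_pos: "0 < eps t" by (simp add: eps_def rad)

lemma eps_admissible: "admissible (horizon t) (eps t)" by (simp add: eps_def horizon_def rad del: of_nat_add of_nat_Suc)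

lemma horizon_gt: "t < horizon t"
  unfolding horizon_def by linarith

lemma eps_antimono: "s \<le> t \<Longrightarrow> eps t \<le> eps s"
  unfolding eps_def by (intro antimonoD[OF rad(3)] add_right_mono nat_mono floor_mono)

text \<open>Before the next integer after \<open>t\<close> the step function has not dropped below
  its value at \<open>t\<close>. The horizon lies strictly after \<open>t\<close>, so this covers a
  full time neighborhood of \<open>t\<close>.\<close>

lemma eps_le_before_horizon:
  assumes "0 \<le> t" "s < horizon t" shows "eps t \<le> eps s"
proof -
  have "\<lfloor>s\<rfloor> \<le> \<lfloor>t\<rfloor>" using assms unfolding horizon_def by linarith
  then show ?thesis unfolding eps_def by (intro antimonoD[OF rad(3)] add_right_mono nat_mono)
qed

definition \<Theta> :: "(real \<times> (real^3)) set" where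
  "\<Theta> = {(t, x). 0 \<le> t \<and> (\<exists>\<xi>\<in>\<Sigma>0. norm (x - X t \<xi>) < eps t)}"

lemma \<Theta>_nonneg: "(t, x) \<in> \<Theta> \<Longrightarrow> 0 \<le> t" by (simp add: \<Theta>_def)

lemma distance_continuous:
  assumes "\<xi> \<in> \<Sigma>0"
  shows "continuous_on ({0..} \<times> UNIV) (\<lambda>q::real \<times> (real^3). norm (snd q - X (fst q) \<xi>))"
proof -
  have "continuous_on {0..} (\<lambda>t. X t \<xi>)" using xflow.Z_cont_t assms \<Sigma>0_sub N_sub by blast
  then have "continuous_on ({0..} \<times> (UNIV :: (real^3) set)) (\<lambda>q. X (fst q) \<xi>)"
    by (rule continuous_on_compose2) (auto intro!: continuous_intros)
  then show ?thesis by (intro continuous_intros)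
qed

text \<open>Nearby points are measured against the same initial point \<xi>. Its trajectory is
  continuous, and the radius is at least \<open>eps t\<close> before the horizon, so the
  neighborhood stays inside \<Theta>. The bound by \<open>eps t\<close> at all its times feeds the
  implicit function theorem.\<close>

lemma \<Theta>_nbhd:
  assumes "(t, x) \<in> \<Theta>" "\<xi> \<in> \<Sigma>0" "norm (x - X t \<xi>) < eps t"
  obtains B where "openin (top_of_set spacetime) B" "(t, x) \<in> B" "B \<subseteq> \<Theta>"
    "\<And>s y. (s, y) \<in> B \<Longrightarrow> s < horizon t \<and> norm (y - X s \<xi>) < eps t"
proof -
  define B where "B = spacetime \<inter> (\<lambda>q. norm (snd q - X (fst q) \<xi>)) -` {..<eps t} \<inter> (spacetime \<inter> fst -` {..<horizon t})"
  show ?thesis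
  proof (rule that[of B])
    show "openin (top_of_set spacetime) B"
    proof -
      have "openin (top_of_set spacetime) (spacetime \<inter> (\<lambda>q. norm (snd q - X (fst q) \<xi>)) -` {..<eps t})"
        by (intro continuous_openin_preimage_gen distance_continuous assms) auto
      moreover have "openin (top_of_set spacetime) (spacetime \<inter> fst -` {..<horizon t})"
        by (intro continuous_openin_preimage_gen continuous_intros)
      ultimately show ?thesis unfolding B_def by (rule openin_Int)
    qed
    show "(t, x) \<in> B" using assms horizon_gt[of t] \<Theta>_nonneg by (auto simp: B_def)
    show "B \<subseteq> \<Theta>"
    proof
      fix q assume q: "q \<in> B"
      then have "norm (snd q - X (fst q) \<xi>) < eps (fst q)"
        using eps_le_before_horizon[of t "fst q"] \<Theta>_nonneg[OF assms(1)] by (auto simp: B_def)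
      then show "q \<in> \<Theta>" using q assms(2) by (auto simp: \<Theta>_def B_def)
    qed
  qed (auto simp: B_def)
qed

lemma openin_\<Theta>: "openin (top_of_set spacetime) \<Theta>"
proof (subst openin_subopen, intro ballI)
  fix q assume q: "q \<in> \<Theta>"
  then obtain t x \<xi> where "q = (t, x)" "\<xi> \<in> \<Sigma>0" "norm (x - X t \<xi>) < eps t" by (auto simp: \<Theta>_def)
  then show "\<exists>B. openin (top_of_set spacetime) B \<and> q \<in> B \<and> B \<subseteq> \<Theta>"
    using \<Theta>_nbhd[of t x \<xi>] q by metis
qed

text \<open>\<open>z = (y, r)\<close> are coordinates of \<open>q\<close> whose foot point is
  nearest on the interface. Minimality is part of the notion because it controls \<open>r\<close> at
  neighboring points and yields the distance formula; uniqueness comes from the other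
  clauses.\<close>

definition is_chart :: "real \<times> (real^3) \<Rightarrow> (real^3) \<times> real \<Rightarrow> bool" where
  "is_chart q z \<longleftrightarrow> fst z \<in> \<Sigma>0 \<and> \<bar>snd z\<bar> < eps (fst q) \<and> H (fst q, z) = (snd q, 0) \<and>
    \<bar>snd z\<bar> = norm (snd q - X (fst q) (fst z)) \<and>
    (\<forall>\<zeta>\<in>\<Sigma>0. \<bar>snd z\<bar> \<le> norm (snd q - X (fst q) \<zeta>))"

lemma H_on_interface: "\<xi> \<in> \<Sigma>0 \<Longrightarrow> H (t, (\<xi>, r)) = (X t \<xi> + r *\<^sub>R \<nu> t \<xi>, 0)"
  using zero_set \<Sigma>0_sub N_sub by (auto simp: H_def)

text \<open>Formulated for an arbitrary nearest point: applied to one of them it gives existence of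
  a chart, applied to all of them it gives, with \<open>g_eqI\<close>, a single-valued
  projection.\<close>

lemma nearest_is_chart:
  assumes q: "(t, x) \<in> \<Theta>" and \<xi>: "\<xi> \<in> \<Sigma>0" and near: "\<And>\<zeta>. \<zeta> \<in> \<Sigma>0 \<Longrightarrow> norm (x - X t \<xi>) \<le> norm (x - X t \<zeta>)"
  obtains r where "is_chart (t, x) (\<xi>, r)"
proof -
  obtain r where r: "x = X t \<xi> + r *\<^sub>R \<nu> t \<xi>" "\<bar>r\<bar> = norm (x - X t \<xi>)"
    using nearest_point_normal[OF \<Theta>_nonneg[OF q] \<xi> near] by metis
  obtain \<zeta> where "\<zeta> \<in> \<Sigma>0" "norm (x - X t \<zeta>) < eps t" using q by (auto simp: \<Theta>_def)
  then have lt: "norm (x - X t \<xi>) < eps t" using near[of \<zeta>] by linarith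
  have "is_chart (t, x) (\<xi>, r)"
    unfolding is_chart_def fst_conv snd_conv
  proof (intro conjI ballI)
    show "H (t, (\<xi>, r)) = (x, 0)" using H_on_interface[OF \<xi>, of t r] r(1) by metis
  qed (use \<xi> near lt r(2) in simp_all)
  then show ?thesis by (rule that)
qed

lemma chart_exists:
  assumes q: "q \<in> \<Theta>" shows "\<exists>z. is_chart q z"
proof -
  obtain t x where q_eq: "q = (t, x)" by fastforce
  have t: "0 \<le> t" using q by (simp add: q_eq \<Theta>_nonneg)
  have "continuous_on \<Sigma>0 (\<lambda>\<xi>. norm (x - X t \<xi>))"
    using \<Sigma>0_sub N_sub by (intro continuous_intros continuous_on_subset[OF X_continuous_on[OF t]]) auto
  then obtain \<xi> where "\<xi> \<in> \<Sigma>0" "\<And>\<zeta>. \<zeta> \<in> \<Sigma>0 \<Longrightarrow> norm (x - X t \<xi>) \<le> norm (x - X t \<zeta>)"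
    using continuous_attains_inf[OF \<Sigma>0_compact \<Sigma>0_ne] by blast
  then show ?thesis using nearest_is_chart[of t x \<xi>] q by (metis q_eq)
qed

lemma dist_chart: "dist (k, 0 :: real) (k, r) = \<bar>r\<bar>"
  by (simp add: dist_Pair_Pair)

lemma chart_lower_bound:
  obtains c where "c > 0" "\<And>s z z'. s \<in> {0..horizon t} \<Longrightarrow> fst z \<in> \<Sigma>0 \<Longrightarrow> fst z' \<in> \<Sigma>0 \<Longrightarrow>
    \<bar>snd z\<bar> < eps t \<Longrightarrow> \<bar>snd z'\<bar> < eps t \<Longrightarrow> c * norm (z - z') \<le> norm (H (s, z) - H (s, z'))"
proof -
  obtain c where c: "c > 0" "\<And>s k k' z z'. s \<in> {0..horizon t} \<Longrightarrow> k \<in> \<Sigma>0 \<Longrightarrow> k' \<in> \<Sigma>0 \<Longrightarrow>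
      dist (k, 0) z < eps t \<Longrightarrow> dist (k', 0) z' < eps t \<Longrightarrow> c * norm (z - z') \<le> norm (H (s, z) - H (s, z'))"
    using admissible_lower[OF eps_admissible[of t]] by blast
  show ?thesis
  proof (rule that[OF c(1)])
    fix s and z z' :: "(real^3) \<times> real"
    assume "s \<in> {0..horizon t}" "fst z \<in> \<Sigma>0" "fst z' \<in> \<Sigma>0" "\<bar>snd z\<bar> < eps t" "\<bar>snd z'\<bar> < eps t"
    then show "c * norm (z - z') \<le> norm (H (s, z) - H (s, z'))"
      using c(2)[of s "fst z" "fst z'" z z'] dist_chart[of "fst z" "snd z"] dist_chart[of "fst z'" "snd z'"] by simp
  qed
qed

lemma chart_unique:
  assumes "0 \<le> t" "fst z \<in> \<Sigma>0" "fst z' \<in> \<Sigma>0" "\<bar>snd z\<bar> < eps t" "\<bar>snd z'\<bar> < eps t" "H (t, z) = H (t, z')"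
  shows "z = z'"
proof -
  obtain c where "c > 0" "c * norm (z - z') \<le> norm (H (t, z) - H (t, z'))"
    using chart_lower_bound[of t] assms horizon_gt[of t] by (metis atLeastAtMost_iff less_imp_le)
  then show ?thesis using assms(6) by (simp add: mult_le_0_iff)
qed

definition g :: "real \<times> (real^3) \<Rightarrow> (real^3) \<times> real" where
  "g q = (SOME z. is_chart q z)"

lemma g: "q \<in> \<Theta> \<Longrightarrow> is_chart q (g q)"
  unfolding g_def by (rule someI_ex[OF chart_exists])

lemma g_\<Sigma>0: "q \<in> \<Theta> \<Longrightarrow> fst (g q) \<in> \<Sigma>0" using g by (simp add: is_chart_def)

lemma g_eqI: "q \<in> \<Theta> \<Longrightarrow> is_chart q z \<Longrightarrow> g q = z"
  using g[of q] chart_unique[of "fst q" "g q" z] \<Theta>_nonneg[of "fst q" "snd q"] by (simp add: is_chart_def)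

text \<open>The implicit function theorem for the system \<open>H = (x, 0)\<close>. Its trivial
  kernel and its lower bound both come from the inequality in \<open>admissible\<close>, the kernel
  through \<open>has_derivative_lower_bound\<close>.\<close>

lemma C1_on_g: "C1_on spacetime \<Theta> g"
proof -
  obtain H' where H': "\<And>q. q \<in> {0..} \<times> (N \<times> UNIV) \<Longrightarrow>
      (H has_derivative blinfun_apply (H' q)) (at q within {0..} \<times> (N \<times> UNIV))"
    "continuous_on ({0..} \<times> (N \<times> UNIV)) H'"
    by (rule C1_onE[OF C1_on_H]) blast
  have oS: "open (N \<times> (UNIV :: real set))" by (intro open_Times open_N open_UNIV)
  show ?thesis
  proof (rule implicit_function_C1[where S = "N \<times> UNIV" and J = "\<lambda>x. (x, 0)", OF openin_\<Theta> H'])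
    show "bounded_linear (\<lambda>x::real^3. (x, 0::real))"
      by (intro bounded_linear_Pair bounded_linear_ident bounded_linear_zero)
    show "g q \<in> N \<times> UNIV" if "q \<in> \<Theta>" for q using g_\<Sigma>0[OF that] \<Sigma>0_sub by (auto simp: mem_Times_iff)
    show "H (fst q, g q) = (snd q, 0)" if "q \<in> \<Theta>" for q using g[OF that] by (simp add: is_chart_def)
  next
    fix q \<zeta> assume q: "q \<in> \<Theta>" and zero: "H' (fst q, g q) (0, \<zeta>) = 0"
    define t where "t = fst q"
    have t: "0 \<le> t" using q \<Theta>_nonneg[of t "snd q"] by (simp add: t_def)
    have ch: "fst (g q) \<in> \<Sigma>0" "\<bar>snd (g q)\<bar> < eps t" using g[OF q] by (auto simp: is_chart_def t_def)
    have gN: "g q \<in> N \<times> UNIV" using ch \<Sigma>0_sub by (auto simp: mem_Times_iff)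
    obtain c where c: "c > 0" "\<And>s k k' z z'. s \<in> {0..horizon t} \<Longrightarrow> k \<in> \<Sigma>0 \<Longrightarrow> k' \<in> \<Sigma>0 \<Longrightarrow>
        dist (k, 0) z < eps t \<Longrightarrow> dist (k', 0) z' < eps t \<Longrightarrow> c * norm (z - z') \<le> norm (H (s, z) - H (s, z'))"
      using admissible_lower[OF eps_admissible[of t]] by blast
    have "((\<lambda>z. H (t, z)) has_derivative (\<lambda>\<zeta>. H' (t, g q) (0, \<zeta>))) (at (g q))"
      by (rule slice_has_derivative[OF H'(1) t gN oS]) (use t gN in auto)
    then have "c * norm \<zeta> \<le> norm (H' (t, g q) (0, \<zeta>))"
    proof (rule has_derivative_lower_bound)
      \<comment> \<open>All points this close to \<open>g q\<close> lie within \<open>eps t\<close>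
        of \<open>(fst (g q), 0)\<close>, where the inequality holds.\<close>
      show "eps t - \<bar>snd (g q)\<bar> > 0" using ch by simp
      have gd: "dist (fst (g q), 0) (g q) = \<bar>snd (g q)\<bar>" using dist_chart[of "fst (g q)" "snd (g q)"] by simp
      fix z' assume "dist (g q) z' < eps t - \<bar>snd (g q)\<bar>"
      then have "dist (fst (g q), 0) z' < eps t"
        using dist_triangle[of "(fst (g q), 0)" z' "g q"] gd by simp
      then show "c * norm (z' - g q) \<le> norm (H (t, z') - H (t, g q))"
        using c(2)[of t "fst (g q)" "fst (g q)" z' "g q"] ch t gd horizon_gt[of t] by simp
    qed
    then have "c * norm \<zeta> \<le> 0" using zero by (simp add: t_def)
    then show "\<zeta> = 0" using c(1) by (simp add: mult_le_0_iff)
  next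
    fix q assume q: "q \<in> \<Theta>"
    obtain t x where q_eq: "q = (t, x)" by fastforce
    have ch: "is_chart (t, x) (g q)" using g[OF q] by (simp add: q_eq)
    obtain B where B: "openin (top_of_set spacetime) B" "q \<in> B"
      "\<And>s y. (s, y) \<in> B \<Longrightarrow> s < horizon t \<and> norm (y - X s (fst (g q))) < eps t"
      using \<Theta>_nbhd[of t x "fst (g q)"] q ch unfolding q_eq is_chart_def by (metis fst_conv snd_conv)
    then obtain d where d: "d > 0" "ball q d \<inter> spacetime \<subseteq> B"
      unfolding openin_contains_ball by blast
    obtain c where c: "c > 0" "\<And>s z z'. s \<in> {0..horizon t} \<Longrightarrow> fst z \<in> \<Sigma>0 \<Longrightarrow> fst z' \<in> \<Sigma>0 \<Longrightarrow>
      \<bar>snd z\<bar> < eps t \<Longrightarrow> \<bar>snd z'\<bar> < eps t \<Longrightarrow> c * norm (z - z') \<le> norm (H (s, z) - H (s, z'))"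
      using chart_lower_bound[of t] by blast
    have "c * norm (g q' - g q) \<le> norm (H (fst q', g q') - H (fst q', g q))" if q': "q' \<in> \<Theta>" "dist q' q < d" for q'
    proof -
      obtain s y where q'_eq: "q' = (s, y)" by fastforce
      have s: "0 \<le> s" using q'(1) \<Theta>_nonneg by (simp add: q'_eq)
      have "q' \<in> B" using d(2) q'(2) s by (auto simp: q'_eq dist_commute)
      then have "s < horizon t" "norm (y - X s (fst (g q))) < eps t" using B(3) by (auto simp: q'_eq)
      \<comment> \<open>At earlier times the radius may exceed \<open>eps t\<close>. Minimality at
        \<open>q'\<close>, compared with the initial point belonging to \<open>q\<close>, brings the
        distance below \<open>eps t\<close>.\<close>
      moreover have "\<bar>snd (g q')\<bar> \<le> norm (y - X s (fst (g q)))"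
        using g[OF q'(1)] ch by (auto simp: is_chart_def q'_eq)
      ultimately show ?thesis
        using c(2)[of s "g q'" "g q"] s g_\<Sigma>0[OF q'(1)] ch by (auto simp: q'_eq is_chart_def)
    qed
    then show "\<exists>d>0. \<exists>c>0. \<forall>q'\<in>\<Theta>. dist q' q < d \<longrightarrow>
        c * norm (g q' - g q) \<le> norm (H (fst q', g q') - H (fst q', g q))"
      using d(1) c(1) by blast
  qed
qed

section \<open>Signed distance, foot point and normal\<close>

definition \<phi> :: "real \<times> (real^3) \<Rightarrow> real" where "\<phi> q = snd (g q)"

definition foot :: "real \<times> (real^3) \<Rightarrow> real^3" where "foot q = X (fst q) (fst (g q))"

definition normal :: "real \<times> (real^3) \<Rightarrow> real^3" where "normal q = \<nu> (fst q) (fst (g q))"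

lemma g_N: "q \<in> \<Theta> \<Longrightarrow> (fst q, fst (g q)) \<in> {0..} \<times> N"
  using g_\<Sigma>0[of q] \<Sigma>0_sub \<Theta>_nonneg[of "fst q" "snd q"] by auto

lemma C1_on_\<Theta>_compose:
  assumes "C1_on spacetime ({0..} \<times> N) (\<lambda>q. f (fst q) (snd q))"
  shows "C1_on spacetime \<Theta> (\<lambda>q. f (fst q) (fst (g q)))"
proof -
  have "C1_on spacetime \<Theta> (\<lambda>q. (fst q, fst (g q)))"
    by (intro C1_on_Pair C1_on_bounded_linear bounded_linear_fst openin_\<Theta> C1_on_linear_compose[OF C1_on_g])
  from C1_on_compose[OF this assms] show ?thesis using g_N by fastforce
qed

lemma C1_on_foot: "C1_on spacetime \<Theta> foot"
  using C1_on_\<Theta>_compose[OF C1_on_X] by (simp add: foot_def[abs_def])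

lemma C1_on_normal: "C1_on spacetime \<Theta> normal"
  using C1_on_\<Theta>_compose[OF C1_on_\<nu>] by (simp add: normal_def[abs_def])

lemma foot_in: "q \<in> \<Theta> \<Longrightarrow> foot q \<in> \<Omega>"
  using X_solution(2) g_N[of q] N_sub by (auto simp: foot_def)

lemma norm_normal: "q \<in> \<Theta> \<Longrightarrow> norm (normal q) = 1"
  using norm_\<nu> g_N[of q] by (auto simp: normal_def)

lemma foot_plus_normal: "q \<in> \<Theta> \<Longrightarrow> foot q + \<phi> q *\<^sub>R normal q = snd q"
  using g[of q] by (auto simp: is_chart_def H_def foot_def \<phi>_def normal_def)

text \<open>Differentiating \<open>snd q = foot q + \<phi> q *\<^sub>R normal q\<close> and taking the inner product with the unit
  normal eliminates the derivatives of the foot point and of the normal.\<close>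

lemma \<phi>_deriv:
  assumes q: "q \<in> \<Theta>"
  shows "(\<phi> has_derivative (\<lambda>h. normal q \<bullet> snd h - fst h * (normal q \<bullet> v (fst q, foot q)))) (at q within \<Theta>)"
proof -
  define t where "t = fst q"
  define y where "y = fst (g q)"
  have ty: "0 \<le> t" "y \<in> N" "y \<in> \<Omega>" using g_N[OF q] N_sub by (auto simp: t_def y_def)
  obtain G where G: "(g has_derivative G) (at q within \<Theta>)"
    using C1_onE[OF C1_on_g] q by metis
  have Gs: "((\<lambda>q. fst (g q)) has_derivative (\<lambda>h. fst (G h))) (at q within \<Theta>)"
    "(\<phi> has_derivative (\<lambda>h. snd (G h))) (at q within \<Theta>)"
    unfolding \<phi>_def using has_derivative_fst[OF G] has_derivative_snd[OF G] by auto
  obtain V where V: "(normal has_derivative V) (at q within \<Theta>)"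
    using C1_onE[OF C1_on_normal] q by metis
  \<comment> \<open>The initial point stays on \<open>\<Sigma>0\<close> as \<open>q\<close> varies,
    so its derivative is tangential.\<close>
  have tangent: "n y \<bullet> fst (G h) = 0" for h
  proof -
    have "((\<lambda>q. \<phi>0 (fst (g q))) has_derivative (\<lambda>h. n y \<bullet> fst (G h))) (at q within \<Theta>)"
      by (rule has_derivative_compose[OF Gs(1)]) (use f_deriv[OF ty(2)] in \<open>simp add: y_def\<close>)
    moreover have "((\<lambda>q. \<phi>0 (fst (g q))) has_derivative (\<lambda>h. 0)) (at q within \<Theta>)"
    proof (rule has_derivative_transform[OF q])
      show "\<phi>0 (fst (g q)) = 0" if "q \<in> \<Theta>" for q
        using g_\<Sigma>0[OF that] zero_set \<Sigma>0_sub N_sub by auto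
    qed (rule has_derivative_const)
    ultimately show ?thesis using halfspace_derivative_unique[OF openin_\<Theta> q] by metis
  qed
  have unit: "normal q \<bullet> V h = 0" for h
  proof -
    have "((\<lambda>q. normal q \<bullet> normal q) has_derivative (\<lambda>h. normal q \<bullet> V h + V h \<bullet> normal q)) (at q within \<Theta>)"
      by (rule has_derivative_inner[OF V V])
    moreover have "((\<lambda>q. normal q \<bullet> normal q) has_derivative (\<lambda>h. 0)) (at q within \<Theta>)"
    proof (rule has_derivative_transform[OF q])
      show "normal q \<bullet> normal q = 1" if "q \<in> \<Theta>" for q
        using norm_normal[OF that] by (simp add: dot_square_norm)
    qed (rule has_derivative_const)
    ultimately have "(\<lambda>h. normal q \<bullet> V h + V h \<bullet> normal q) = (\<lambda>h. 0)"
      by (rule halfspace_derivative_unique[OF openin_\<Theta> q])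
    from fun_cong[OF this, of h] show ?thesis by (simp add: inner_commute)
  qed
  have foot': "(foot has_derivative (\<lambda>h. fst h *\<^sub>R v (t, foot q) + W t y (fst (G h)))) (at q within \<Theta>)"
  proof -
    have pair: "((\<lambda>q. (fst q, fst (g q))) has_derivative (\<lambda>h. (fst h, fst (G h)))) (at q within \<Theta>)"
      by (intro has_derivative_Pair Gs(1) bounded_linear_imp_has_derivative bounded_linear_fst)
    have "((\<lambda>q. (\<lambda>(t, \<xi>). X t \<xi>) (fst q, fst (g q))) has_derivative
        (\<lambda>h. (\<lambda>(\<tau>, \<eta>). \<tau> *\<^sub>R v (t, X t y) + W t y \<eta>) (fst h, fst (G h)))) (at q within \<Theta>)"
    proof (rule has_derivative_in_compose[OF pair])
      show "((\<lambda>(t, \<xi>). X t \<xi>) has_derivative (\<lambda>(\<tau>, \<eta>). \<tau> *\<^sub>R v (t, X t y) + W t y \<eta>))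
          (at (fst q, fst (g q)) within (\<lambda>q. (fst q, fst (g q))) ` \<Theta>)"
        unfolding t_def[symmetric] y_def[symmetric]
        by (rule has_derivative_subset[OF xflow.Z_has_derivative[OF ty(1,3)]]) (use g_N N_sub in fastforce)
    qed
    then show ?thesis by (simp add: foot_def[abs_def] t_def y_def)
  qed
  have "((\<lambda>q. foot q + \<phi> q *\<^sub>R normal q) has_derivative
      (\<lambda>h. (fst h *\<^sub>R v (t, foot q) + W t y (fst (G h))) + (\<phi> q *\<^sub>R V h + snd (G h) *\<^sub>R normal q))) (at q within \<Theta>)"
    by (intro has_derivative_add foot' has_derivative_scaleR Gs(2) V)
  moreover have "((\<lambda>q. foot q + \<phi> q *\<^sub>R normal q) has_derivative snd) (at q within \<Theta>)"
    by (rule has_derivative_transform[OF q foot_plus_normal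
          bounded_linear_imp_has_derivative[OF bounded_linear_snd]])
  ultimately have eq: "(\<lambda>h. (fst h *\<^sub>R v (t, foot q) + W t y (fst (G h))) + (\<phi> q *\<^sub>R V h + snd (G h) *\<^sub>R normal q)) = snd"
    by (rule halfspace_derivative_unique[OF openin_\<Theta> q])
  have "snd (G h) = normal q \<bullet> snd h - fst h * (normal q \<bullet> v (t, foot q))" for h
  proof -
    have "normal q \<bullet> snd h = normal q \<bullet>
        ((fst h *\<^sub>R v (t, foot q) + W t y (fst (G h))) + (\<phi> q *\<^sub>R V h + snd (G h) *\<^sub>R normal q))"
      using fun_cong[OF eq, of h] by simp
    moreover have "normal q \<bullet> W t y (fst (G h)) = 0"
      using \<nu>_tangent[OF ty(1,2) tangent] by (simp add: normal_def t_def y_def)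
    ultimately show ?thesis using unit[of h] norm_normal[OF q] by (simp add: inner_add_right dot_square_norm)
  qed
  then show ?thesis using Gs(2) by (simp add: t_def)
qed

lemma C2_on_\<phi>: "C2_on spacetime \<Theta> \<phi>"
  unfolding C2_on_def
proof (intro conjI openin_\<Theta> exI[of _ "\<lambda>q. blinfun_inner_right (- (normal q \<bullet> v (fst q, foot q)), normal q)"] ballI)
  show "(\<phi> has_derivative blinfun_apply (blinfun_inner_right (- (normal q \<bullet> v (fst q, foot q)), normal q))) (at q within \<Theta>)"
    if "q \<in> \<Theta>" for q
    by (rule has_derivative_eq_rhs[OF \<phi>_deriv[OF that]]) (simp add: fun_eq_iff mult.commute)
  have "C1_on spacetime \<Theta> (\<lambda>q. (fst q, foot q))"
    by (intro C1_on_Pair C1_on_foot C1_on_bounded_linear bounded_linear_fst openin_\<Theta>)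
  then have "C1_on spacetime \<Theta> (\<lambda>q. v (fst q, foot q))"
    by (rule C1_on_compose[OF _ C1_on_v]) (use foot_in \<Theta>_nonneg in auto)
  then show "C1_on spacetime \<Theta> (\<lambda>q. blinfun_inner_right (- (normal q \<bullet> v (fst q, foot q)), normal q))"
    by (intro C1_on_linear_compose[OF _ bounded_linear_blinfun_inner_right]
        C1_on_Pair C1_on_minus C1_on_inner C1_on_normal)
qed

section \<open>Spatial gradient, time derivative, initial values, signs and projection\<close>

lemma open_slice: "open {x. (t, x) \<in> \<Theta>}"
proof (cases "0 \<le> t")
  case True
  then have "{x. (t, x) \<in> \<Theta>} = (\<Union>\<xi>\<in>\<Sigma>0. ball (X t \<xi>) (eps t))"
    by (auto simp: \<Theta>_def dist_norm norm_minus_commute)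
  then show ?thesis by auto
qed (simp add: \<Theta>_def)

lemma grad_\<phi>:
  assumes "(t, x) \<in> \<Theta>"
  shows "grad (\<lambda>y. \<phi> (t, y)) x = normal (t, x)"
proof (rule grad_eqI)
  define D where "D = (\<lambda>h. normal (t, x) \<bullet> snd h - fst h * (normal (t, x) \<bullet> v (fst (t, x), foot (t, x))))"
  have "((\<lambda>y. \<phi> (t, y)) has_derivative (\<lambda>\<eta>. D (0, \<eta>))) (at x within {x. (t, x) \<in> \<Theta>})"
  proof (rule has_derivative_in_compose[where g = \<phi> and f = "\<lambda>y. (t, y)"])
    show "((\<lambda>y. (t, y)) has_derivative (\<lambda>\<eta>. (0, \<eta>))) (at x within {x. (t, x) \<in> \<Theta>})"
      by (auto intro!: derivative_eq_intros)
    show "(\<phi> has_derivative D) (at (t, x) within (\<lambda>y. (t, y)) ` {x. (t, x) \<in> \<Theta>})"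
      unfolding D_def by (rule has_derivative_subset[OF \<phi>_deriv[OF assms]]) auto
  qed
  then show "GDERIV (\<lambda>y. \<phi> (t, y)) x :> normal (t, x)"
    using at_within_open[OF _ open_slice, of x t] assms by (simp add: D_def gderiv_def inner_commute)
qed

lemma time_deriv_\<phi>:
  assumes q: "(t, x) \<in> \<Theta>" and t: "0 < t"
  shows "deriv (\<lambda>s. \<phi> (s, x)) t = - (v (t, foot (t, x)) \<bullet> normal (t, x))"
proof (rule DERIV_imp_deriv)
  obtain A where A: "open A" "\<Theta> = spacetime \<inter> A" using openin_\<Theta> by (auto simp: openin_open)
  \<comment> \<open>For \<open>t > 0\<close> the times are cut down to an open set, which gives the
    two-sided derivative in \<open>deriv\<close>.\<close>
  define B where "B = {0<..} \<inter> (\<lambda>s. (s, x)) -` A"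
  have B: "open B" unfolding B_def by (intro open_Int open_vimage A(1) continuous_intros open_greaterThan)
  have tB: "t \<in> B" using q t A by (auto simp: B_def)
  define D where "D = (\<lambda>h. normal (t, x) \<bullet> snd h - fst h * (normal (t, x) \<bullet> v (fst (t, x), foot (t, x))))"
  have "((\<lambda>s. \<phi> (s, x)) has_derivative (\<lambda>h. D (h, 0))) (at t within B)"
  proof (rule has_derivative_in_compose[where g = \<phi> and f = "\<lambda>s. (s, x)"])
    show "((\<lambda>s. (s, x)) has_derivative (\<lambda>h. (h, 0))) (at t within B)"
      by (auto intro!: derivative_eq_intros)
    show "(\<phi> has_derivative D) (at (t, x) within (\<lambda>s. (s, x)) ` B)"
      unfolding D_def by (rule has_derivative_subset[OF \<phi>_deriv[OF q]]) (auto simp: A B_def)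
  qed
  then have "((\<lambda>s. \<phi> (s, x)) has_derivative (\<lambda>h. h * - (v (t, foot (t, x)) \<bullet> normal (t, x)))) (at t)"
    using at_within_open[OF tB B] by (simp add: D_def inner_commute)
  then show "DERIV (\<lambda>s. \<phi> (s, x)) t :> - (v (t, foot (t, x)) \<bullet> normal (t, x))"
    unfolding has_field_derivative_def by (rule has_derivative_eq_rhs) (simp add: fun_eq_iff)
qed

lemma \<phi>_initial:
  assumes q: "(0, x) \<in> \<Theta>"
  shows "\<phi> (0, x) = \<phi>0 x"
proof -
  define \<xi> where "\<xi> = fst (g (0, x))"
  define r where "r = \<phi> (0, x)"
  have \<xi>: "\<xi> \<in> \<Sigma>0" "\<xi> \<in> N" "\<xi> \<in> \<Omega>" using g_\<Sigma>0[OF q] \<Sigma>0_sub N_sub by (auto simp: \<xi>_def)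
  have r: "\<bar>r\<bar> < eps 0" using g[OF q] by (simp add: r_def \<phi>_def is_chart_def)
  have "\<nu> 0 \<xi> = n \<xi>" using norm_n[OF \<xi>(2)] costate_init[OF \<xi>(3)] by (simp add: \<nu>_def p_def sgn_div_norm)
  then have x: "x = \<xi> + r *\<^sub>R n \<xi>"
    using foot_plus_normal[OF q] X_solution(1)[OF \<xi>(3)] by (simp add: foot_def normal_def r_def \<xi>_def)
  have "\<phi>0 x = \<phi>0 \<xi> + r"
    unfolding x
  proof (rule normal_line(2))
    fix \<tau> :: real assume "\<tau> \<in> {0..1}"
    then have "\<bar>\<tau> * r\<bar> \<le> \<bar>r\<bar>" by (simp add: abs_mult mult_left_le_one_le)
    \<comment> \<open>The segment from the foot point to \<open>x\<close> has to lie in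
      \<open>N\<close>. Admissibility speaks of points near \<open>(\<xi>, 0)\<close> in the product
      with the real line, hence the second component 0.\<close>
    then have "dist (\<xi>, 0 :: real) (\<xi> + (\<tau> * r) *\<^sub>R n \<xi>, 0) < eps 0"
      using r norm_n[OF \<xi>(2)] by (simp add: dist_Pair_Pair dist_norm)
    then show "\<xi> + (\<tau> * r) *\<^sub>R n \<xi> \<in> N"
      using admissible_N[OF eps_admissible \<xi>(1)] by blast
  qed
  then show ?thesis using zero_set[OF \<xi>(3)] \<xi>(1) by (simp add: r_def)
qed

lemma \<phi>_sign:
  assumes q: "(t, X t z) \<in> \<Theta>" and z: "z \<in> \<Omega>"
  shows "sgn (\<phi> (t, X t z)) = sgn (\<phi>0 z)"
proof -
  define \<xi> where "\<xi> = fst (g (t, X t z))"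
  have "\<xi> \<in> \<Sigma>0" "\<bar>\<phi> (t, X t z)\<bar> < eps t" using g[OF q] by (auto simp: \<phi>_def is_chart_def \<xi>_def)
  moreover have "X t z = X t \<xi> + \<phi> (t, X t z) *\<^sub>R \<nu> t \<xi>"
    using foot_plus_normal[OF q] by (simp add: foot_def normal_def \<xi>_def)
  moreover have "t \<in> {0..horizon t}" using \<Theta>_nonneg[OF q] horizon_gt[of t] by simp
  ultimately show ?thesis using admissible_sign[OF eps_admissible] z by blast
qed

lemma foot_nearest:
  assumes q: "(t, x) \<in> \<Theta>"
  shows "foot (t, x) \<in> X t ` \<Sigma>0" "norm (x - foot (t, x)) = \<bar>\<phi> (t, x)\<bar>"
    "y \<in> X t ` \<Sigma>0 \<Longrightarrow> norm (x - foot (t, x)) \<le> norm (x - y)"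
  using g[OF q] by (auto simp: is_chart_def foot_def \<phi>_def)

text \<open>A second nearest point would be the base of a second chart at the same point, which
  \<open>g_eqI\<close> excludes.\<close>

lemma metric_projection_foot:
  assumes q: "(t, x) \<in> \<Theta>"
  shows "metric_projection (X t ` \<Sigma>0) x = {foot (t, x)}"
proof -
  have inf: "(INF y\<in>X t ` \<Sigma>0. norm (x - y)) = norm (x - foot (t, x))"
  proof (rule cInf_eq_minimum)
    show "norm (x - foot (t, x)) \<in> (\<lambda>y. norm (x - y)) ` X t ` \<Sigma>0" by (rule imageI[OF foot_nearest(1)[OF q]])
  qed (use foot_nearest(3)[OF q] in auto)
  have "y = foot (t, x)" if "y \<in> X t ` \<Sigma>0" "norm (x - y) = norm (x - foot (t, x))" for y
  proof -
    obtain \<xi> where \<xi>: "\<xi> \<in> \<Sigma>0" "y = X t \<xi>" using \<open>y \<in> X t ` \<Sigma>0\<close> by blast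
    have "norm (x - X t \<xi>) \<le> norm (x - X t \<zeta>)" if "\<zeta> \<in> \<Sigma>0" for \<zeta>
      using foot_nearest(3)[OF q, of "X t \<zeta>"] that \<xi> \<open>norm (x - y) = _\<close> by auto
    then obtain r where "is_chart (t, x) (\<xi>, r)" using nearest_is_chart[OF q \<xi>(1)] by metis
    from g_eqI[OF q this] show ?thesis by (simp add: foot_def \<xi>)
  qed
  with foot_nearest(1)[OF q] have "{\<xi> \<in> X t ` \<Sigma>0. norm (x - \<xi>) = norm (x - foot (t, x))} = {foot (t, x)}"
    by blast
  then show ?thesis by (simp only: metric_projection_def inf)
qed

lemma min_distance_\<phi>:
  assumes q: "(t, x) \<in> \<Theta>"
  shows "min_distance (X t ` \<Sigma>0) x = \<bar>\<phi> (t, x)\<bar>"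
  unfolding min_distance_def
proof (rule Least_equality)
  show "\<exists>y\<in>X t ` \<Sigma>0. \<bar>\<phi> (t, x)\<bar> = norm (x - y)"
    using foot_nearest(1)[OF q] by (rule bexI[rotated]) (simp add: foot_nearest(2)[OF q])
  fix r assume "\<exists>y\<in>X t ` \<Sigma>0. r = norm (x - y)"
  then obtain y where "y \<in> X t ` \<Sigma>0" "r = norm (x - y)" by (elim bexE)
  then show "\<bar>\<phi> (t, x)\<bar> \<le> r" using foot_nearest(3)[OF q, of y] foot_nearest(2)[OF q] by simp
qed

lemma tubular_neighborhood_\<Theta>: "tubular_neighborhood \<Omega> (\<lambda>t. X t ` \<Sigma>0) \<Theta>"
proof -
  have sub: "x \<in> \<Omega>" if q: "(t, x) \<in> \<Theta>" for t x
  proof -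
    obtain \<xi> where "\<xi> \<in> \<Sigma>0" "x \<in> ball (X t \<xi>) (eps t)"
      using q by (auto simp: \<Theta>_def dist_norm norm_minus_commute)
    moreover have "t \<in> {0..horizon t}" using \<Theta>_nonneg[OF q] horizon_gt[of t] by simp
    ultimately show ?thesis using admissible_ball[OF eps_admissible] by blast
  qed
  have op: "open {x \<in> \<Omega>. (t, x) \<in> \<Theta>}" for t
    using open_slice[of t] open_\<Omega> by (simp add: Collect_conj_eq open_Int)
  have tube: "(t, y) \<in> \<Theta>" if "0 \<le> t" "x \<in> X t ` \<Sigma>0" "y \<in> ball x (eps t)" for t x y
    using that by (auto simp: \<Theta>_def dist_norm norm_minus_commute)
  show ?thesis
    unfolding tubular_neighborhood_def
  proof (intro conjI exI[of _ eps] allI impI)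
    show "\<Theta> \<subseteq> {0..} \<times> \<Omega>" using sub \<Theta>_nonneg by force
    have "(t, x) \<in> \<Theta>" if "0 \<le> t" "x \<in> X t ` \<Sigma>0" for t x
      using tube[OF that, of x] eps_pos by simp
    then show "(\<Union>t\<in>{0..}. {t} \<times> X t ` \<Sigma>0) \<subseteq> \<Theta>" by blast
    show "antimono_on {0..} eps" by (auto intro!: monotone_onI eps_antimono)
    show "{t} \<times> (\<Union>x\<in>X t ` \<Sigma>0. ball x (eps t)) \<subseteq> \<Theta>" if "0 \<le> t" for t
      using tube[OF that] by blast
  qed (use op eps_pos in auto)
qed

end

theorem corollary2p5:
  fixes \<Omega> \<Omega>p \<Omega>m \<Sigma>0 :: "(real^3) set"
    and v :: "real \<times> (real^3) \<Rightarrow> real^3"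
    and \<phi>0 :: "real^3 \<Rightarrow> real"
    and \<Omega>plus \<Omega>minus \<Sigma> :: "real \<Rightarrow> (real^3) set"
  assumes \<Omega>: "open \<Omega>" "connected \<Omega>" "bounded \<Omega>"
    and v: "H1 \<Omega> v" "H2 \<Omega> v"
    and \<Omega>p: "open \<Omega>p" "connected \<Omega>p" "\<Omega>p \<noteq> {}" "\<Omega>p \<subseteq> \<Omega>"
    and \<Sigma>0: "\<Sigma>0 = frontier \<Omega>p" "closed_C2_surface \<Sigma>0" "\<Sigma>0 \<inter> frontier \<Omega> = {}"
    and \<Omega>m: "\<Omega>m = \<Omega> - (\<Omega>p \<union> \<Sigma>0)"
    and moving: "\<Omega>plus = transported \<Omega> v \<Omega>p" "\<Omega>minus = transported \<Omega> v \<Omega>m"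
      "\<Sigma> = transported \<Omega> v \<Sigma>0"
    and \<phi>0_sign: "\<forall>x\<in>\<Omega>p. \<phi>0 x > 0" "\<forall>x\<in>\<Omega>m. \<phi>0 x < 0" "{x \<in> \<Omega>. \<phi>0 x = 0} = \<Sigma>0"
    and \<phi>0_grad: "\<forall>x\<in>\<Sigma>0. grad \<phi>0 x \<noteq> 0"
    and \<phi>0_C2: "\<exists>N. open N \<and> \<Sigma>0 \<subseteq> N \<and> N \<subseteq> \<Omega> \<and> C2_on UNIV N \<phi>0 \<and>
      (\<forall>x\<in>N. norm (grad \<phi>0 x) = 1)"
  shows "\<exists>\<Theta> (\<phi> :: real \<times> (real^3) \<Rightarrow> real).
    tubular_neighborhood \<Omega> \<Sigma> \<Theta> \<and> C2_on spacetime \<Theta> \<phi> \<and>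
    \<comment> \<open>(a)\<close>
    (\<forall>(t, x)\<in>\<Theta>. t > 0 \<longrightarrow>
       x - \<phi> (t, x) *\<^sub>R grad (\<lambda>y. \<phi> (t, y)) x \<in> closure \<Omega> \<and>
       deriv (\<lambda>s. \<phi> (s, x)) t
         + v (t, x - \<phi> (t, x) *\<^sub>R grad (\<lambda>y. \<phi> (t, y)) x) \<bullet> grad (\<lambda>y. \<phi> (t, y)) x = 0) \<and>
    (\<forall>x. (0, x) \<in> \<Theta> \<longrightarrow> \<phi> (0, x) = \<phi>0 x) \<and>
    (\<forall>(t, x)\<in>\<Theta>. norm (grad (\<lambda>y. \<phi> (t, y)) x) = 1) \<and>
    (\<forall>(t, x)\<in>\<Theta>. (x \<in> \<Omega>plus t \<longrightarrow> \<phi> (t, x) > 0) \<and> (x \<in> \<Omega>minus t \<longrightarrow> \<phi> (t, x) < 0)) \<and>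
    \<comment> \<open>(b)\<close>
    (\<forall>(t, x)\<in>\<Theta>. is_singleton (metric_projection (\<Sigma> t) x)) \<and>
    C1_on spacetime \<Theta> (\<lambda>(t, x). the_elem (metric_projection (\<Sigma> t) x)) \<and>
    \<comment> \<open>(c), where the initial condition is the one already stated in (a)\<close>
    (\<forall>(t, x)\<in>\<Theta>. t > 0 \<longrightarrow>
       deriv (\<lambda>s. \<phi> (s, x)) t
         + v (t, the_elem (metric_projection (\<Sigma> t) x)) \<bullet> grad (\<lambda>y. \<phi> (t, y)) x = 0) \<and>
    \<comment> \<open>(d)\<close>
    (\<forall>(t, x)\<in>\<Theta>.
       (x \<in> \<Omega>plus t \<longrightarrow> \<phi> (t, x) = min_distance (\<Sigma> t) x) \<and>
       (x \<in> \<Omega>minus t \<longrightarrow> \<phi> (t, x) = - min_distance (\<Sigma> t) x) \<and>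
       (x \<in> \<Sigma> t \<longrightarrow> \<phi> (t, x) = 0))"
proof -
  obtain N where N: "open N" "\<Sigma>0 \<subseteq> N" "N \<subseteq> \<Omega>" "C2_on UNIV N \<phi>0" "\<And>x. x \<in> N \<Longrightarrow> norm (grad \<phi>0 x) = 1"
    using \<phi>0_C2 by blast
  obtain f' where f': "\<And>y. y \<in> N \<Longrightarrow> (\<phi>0 has_derivative blinfun_apply (f' y)) (at y)" "C1_on UNIV N f'"
  proof -
    obtain f' where "\<And>y. y \<in> N \<Longrightarrow> (\<phi>0 has_derivative blinfun_apply (f' y)) (at y within N)" "C1_on UNIV N f'"
      using N(4) unfolding C2_on_def by (elim conjE exE) blast
    then show ?thesis using that at_within_open[OF _ N(1)] by metis
  qed
  \<comment> \<open>The Riesz vector of the derivative. It depends linearly on \<open>f'\<close>, so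
    the gradient field inherits its regularity.\<close>
  define n where "n y = (\<Sum>b\<in>Basis. f' y b *\<^sub>R b)" for y
  have fn: "blinfun_apply (f' y) = (\<lambda>\<eta>. n y \<bullet> \<eta>)" for y
  proof
    fix \<eta>
    have "f' y \<eta> = f' y (\<Sum>b\<in>Basis. (\<eta> \<bullet> b) *\<^sub>R b)" by (simp add: euclidean_representation)
    also have "\<dots> = n y \<bullet> \<eta>"
      by (simp add: n_def blinfun.sum_right blinfun.scaleR_right inner_sum_left inner_commute[of \<eta>] mult.commute)
    finally show "f' y \<eta> = n y \<bullet> \<eta>" .
  qed
  have "bounded_linear (\<lambda>F :: (real^3) \<Rightarrow>\<^sub>L real. \<Sum>b\<in>Basis. F b *\<^sub>R b)"
    by (intro bounded_linear_sum bounded_linear_compose[OF bounded_linear_scaleR_left blinfun.bounded_linear_left])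
  from C1_on_linear_compose[OF f'(2) this] have "C1_on UNIV N n" by (simp add: n_def[abs_def])
  then obtain Dn where Dn: "\<And>y. y \<in> N \<Longrightarrow> (n has_derivative blinfun_apply (Dn y)) (at y)" "continuous_on N Dn"
    using at_within_open[OF _ N(1)] by (metis C1_onE)
  have grad_n: "grad \<phi>0 y = n y" if "y \<in> N" for y
    using f'(1)[OF that] by (intro grad_eqI) (simp add: gderiv_def fn inner_commute)
  obtain L v' D2v where vf: "velocity_field \<Omega> v L v' D2v" using H1_velocity_field[OF \<Omega> v] by blast
  have eik: "eikonal N \<phi>0 n Dn"
  proof
    show "(\<phi>0 has_derivative (\<lambda>\<eta>. n y \<bullet> \<eta>)) (at y)" if "y \<in> N" for y using f'(1)[OF that] by (simp add: fn)
    show "norm (n y) = 1" if "y \<in> N" for y using N(5)[OF that] grad_n[OF that] by simp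
  qed (use N Dn in auto)
  have "moving_interface_axioms \<Omega> N \<phi>0 \<Sigma>0"
    using N(2,3) \<Sigma>0(2) \<phi>0_sign(3) by unfold_locales (auto simp: closed_C2_surface_def)
  with vf eik interpret mi: moving_interface \<Omega> v L v' D2v N \<phi>0 n Dn \<Sigma>0
    by (rule moving_interface.intro)
  have image: "transported \<Omega> v A = (\<lambda>t. mi.X t ` A)" for A
    by (simp add: fun_eq_iff transported_def mi.X_def)
  have pos: "mi.\<phi> (t, x) > 0" if q: "(t, x) \<in> mi.\<Theta>" and x: "x \<in> \<Omega>plus t" for t x
  proof -
    obtain z where z: "z \<in> \<Omega>p" "x = mi.X t z" using x by (auto simp: moving image)
    then have "sgn (mi.\<phi> (t, x)) = sgn (\<phi>0 z)" using mi.\<phi>_sign[of t z] q \<Omega>p(4) by auto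
    then show ?thesis using \<phi>0_sign(1) z(1) by (simp add: sgn_1_pos)
  qed
  have neg: "mi.\<phi> (t, x) < 0" if q: "(t, x) \<in> mi.\<Theta>" and x: "x \<in> \<Omega>minus t" for t x
  proof -
    obtain z where z: "z \<in> \<Omega>m" "x = mi.X t z" using x by (auto simp: moving image)
    then have "sgn (mi.\<phi> (t, x)) = sgn (\<phi>0 z)" using mi.\<phi>_sign[of t z] q \<Omega>m by auto
    then show ?thesis using \<phi>0_sign(2) z(1) by (simp add: sgn_1_neg)
  qed
  \<comment> \<open>A point of the interface is its own competitor, at distance 0.\<close>
  have zero: "mi.\<phi> (t, x) = 0" if q: "(t, x) \<in> mi.\<Theta>" and x: "x \<in> \<Sigma> t" for t x
    using mi.foot_nearest(2)[OF q] mi.foot_nearest(3)[OF q, of x] x by (simp add: moving image)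
  have foot: "x - mi.\<phi> (t, x) *\<^sub>R mi.normal (t, x) = mi.foot (t, x)" if "(t, x) \<in> mi.\<Theta>" for t x
    using mi.foot_plus_normal[OF that] by (simp add: algebra_simps)
  have proj: "metric_projection (\<Sigma> t) x = {mi.foot (t, x)}" if "(t, x) \<in> mi.\<Theta>" for t x
    using mi.metric_projection_foot[OF that] by (simp add: moving image)
  have dist: "min_distance (\<Sigma> t) x = \<bar>mi.\<phi> (t, x)\<bar>" if "(t, x) \<in> mi.\<Theta>" for t x
    using mi.min_distance_\<phi>[OF that] by (simp add: moving image)
  have closure: "mi.foot (t, x) \<in> closure \<Omega>" if "(t, x) \<in> mi.\<Theta>" for t x
    using mi.foot_in[OF that] closure_subset by blast
  show ?thesis
  proof (intro exI[of _ mi.\<Theta>] exI[of _ mi.\<phi>] conjI)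
    show "tubular_neighborhood \<Omega> \<Sigma> mi.\<Theta>" using mi.tubular_neighborhood_\<Theta> by (simp add: moving image)
    show "C2_on spacetime mi.\<Theta> mi.\<phi>" by (rule mi.C2_on_\<phi>)
    show "C1_on spacetime mi.\<Theta> (\<lambda>(t, x). the_elem (metric_projection (\<Sigma> t) x))"
      by (rule C1_on_cong[OF mi.C1_on_foot]) (auto simp: proj)
  qed (auto simp: foot proj dist closure mi.grad_\<phi> mi.norm_normal mi.time_deriv_\<phi> mi.\<phi>_initial zero
      pos neg abs_of_pos[OF pos] abs_of_neg[OF neg])
qed

end
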